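(* Let $\mathbb{K}$ be a field and $S=\mathbb{K}[x_1,x_2,x_3]$ (so $\ell=3$). Let $\mathcal{A}$ be a free arrangement in $\mathbb{K}^3$ with $\exp(\mathcal{A})=(d_1,d_2,d_3)$, let $H_1=\ker\alpha_1$ and $H_2=\ker\alpha_2$ be two distinct hyperplanes of $\mathcal{A}$, and put $\mathcal{A}_1=\mathcal{A}\setminus\{H_1\}$, $\mathcal{A}_2=\mathcal{A}\setminus\{H_2\}$, $\mathcal{A}_{1,2}=\mathcal{A}\setminus\{H_1,H_2\}$. Assume that $\mathcal{A}_1$ and $\mathcal{A}_2$ are SPOG with levels $c_1$ and $c_2$ respectively, with $c_1\le c_2$. Then $\mathcal{A}_{1,2}$ is not free, and $D(\mathcal{A}_{1,2})$ has a minimal free resolution of one of the following forms. (1) Suppose $|\mathcal{A}_{H_1\cap H_2}|=2$. Then there exist $f_i,g_i\in S$ ($i=1,2,3$) such that $$0\to S[-c_1-1]\oplus S[-c_2-1]\xrightarrow{\begin{array}{c}(\alpha_1,0,f_1,f_2,f_3)\\(0,\alpha_2,g_1,g_2,g_3)\end{array}} S[-c_1]\oplus S[-c_2]\oplus\Big(\bigoplus_{i=1}^3 S[-d_i]\Big)\to D(\mathcal{A}_{1,2})\to 0$$ is a minimal free resolution. (2) Suppose $|\mathcal{A}_{H_1\cap H_2}|>2$. (2.1) If $c_1=c_2$, there exist $f_1,f_2,f_3\in S$ such that $$0\to S[-c_1-1]\xrightarrow{(\alpha_1\alpha_2,f_1,f_2,f_3)} S[-c_1+1]\oplus\Big(\bigoplus_{i=1}^3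 S[-d_i]\Big)\to D(\mathcal{A}_{1,2})\to 0$$ is a minimal free resolution. Moreover, $\mathcal{A}_{1,2}$ is SPOG if and only if $c_1=c_2=\max\{d_1,d_2,d_3\}$. If $\mathcal{A}_{1,2}$ is SPOG and (labelling the exponents so that) $d_2=\max\{d_1,d_2,d_3\}$, then $f_2\in S_1$. (2.2) If $c_1<c_2$, there exist $f_i,g_i,g\in S$ ($i=1,2,3$) with $g\neq 0$ such that $$0\to S[-c_1-1]\oplus S[-c_2]\xrightarrow{\begin{array}{c}(\alpha_1,0,f_1,f_2,f_3)\\(g,\alpha_2,g_1,g_2,g_3)\end{array}} S[-c_1]\oplus S[-c_2+1]\oplus\Big(\bigoplus_{i=1}^3 S[-d_i]\Big)\to D(\mathcal{A}_{1,2})\to 0$$ is a minimal free resolution.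
   Context: Let $V=\mathbb{K}^\ell$ and $S=\mathbb{K}[x_1,\ldots,x_\ell]$ with the usual grading, $S_d$ the degree-$d$ part, $S[-d]$ the graded free module with generator in degree $d$. A (central) hyperplane arrangement $\mathcal{A}$ is a finite set of linear hyperplanes in $V$; for $H\in\mathcal{A}$, $\alpha_H\in S_1$ is a linear form with $H=\ker\alpha_H$. $D(\mathcal{A})=\{\theta\in\mathrm{Der}\,S\mid\theta(\alpha_H)\in S\alpha_H\ \forall H\in\mathcal{A}\}$, where $\mathrm{Der}\,S=\bigoplus_i S\partial_{x_i}$; a derivation $\sum f_i\partial_{x_i}$ is homogeneous of degree $d$ if all $f_i\in S_d$. $\mathcal{A}$ is free with exponents $\exp(\mathcal{A})=(d_1,\ldots,d_\ell)$ if $D(\mathcal{A})$ is a free $S$-module with homogeneous basis $\theta_1,\ldots,\theta_\ell$, $\deg\theta_i=d_i$. For a subspace $X$ that is an intersection of hyperplanes of $\mathcal{A}$, $\mathcal{A}_X=\{H\in\mathcal{A}\mid X\subset H\}$. An arrangement $\mathcal{B}$ is SPOG (strictly plus-one generated) with exponents $\mathrm{POexp}(\mathcal{B})=(p_1,\ldots,p_\ell)$ and level $d$ if there exist $f_1,\ldots,f_\ell,\alpha\in S$ with $\alpha\ne0$ such that $D(\mathcal{B})$ has a minimal free resolution $0\to S[-d-1]\xrightarrow{(\alpha,f_1,\ldots,f_\ell)}S[-d]\oplus\bigoplus_{i=1}^{\ell}S[-p_i]\to D(\mathcal{B})\to0$. In the displayed resolutions, each row of the matrix is the image of the corresponding generator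 of the left-hand free module, i.e. a relation among the minimal generators of $D$. *)

theory Defs
  imports "HOL-Analysis.Analysis" "HOL-Library.Poly_Mapping"
begin

section \<open>The polynomial ring\<close>

text \<open>
  The ring \<open>S = K[x\<^sub>i | i :: 'n]\<close> is the monoid algebra of the exponent vectors \<open>'n \<Rightarrow>\<^sub>0 nat\<close>; the
  multiplication of \<open>poly_mapping\<close> is convolution.
\<close>

type_synonym ('n, 'k) mpoly = "('n \<Rightarrow>\<^sub>0 nat) \<Rightarrow>\<^sub>0 'k"

definition monom_degree :: "('n::finite \<Rightarrow>\<^sub>0 nat) \<Rightarrow> nat" where
  "monom_degree m = (\<Sum>i\<in>UNIV. Poly_Mapping.lookup m i)"

text \<open>
  \<open>graded_part k\<close> is \<open>S\<^sub>k\<close>, zero polynomial included.  The degree is an integer because shifts such as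
  \<open>S[-c+1]\<close> and differences of shifts occur below; \<open>S\<^sub>k = {0}\<close> for \<open>k < 0\<close>.
\<close>

definition graded_part :: "int \<Rightarrow> ('n::finite, 'k::comm_ring_1) mpoly set" where
  "graded_part k = {p. \<forall>m\<in>Poly_Mapping.keys p. int (monom_degree m) = k}"

definition poly_eval :: "('n::finite, 'k::comm_ring_1) mpoly \<Rightarrow> 'k ^ 'n \<Rightarrow> 'k" where
  "poly_eval p v =
    (\<Sum>m\<in>Poly_Mapping.keys p. Poly_Mapping.lookup p m * (\<Prod>i\<in>UNIV. (v $ i) ^ Poly_Mapping.lookup m i))"

definition zero_locus :: "('n::finite, 'k::comm_ring_1) mpoly \<Rightarrow> ('k ^ 'n) set" where
  "zero_locus p = {v. poly_eval p v = 0}"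

text \<open>
  In \<open>partial_deriv\<close> the truncated subtraction \<open>m - single i 1\<close> is harmless: if \<open>x\<^sub>i\<close> does not occur in
  the monomial \<open>m\<close>, then the coefficient vanishes.
\<close>

definition partial_deriv :: "'n::finite \<Rightarrow> ('n, 'k::comm_ring_1) mpoly \<Rightarrow> ('n, 'k) mpoly" where
  "partial_deriv i p =
    (\<Sum>m\<in>Poly_Mapping.keys p. Poly_Mapping.single (m - Poly_Mapping.single i 1)
       (of_nat (Poly_Mapping.lookup m i) * Poly_Mapping.lookup p m))"

section \<open>Arrangements and logarithmic derivations\<close>

definition linear_hyperplane :: "('k::field ^ 'n::finite) set \<Rightarrow> bool" where
  "linear_hyperplane H \<longleftrightarrow> (\<exists>\<alpha>\<in>graded_part 1. \<alpha> \<noteq> 0 \<and> H = zero_locus \<alpha>)"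

definition arrangement :: "('k::field ^ 'n::finite) set set \<Rightarrow> bool" where
  "arrangement A \<longleftrightarrow> finite A \<and> (\<forall>H\<in>A. linear_hyperplane H)"

definition localization :: "('k::field ^ 'n::finite) set set \<Rightarrow> ('k ^ 'n) set \<Rightarrow> ('k ^ 'n) set set" where
  "localization A X = {H \<in> A. X \<subseteq> H}"

text \<open>
  \<open>Der S\<close> is the free module \<open>S\<^sup>n\<close> on the \<open>\<partial>\<^sub>i\<close>: a derivation is its vector of coefficients.
\<close>

type_synonym ('n, 'k) deriv = "('n, 'k) mpoly ^ 'n"

definition apply_deriv :: "('n::finite, 'k::comm_ring_1) deriv \<Rightarrow> ('n, 'k) mpoly \<Rightarrow> ('n, 'k) mpoly" where
  "apply_deriv \<theta> p = (\<Sum>i\<in>UNIV. \<theta> $ i * partial_deriv i p)"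

definition homogeneous_deriv :: "int \<Rightarrow> ('n::finite, 'k::comm_ring_1) deriv \<Rightarrow> bool" where
  "homogeneous_deriv k \<theta> \<longleftrightarrow> (\<forall>i. \<theta> $ i \<in> graded_part k)"

text \<open>
  The linear form defining a hyperplane is unique up to a nonzero scalar, so quantifying over all of
  them is the same as choosing one for each hyperplane.
\<close>

definition log_derivs :: "('k::field ^ 'n::finite) set set \<Rightarrow> ('n, 'k) deriv set" where
  "log_derivs A = {\<theta>. \<forall>H\<in>A. \<forall>\<alpha>\<in>graded_part 1. H = zero_locus \<alpha> \<longrightarrow> \<alpha> dvd apply_deriv \<theta> \<alpha>}"

section \<open>Freeness\<close>

interpretation vecmod: module "(*s) :: 'a::comm_ring_1 \<Rightarrow> 'a ^ 'n::finite \<Rightarrow> 'a ^ 'n"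
  by unfold_locales (simp_all add: vec_eq_iff algebra_simps)

definition free_arrangement :: "('k::field ^ 'n::finite) set set \<Rightarrow> bool" where
  "free_arrangement A \<longleftrightarrow>
    (\<exists>B. \<not> vecmod.dependent B \<and> vecmod.span B = log_derivs A)"

definition free_with_exponents :: "('k::field ^ 'n::finite) set set \<Rightarrow> nat ^ 'n \<Rightarrow> bool" where
  "free_with_exponents A d \<longleftrightarrow>
    (\<exists>\<theta> :: 'n \<Rightarrow> ('n, 'k) deriv.
      inj \<theta> \<and> \<not> vecmod.dependent (range \<theta>) \<and> vecmod.span (range \<theta>) = log_derivs A \<and>
      (\<forall>i. homogeneous_deriv (int (d $ i)) (\<theta> i)))"

section \<open>Minimal free resolutions of length one\<close>

text \<open>
  \<open>minimal_free_resolution b a M D\<close> says that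
  \<open>0 \<rightarrow> \<Oplus>\<^sub>j S[-b\<^sub>j] \<rightarrow> \<Oplus>\<^sub>i S[-a\<^sub>i] \<rightarrow> D \<rightarrow> 0\<close> is a minimal graded free resolution of the graded submodule
  \<open>D\<close> of \<open>Der S\<close> for some second map, where the first map is \<open>e \<mapsto> e v* M\<close>; the rows of \<open>M\<close> are the
  images of the generators of the left-hand module.  The second map is \<open>c \<mapsto> c v* \<Theta>\<close>, the rows of
  \<open>\<Theta>\<close> being the images of the generators of the middle module.  The conditions are, in order:
  both maps are homogeneous of degree \<open>0\<close>; exactness at the three places; minimality, that is, the
  image of the first map lies in the product of the middle module with the irrelevant maximal ideal
  (the polynomials without constant term).
\<close>

definition minimal_free_resolution ::
  "int ^ 'q::finite \<Rightarrow> int ^ 'p::finite \<Rightarrow> ('n::finite, 'k::field) mpoly ^ 'p ^ 'q \<Rightarrow>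
   ('n, 'k) deriv set \<Rightarrow> bool" where
  "minimal_free_resolution b a M D \<longleftrightarrow>
    (\<exists>\<Theta> :: ('n, 'k) mpoly ^ 'n ^ 'p.
      (\<forall>j i. M $ j $ i \<in> graded_part (b $ j - a $ i)) \<and>
      (\<forall>i. homogeneous_deriv (a $ i) (\<Theta> $ i)) \<and>
      inj (\<lambda>e. e v* M) \<and>
      range (\<lambda>e. e v* M) = {c. c v* \<Theta> = 0} \<and>
      range (\<lambda>c. c v* \<Theta>) = D \<and>
      (\<forall>j i. Poly_Mapping.lookup (M $ j $ i) 0 = 0))"

text \<open>
  In \<open>SPOG\<close> the middle module \<open>S[-d] \<oplus> \<Oplus>\<^sub>i S[-p\<^sub>i]\<close> is indexed by \<open>'n option\<close>, the summand \<open>S[-d]\<close>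
  belonging to \<open>None\<close>.
\<close>

definition SPOG :: "('k::field ^ 'n::finite) set set \<Rightarrow> nat ^ 'n \<Rightarrow> nat \<Rightarrow> bool" where
  "SPOG A p d \<longleftrightarrow>
    (\<exists>\<alpha> (f :: ('n, 'k) mpoly ^ 'n). \<alpha> \<noteq> 0 \<and>
      minimal_free_resolution
        ((\<chi> j. int d + 1) :: int ^ 1)
        (\<chi> i. case i of None \<Rightarrow> int d | Some k \<Rightarrow> int (p $ k))
        (\<chi> j i. case i of None \<Rightarrow> \<alpha> | Some k \<Rightarrow> f $ k)
        (log_derivs A))"

end

theory Submission
  imports Defs
begin

text \<open>
  Let \<open>F = D(A)\<close> with homogeneous basis \<open>\<theta>\<^sub>1, \<theta>\<^sub>2, \<theta>\<^sub>3\<close>.  Since a factor \<open>\<alpha>\<^sub>1\<close> can be cancelled in the conditions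
  that come from the other hyperplanes, the modules of the deletions are described by \<open>F\<close>:
  \<open>M\<^sub>1 = D(A - {H\<^sub>1}) = {x | \<alpha>\<^sub>1 x \<in> F}\<close>, likewise \<open>M\<^sub>2\<close>, and
  \<open>M\<^sub>1\<^sub>2 = D(A - {H\<^sub>1, H\<^sub>2}) = {x | \<alpha>\<^sub>1 x \<in> M\<^sub>2} = {x | \<alpha>\<^sub>2 x \<in> M\<^sub>1}\<close>.

  One deletion.  The module \<open>M\<^sub>1 / F\<close> is cyclic (\<open>generator_exists\<close>): restricting to a line of the plane
  \<open>\<alpha>\<^sub>1 = 0\<close> shows that an element of least degree generates it.  So \<open>M\<^sub>1 = F + S \<phi>\<^sub>1\<close> with a single relation
  \<open>\<alpha>\<^sub>1 \<phi>\<^sub>1 = \<Sum> f\<^sub>i \<theta>\<^sub>i\<close>.  As \<open>A - {H\<^sub>1}\<close> is SPOG, \<open>M\<^sub>1\<close> is not free, the \<open>f\<^sub>i\<close> have no constant terms, and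
  uniqueness of the minimal resolution forces \<open>deg \<phi>\<^sub>1 = c\<^sub>1\<close>.  The Euler derivation, together with a second
  hyperplane, shows that \<open>f\<^sub>i \<noteq> 0\<close> as soon as \<open>d\<^sub>i \<ge> 2\<close>; whence \<open>d\<^sub>i \<le> c\<^sub>1\<close> for all \<open>i\<close>
  (\<open>generator_degree_bounds\<close>).

  Two deletions.  Multiplication by \<open>\<alpha>\<^sub>1\<close> embeds \<open>M\<^sub>1\<^sub>2 / M\<^sub>1\<close> into \<open>M\<^sub>2 / F = S/(\<alpha>\<^sub>2) \<phi>\<^sub>2\<close> as an ideal that contains
  \<open>\<alpha>\<^sub>1\<close>.  Modulo \<open>\<alpha>\<^sub>1\<close> such an ideal is generated by a power of the coordinate on the axis \<open>H\<^sub>1 \<inter> H\<^sub>2\<close>, or it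
  is zero, which means \<open>M\<^sub>1\<^sub>2 = M\<^sub>1 + M\<^sub>2\<close>.  A descent in the degree (\<open>descent_step\<close>, where \<open>c\<^sub>1 \<le> c\<^sub>2\<close> is used)
  shows that no positive power occurs.  Hence either \<open>M\<^sub>1\<^sub>2 = F + S \<phi>\<^sub>1 + S \<phi>\<^sub>2\<close>, or there is a \<open>\<psi> \<in> M\<^sub>1\<^sub>2\<close> of degree
  \<open>c\<^sub>2 - 1\<close> such that \<open>\<alpha>\<^sub>1 \<psi>\<close> may serve as \<open>\<phi>\<^sub>2\<close>, and \<open>M\<^sub>1\<^sub>2 = F + S \<phi>\<^sub>1 + S \<psi>\<close> with \<open>\<alpha>\<^sub>2 \<psi> = h \<phi>\<^sub>1\<close> modulo \<open>F\<close>, where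
  \<open>h \<noteq> 0\<close> has degree \<open>c\<^sub>2 - c\<^sub>1\<close>.  If \<open>c\<^sub>1 = c\<^sub>2\<close>, then \<open>h\<close> is a unit and \<open>\<phi>\<^sub>1\<close> can be dropped.

  The first alternative occurs exactly if no third hyperplane contains the axis.  This is decided by
  evaluating on \<open>\<alpha>\<^sub>1\<close> or \<open>\<alpha>\<^sub>2\<close> a product of linear forms times a constant derivation
  (\<open>decomposable_if_generic\<close>, \<open>indecomposable_if_special\<close>).

  In each case the relations are read off; that they have no constant terms was shown for those of \<open>\<phi>\<^sub>1\<close>
  and \<open>\<phi>\<^sub>2\<close>, and for that of \<open>\<psi>\<close> it follows from the degree bounds or from the relation of \<open>\<alpha>\<^sub>1 \<psi>\<close>.  A module
  with a minimal resolution of length one is not free, because a splitting of the resolution would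
  produce a unit in its matrix (\<open>minimal_resolution_not_split\<close>).  Finally, let \<open>c\<^sub>1 = c\<^sub>2\<close> in the second
  alternative.  Comparing resolutions with one relation shows that \<open>A - {H\<^sub>1, H\<^sub>2}\<close> can only be SPOG if \<open>c\<^sub>1\<close> is
  one of the exponents, hence the largest.  Conversely, if
  \<open>c\<^sub>1 = max d\<^sub>i\<close>, some basis element of this degree occurs in the relation, with a linear coefficient.
\<close>

section \<open>Constants and monomials\<close>

abbreviation cpoly :: "'k \<Rightarrow> ('n, 'k::zero) mpoly" where
  "cpoly \<equiv> Poly_Mapping.single 0"

lemma sum_monomials:
  "p = (\<Sum>m\<in>Poly_Mapping.keys p. Poly_Mapping.single m (Poly_Mapping.lookup p m))"
proof (rule poly_mapping_eqI)
  fix k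
  show "Poly_Mapping.lookup p k =
    Poly_Mapping.lookup (\<Sum>m\<in>Poly_Mapping.keys p. Poly_Mapping.single m (Poly_Mapping.lookup p m)) k"
    by (cases "k \<in> Poly_Mapping.keys p")
      (auto simp: lookup_sum lookup_single when_def in_keys_iff)
qed

lemma cpoly_add: "cpoly (a + b) = cpoly a + cpoly b"
  by (rule single_add)

lemma cpoly_mult: "cpoly (a * b) = (cpoly a * cpoly b :: ('n, 'k::comm_ring_1) mpoly)"
  by (simp add: mult_single)

lemma cpoly_sum: "cpoly (sum f I) = (\<Sum>i\<in>I. cpoly (f i) :: ('n, 'k::comm_ring_1) mpoly)"
  by (induction I rule: infinite_finite_induct) (simp_all add: cpoly_add)

lemma cpoly_eq_0_iff [simp]: "cpoly c = 0 \<longleftrightarrow> c = 0"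
  by (metis lookup_single_eq lookup_zero single_zero)

lemma cpoly_inverse:
  "c \<noteq> 0 \<Longrightarrow> cpoly c * cpoly (inverse c) = (1 :: ('n, 'k::field) mpoly)"
  by (simp flip: cpoly_mult)

section \<open>Evaluation homomorphisms\<close>

text \<open>
  The coefficients are moved by \<open>h\<close> so that one homomorphism property serves both the evaluation at a
  point of \<open>K\<^sup>n\<close> (\<open>h\<close> the identity) and substitutions \<open>S \<rightarrow> S\<close> (\<open>h\<close> the inclusion of the constants).
\<close>

definition insertion ::
  "('k \<Rightarrow> 'r) \<Rightarrow> ('n \<Rightarrow> 'r) \<Rightarrow> ('n::finite, 'k::comm_ring_1) mpoly \<Rightarrow> 'r::comm_ring_1" where
  "insertion h l p =
    (\<Sum>m\<in>Poly_Mapping.keys p. h (Poly_Mapping.lookup p m) * (\<Prod>i\<in>UNIV. l i ^ Poly_Mapping.lookup m i))"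

locale coefficient_hom =
  fixes h :: "'k::comm_ring_1 \<Rightarrow> 'r::comm_ring_1"
  assumes add: "h (a + b) = h a + h b"
    and mult: "h (a * b) = h a * h b"
    and one: "h 1 = 1"
begin

lemma zero: "h 0 = 0"
  using add[of 0 0] by simp

lemma insertion_superset:
  assumes "finite S" "Poly_Mapping.keys p \<subseteq> S"
  shows "insertion h l p =
    (\<Sum>m\<in>S. h (Poly_Mapping.lookup p m) * (\<Prod>i\<in>UNIV. l i ^ Poly_Mapping.lookup m i))"
  unfolding insertion_def using assms
  by (intro sum.mono_neutral_left) (auto simp: in_keys_iff zero)

lemma insertion_zero [simp]: "insertion h l 0 = 0"
  by (simp add: insertion_def)

lemma insertion_add: "insertion h l (p + q) = insertion h l p + insertion h l q"
proof -
  let ?S = "Poly_Mapping.keys p \<union> Poly_Mapping.keys q"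
  have "Poly_Mapping.keys (p + q) \<subseteq> ?S" by (rule keys_add)
  then show ?thesis
    by (simp add: insertion_superset[where S = ?S] lookup_add add distrib_right sum.distrib)
qed

lemma insertion_single:
  "insertion h l (Poly_Mapping.single m c) = h c * (\<Prod>i\<in>UNIV. l i ^ Poly_Mapping.lookup m i)"
  by (cases "c = 0") (simp_all add: insertion_def zero)

lemma insertion_cpoly [simp]: "insertion h l (cpoly c) = h c"
  by (simp add: insertion_single)

lemma insertion_one [simp]: "insertion h l 1 = 1"
  using insertion_cpoly[of l 1] by (simp add: one)

lemma insertion_sum: "insertion h l (sum f I) = (\<Sum>i\<in>I. insertion h l (f i))"
  by (induction I rule: infinite_finite_induct) (simp_all add: insertion_add)

lemma insertion_mult: "insertion h l (p * q) = insertion h l p * insertion h l q"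
proof -
  let ?s = "\<lambda>p m. Poly_Mapping.single m (Poly_Mapping.lookup p m)"
  have "insertion h l (?s p m * ?s q m') = insertion h l (?s p m) * insertion h l (?s q m')" for m m'
    by (simp add: mult_single insertion_single mult lookup_add power_add prod.distrib mult_ac)
  then have "insertion h l ((\<Sum>m\<in>Poly_Mapping.keys p. ?s p m) * (\<Sum>m\<in>Poly_Mapping.keys q. ?s q m))
      = insertion h l (\<Sum>m\<in>Poly_Mapping.keys p. ?s p m) * insertion h l (\<Sum>m\<in>Poly_Mapping.keys q. ?s q m)"
    by (simp add: sum_product insertion_sum)
  then show ?thesis by (simp flip: sum_monomials)
qed

lemma insertion_uminus: "insertion h l (- p) = - insertion h l p"
  by (metis add.right_inverse add_eq_0_iff insertion_add insertion_zero)

lemma insertion_diff: "insertion h l (p - q) = insertion h l p - insertion h l q"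
  using insertion_add[of l p "- q"] by (simp add: insertion_uminus)

lemma insertion_power: "insertion h l (p ^ n) = insertion h l p ^ n"
  by (induction n) (simp_all add: insertion_mult)

lemma insertion_prod: "insertion h l (prod f I) = (\<Prod>i\<in>I. insertion h l (f i))"
  by (induction I rule: infinite_finite_induct) (simp_all add: insertion_mult)

lemmas insertion_simps =
  insertion_add insertion_mult insertion_uminus insertion_diff insertion_power insertion_sum insertion_prod

end

interpretation id_hom: coefficient_hom "\<lambda>c. c"
  by (rule coefficient_hom.intro) (rule refl)+

interpretation cpoly_hom: coefficient_hom "cpoly :: 'k \<Rightarrow> ('n::finite, 'k::comm_ring_1) mpoly"
  by (rule coefficient_hom.intro) (simp_all only: cpoly_add cpoly_mult single_one)

lemma poly_eval_insertion: "poly_eval p v = insertion (\<lambda>c. c) (\<lambda>i. v $ i) p"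
  by (simp add: poly_eval_def insertion_def)

lemmas poly_eval_simps [simp] =
  id_hom.insertion_simps[where l = "\<lambda>i. v $ i" for v, folded poly_eval_insertion]
  id_hom.insertion_zero[where l = "\<lambda>i. v $ i" for v, folded poly_eval_insertion]
  id_hom.insertion_one[where l = "\<lambda>i. v $ i" for v, folded poly_eval_insertion]
  id_hom.insertion_cpoly[where l = "\<lambda>i. v $ i" for v, folded poly_eval_insertion]

abbreviation subst :: "('n \<Rightarrow> ('n, 'k) mpoly) \<Rightarrow> ('n::finite, 'k::comm_ring_1) mpoly \<Rightarrow> ('n, 'k) mpoly" where
  "subst \<equiv> insertion cpoly"

abbreviation const_term :: "('n::finite, 'k::zero) mpoly \<Rightarrow> 'k" where
  "const_term p \<equiv> Poly_Mapping.lookup p 0"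

text \<open>
  Only the constant monomial survives at the origin, so that \<open>const_term\<close> is a ring homomorphism.
\<close>

lemma const_term_poly_eval: "const_term p = poly_eval p 0"
proof -
  have *: "(\<Prod>i\<in>UNIV. (0::'a) ^ Poly_Mapping.lookup m i) = (1 when m = 0)" for m :: "'b \<Rightarrow>\<^sub>0 nat"
  proof (cases "m = 0")
    case False
    then obtain i where "Poly_Mapping.lookup m i \<noteq> 0" by (metis lookup_zero poly_mapping_eqI)
    then have "(0::'a) ^ Poly_Mapping.lookup m i = 0" by (simp add: zero_power)
    then have "(\<Prod>i\<in>UNIV. (0::'a) ^ Poly_Mapping.lookup m i) = 0" by (intro prod_zero) auto
    then show ?thesis using False by simp
  qed simp
  have "poly_eval p 0 = (\<Sum>m\<in>Poly_Mapping.keys p. Poly_Mapping.lookup p m * (1 when m = 0))"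
    unfolding poly_eval_def by (simp add: *)
  also have "\<dots> = (\<Sum>m\<in>Poly_Mapping.keys p. if m = 0 then Poly_Mapping.lookup p m else 0)"
    by (intro sum.cong) (auto simp: when_def)
  also have "\<dots> = const_term p"
    by (auto simp: sum.delta in_keys_iff)
  finally show ?thesis by simp
qed

lemma const_term_mult [simp]: "const_term (p * q) = const_term p * const_term (q :: ('n::finite, 'k::comm_ring_1) mpoly)"
  by (simp add: const_term_poly_eval)

lemma const_term_add [simp]: "const_term (p + q) = const_term p + const_term (q :: ('n::finite, 'k::comm_ring_1) mpoly)"
  by (simp add: const_term_poly_eval)

lemma const_term_diff [simp]: "const_term (p - q) = const_term p - const_term (q :: ('n::finite, 'k::comm_ring_1) mpoly)"
  by (simp add: const_term_poly_eval)

lemma const_term_sum [simp]: "const_term (sum f I) = (\<Sum>i\<in>I. const_term (f i))"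
  by (simp add: lookup_sum)

section \<open>The grading\<close>

lemma monom_degree_add: "monom_degree (m + m') = monom_degree m + monom_degree m'"
  by (simp add: monom_degree_def lookup_add sum.distrib)

lemma monom_degree_zero [simp]: "monom_degree 0 = 0"
  by (simp add: monom_degree_def)

lemma monom_degree_zero_iff [simp]: "monom_degree m = 0 \<longleftrightarrow> m = 0"
  by (auto simp: monom_degree_def intro: poly_mapping_eqI)

lemma graded_zero [simp]: "0 \<in> graded_part k"
  by (simp add: graded_part_def)

lemma graded_add: "p \<in> graded_part k \<Longrightarrow> q \<in> graded_part k \<Longrightarrow> p + q \<in> graded_part k"
  unfolding graded_part_def using keys_add[of p q] by blast

lemma graded_uminus: "p \<in> graded_part k \<Longrightarrow> - p \<in> graded_part k"
  unfolding graded_part_def by (auto simp: in_keys_iff)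

lemma graded_diff: "p \<in> graded_part k \<Longrightarrow> q \<in> graded_part k \<Longrightarrow> p - q \<in> graded_part k"
  using graded_add[of p k "- q"] graded_uminus[of q k] by simp

lemma graded_sum: "(\<And>i. i \<in> I \<Longrightarrow> f i \<in> graded_part k) \<Longrightarrow> sum f I \<in> graded_part k"
  by (induction I rule: infinite_finite_induct) (auto intro: graded_add)

lemma graded_mult:
  assumes "p \<in> graded_part j" "q \<in> graded_part k"
  shows "p * q \<in> graded_part (j + k)"
proof -
  have "int (monom_degree m) = j + k" if "m \<in> Poly_Mapping.keys (p * q)" for m
  proof -
    from that obtain a b where "m = a + b" "a \<in> Poly_Mapping.keys p" "b \<in> Poly_Mapping.keys q"
      using keys_mult[of p q] by blast
    then show ?thesis using assms by (simp add: graded_part_def monom_degree_add)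
  qed
  then show ?thesis by (simp add: graded_part_def)
qed

lemma graded_cpoly [simp]: "cpoly c \<in> graded_part 0"
  by (auto simp: graded_part_def monom_degree_def)

lemma graded_one [simp]: "1 \<in> graded_part 0"
  using graded_cpoly[of 1] by simp

lemma graded_cmult: "p \<in> graded_part k \<Longrightarrow> cpoly c * p \<in> graded_part k"
  using graded_mult[OF graded_cpoly] by fastforce

lemma graded_power: "p \<in> graded_part j \<Longrightarrow> p ^ n \<in> graded_part (int n * j)"
  by (induction n) (auto simp: algebra_simps intro: graded_mult)

lemma graded_prod:
  "finite I \<Longrightarrow> (\<And>i. i \<in> I \<Longrightarrow> f i \<in> graded_part 1) \<Longrightarrow> prod f I \<in> graded_part (int (card I))"
proof (induction I rule: finite_induct)
  case (insert i I)
  then have "f i * prod f I \<in> graded_part (1 + int (card I))" by (intro graded_mult) auto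
  then show ?case using insert by (simp add: add.commute)
qed simp

lemma graded_neg_eq_0: "p \<in> graded_part k \<Longrightarrow> k < 0 \<Longrightarrow> p = 0"
  by (force simp: graded_part_def simp flip: keys_eq_empty)

lemma graded_0_const: "p \<in> graded_part 0 \<Longrightarrow> p = cpoly (const_term p)"
  by (rule poly_mapping_eqI)
    (auto simp: graded_part_def lookup_single when_def in_keys_iff)

lemma const_term_graded: "p \<in> graded_part k \<Longrightarrow> k \<noteq> 0 \<Longrightarrow> const_term p = 0"
  by (force simp: graded_part_def in_keys_iff)

lemma graded_nonzero_degree_pos:
  assumes "p \<in> graded_part k" "p \<noteq> 0" "const_term p = 0"
  shows "k \<ge> 1"
proof (rule ccontr)
  assume "\<not> k \<ge> 1"
  then consider "k < 0" | "k = 0" by linarith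
  then show False
  proof cases
    case 1
    then show False using assms graded_neg_eq_0 by blast
  next
    case 2
    then show False using assms graded_0_const[of p] by simp
  qed
qed

definition hcomp :: "int \<Rightarrow> ('n::finite, 'k::comm_ring_1) mpoly \<Rightarrow> ('n, 'k) mpoly" where
  "hcomp k p = (\<Sum>m | m \<in> Poly_Mapping.keys p \<and> int (monom_degree m) = k.
     Poly_Mapping.single m (Poly_Mapping.lookup p m))"

lemma lookup_hcomp:
  "Poly_Mapping.lookup (hcomp k p) m = (Poly_Mapping.lookup p m when int (monom_degree m) = k)"
proof -
  let ?M = "{m. m \<in> Poly_Mapping.keys p \<and> int (monom_degree m) = k}"
  have "Poly_Mapping.lookup (hcomp k p) m = (\<Sum>m'\<in>?M. if m' = m then Poly_Mapping.lookup p m' else 0)"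
    unfolding hcomp_def lookup_sum lookup_single when_def by simp
  also have "\<dots> = (if m \<in> ?M then Poly_Mapping.lookup p m else 0)"
    by (rule sum.delta) simp
  also have "\<dots> = (Poly_Mapping.lookup p m when int (monom_degree m) = k)"
    by (simp add: when_def in_keys_iff)
  finally show ?thesis .
qed

lemma hcomp_graded [simp]: "hcomp k p \<in> graded_part k"
  by (auto simp: graded_part_def in_keys_iff lookup_hcomp)

lemma hcomp_zero [simp]: "hcomp k 0 = 0"
  by (simp add: hcomp_def)

lemma hcomp_add: "hcomp k (p + q) = hcomp k p + hcomp k q"
  by (rule poly_mapping_eqI) (simp add: lookup_hcomp lookup_add when_def)

lemma hcomp_sum: "hcomp k (sum f I) = (\<Sum>i\<in>I. hcomp k (f i))"
  by (induction I rule: infinite_finite_induct) (simp_all add: hcomp_add)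

lemma hcomp_of_graded: "p \<in> graded_part j \<Longrightarrow> hcomp k p = (if j = k then p else 0)"
  by (rule poly_mapping_eqI) (auto simp: lookup_hcomp when_def graded_part_def in_keys_iff)

lemma sum_hcomp:
  assumes "finite J" "(\<lambda>m. int (monom_degree m)) ` Poly_Mapping.keys p \<subseteq> J"
  shows "(\<Sum>j\<in>J. hcomp j p) = p"
proof (rule poly_mapping_eqI)
  fix m
  have "Poly_Mapping.lookup (\<Sum>j\<in>J. hcomp j p) m =
      (\<Sum>j\<in>J. if int (monom_degree m) = j then Poly_Mapping.lookup p m else 0)"
    by (simp add: lookup_sum lookup_hcomp when_def)
  also have "\<dots> = (if int (monom_degree m) \<in> J then Poly_Mapping.lookup p m else 0)"
    using assms(1) by (rule sum.delta')
  also have "\<dots> = Poly_Mapping.lookup p m"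
    using assms(2) unfolding image_subset_iff by (auto simp: in_keys_iff)
  finally show "Poly_Mapping.lookup (\<Sum>j\<in>J. hcomp j p) m = Poly_Mapping.lookup p m" .
qed

lemma hcomp_mult_graded:
  assumes a: "a \<in> graded_part i"
  shows "hcomp k (a * q) = a * hcomp (k - i) q"
proof -
  let ?J = "insert (k - i) ((\<lambda>m. int (monom_degree m)) ` Poly_Mapping.keys q)"
  have "a * hcomp j q \<in> graded_part (i + j)" for j
    using a by (intro graded_mult) auto
  then have "hcomp k (a * hcomp j q) = (if j = k - i then a * hcomp j q else 0)" for j
    using hcomp_of_graded[of "a * hcomp j q" "i + j" k] by auto
  moreover have "a * q = (\<Sum>j\<in>?J. a * hcomp j q)"
    by (subst sum_distrib_left[symmetric], subst sum_hcomp) auto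
  ultimately have "hcomp k (a * q) = (\<Sum>j\<in>?J. if j = k - i then a * hcomp j q else 0)"
    by (simp add: hcomp_sum del: sum.insert)
  also have "\<dots> = a * hcomp (k - i) q" by (subst sum.delta) auto
  finally show ?thesis .
qed

lemma graded_mult_cancel:
  fixes a :: "('n::{finite,linorder}, 'k::field) mpoly"
  assumes "a \<in> graded_part i" "a \<noteq> 0" "a * q \<in> graded_part k"
  shows "q \<in> graded_part (k - i)"
proof -
  have "a * q = hcomp k (a * q)" using assms(3) by (simp add: hcomp_of_graded)
  also have "\<dots> = a * hcomp (k - i) q" by (rule hcomp_mult_graded) fact
  finally have "q = hcomp (k - i) q" using assms(2) by simp
  then show ?thesis using hcomp_graded[of "k - i" q] by simp
qed

section \<open>Linear forms\<close>

definition linear_form :: "'k::comm_ring_1 ^ 'n::finite \<Rightarrow> ('n, 'k) mpoly" where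
  "linear_form a = (\<Sum>i\<in>UNIV. Poly_Mapping.single (Poly_Mapping.single i 1) (a $ i))"

definition dot :: "'k::comm_ring_1 ^ 'n::finite \<Rightarrow> 'k ^ 'n \<Rightarrow> 'k" where
  "dot a v = (\<Sum>i\<in>UNIV. a $ i * v $ i)"

definition var :: "'n \<Rightarrow> ('n, 'k::comm_ring_1) mpoly" where
  "var i = Poly_Mapping.single (Poly_Mapping.single i 1) 1"

lemma single_var: "Poly_Mapping.single (Poly_Mapping.single i 1) c = cpoly c * var i"
  by (simp add: var_def mult_single)

lemma linear_form_vars: "linear_form a = (\<Sum>i\<in>UNIV. cpoly (a $ i) * var i)"
  unfolding linear_form_def by (intro sum.cong single_var refl)

lemma linear_form_add: "linear_form (a + b) = linear_form a + linear_form b"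
  by (simp add: linear_form_def single_add sum.distrib)

lemma linear_form_scale: "linear_form (c *s a) = cpoly c * linear_form a"
  by (simp add: linear_form_def sum_distrib_left mult_single)

lemma linear_form_zero [simp]: "linear_form 0 = 0"
  by (simp add: linear_form_def)

lemma monom_degree_single: "monom_degree (Poly_Mapping.single i k) = k"
  by (simp add: monom_degree_def lookup_single when_def)

lemma linear_form_graded [simp]: "linear_form a \<in> graded_part 1"
  unfolding linear_form_def
  by (intro graded_sum) (auto simp: graded_part_def monom_degree_single)

lemma lookup_linear_form: "Poly_Mapping.lookup (linear_form a) (Poly_Mapping.single i 1) = a $ i"
proof -
  have "Poly_Mapping.lookup (linear_form a) (Poly_Mapping.single i 1) =
    (\<Sum>j\<in>UNIV. if j = i then a $ j else 0)"
    unfolding linear_form_def lookup_sum lookup_single when_def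
    by (intro sum.cong) (auto dest: arg_cong[where f = Poly_Mapping.keys])
  then show ?thesis by simp
qed

lemma linear_form_eq_0_iff [simp]: "linear_form a = 0 \<longleftrightarrow> a = 0"
  by (metis linear_form_zero lookup_linear_form lookup_zero vec_eq_iff zero_index)

lemma monom_degree_1E:
  assumes "monom_degree m = 1"
  obtains i where "m = Poly_Mapping.single i 1"
proof -
  obtain i where i: "Poly_Mapping.lookup m i \<noteq> 0"
    using assms by (metis monom_degree_zero_iff lookup_zero poly_mapping_eqI zero_neq_one)
  have "monom_degree m = Poly_Mapping.lookup m i + (\<Sum>j\<in>UNIV - {i}. Poly_Mapping.lookup m j)"
    unfolding monom_degree_def by (rule sum.remove) auto
  then have "Poly_Mapping.lookup m i = 1 \<and> (\<Sum>j\<in>UNIV - {i}. Poly_Mapping.lookup m j) = 0"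
    using assms i by linarith
  then have "Poly_Mapping.lookup m i = 1" "\<And>j. j \<noteq> i \<Longrightarrow> Poly_Mapping.lookup m j = 0"
    by (auto simp: sum_eq_0_iff)
  then have "m = Poly_Mapping.single i 1"
    by (intro poly_mapping_eqI) (auto simp: lookup_single when_def)
  then show ?thesis by (rule that)
qed

lemma graded_1_linear_form:
  assumes "p \<in> graded_part 1"
  obtains a where "p = linear_form a"
proof
  let ?a = "\<chi> i. Poly_Mapping.lookup p (Poly_Mapping.single i 1)"
  show "p = linear_form ?a"
  proof (rule poly_mapping_eqI)
    fix m
    show "Poly_Mapping.lookup p m = Poly_Mapping.lookup (linear_form ?a) m"
    proof (cases "monom_degree m = 1")
      case True
      then show ?thesis by (elim monom_degree_1E) (simp only: lookup_linear_form vec_lambda_beta)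
    next
      case False
      then have "m \<notin> Poly_Mapping.keys p" "m \<notin> Poly_Mapping.keys (linear_form ?a)"
        using assms linear_form_graded[of ?a] unfolding graded_part_def by auto
      then show ?thesis by (simp add: in_keys_iff)
    qed
  qed
qed

lemma (in coefficient_hom) insertion_var: "insertion h l (var i) = l i"
proof -
  have "(\<Prod>j\<in>UNIV. l j ^ Poly_Mapping.lookup (Poly_Mapping.single i 1) j) =
      (\<Prod>j\<in>UNIV. if j = i then l j else 1)"
    by (intro prod.cong) (auto simp: lookup_single when_def)
  then show ?thesis by (simp add: var_def insertion_single one)
qed

lemma (in coefficient_hom) insertion_linear_form:
  "insertion h l (linear_form a) = (\<Sum>i\<in>UNIV. h (a $ i) * l i)"
  unfolding linear_form_vars by (simp add: insertion_simps insertion_var)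

lemma poly_eval_linear_form [simp]: "poly_eval (linear_form a) v = dot a v"
  by (simp add: poly_eval_insertion id_hom.insertion_linear_form dot_def)

lemma partial_deriv_superset:
  assumes "finite S" "Poly_Mapping.keys p \<subseteq> S"
  shows "partial_deriv i p =
    (\<Sum>m\<in>S. Poly_Mapping.single (m - Poly_Mapping.single i 1)
       (of_nat (Poly_Mapping.lookup m i) * Poly_Mapping.lookup p m))"
  unfolding partial_deriv_def using assms
  by (intro sum.mono_neutral_left) (auto simp: in_keys_iff)

lemma partial_deriv_linear_form:
  fixes a :: "'k::comm_ring_1 ^ 'n::finite"
  shows "partial_deriv i (linear_form a) = cpoly (a $ i)"
proof -
  let ?e = "\<lambda>j :: 'n. Poly_Mapping.single j (1 :: nat)"
  have "m \<in> range ?e" if "m \<in> Poly_Mapping.keys (linear_form a)" for m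
  proof -
    have "monom_degree m = 1"
      using that linear_form_graded[of a] unfolding graded_part_def by auto
    then show ?thesis by (rule monom_degree_1E) auto
  qed
  moreover have "inj ?e"
    by (auto simp: inj_def dest: arg_cong[where f = Poly_Mapping.keys])
  ultimately have "partial_deriv i (linear_form a) =
      (\<Sum>j\<in>UNIV. Poly_Mapping.single (?e j - ?e i) (of_nat (Poly_Mapping.lookup (?e j) i) * a $ j))"
    by (subst partial_deriv_superset[where S = "range ?e"])
      (auto simp: sum.reindex lookup_linear_form[unfolded One_nat_def])
  also have "\<dots> = (\<Sum>j\<in>UNIV. if j = i then cpoly (a $ j) else 0)"
    by (intro sum.cong) (auto simp: lookup_single when_def)
  finally show ?thesis by simp
qed

lemma apply_deriv_linear_form: "apply_deriv \<theta> (linear_form a) = (\<Sum>i\<in>UNIV. \<theta> $ i * cpoly (a $ i))"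
  by (simp add: apply_deriv_def partial_deriv_linear_form)

lemma single_monomial:
  fixes m :: "'n::finite \<Rightarrow>\<^sub>0 nat" and c :: "'k::comm_ring_1"
  shows "Poly_Mapping.single m c = cpoly c * (\<Prod>i\<in>UNIV. var i ^ Poly_Mapping.lookup m i)"
proof -
  have pow: "var i ^ k = (Poly_Mapping.single (Poly_Mapping.single i k) 1 :: ('n, 'k) mpoly)" for i and k
    by (induction k) (simp_all add: var_def mult_single single_add[symmetric])
  have prod: "(\<Prod>i\<in>I. Poly_Mapping.single (f i) 1) = (Poly_Mapping.single (sum f I) 1 :: ('n, 'k) mpoly)"
    for f and I :: "'n set"
    by (induction I rule: infinite_finite_induct) (simp_all add: mult_single)
  have "(\<Sum>i\<in>UNIV. Poly_Mapping.single i (Poly_Mapping.lookup m i)) = m"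
    by (rule poly_mapping_eqI) (simp add: lookup_sum lookup_single when_def)
  then show ?thesis by (simp only: pow prod) (simp add: mult_single)
qed

section \<open>Ideals generated by linear forms\<close>

text \<open>
  The case \<open>y = 0\<close> is the principal ideal \<open>(x)\<close>, so that congruences modulo one and modulo two linear
  forms have a common proof.
\<close>

definition pair_ideal :: "'a::comm_ring_1 \<Rightarrow> 'a \<Rightarrow> 'a set" where
  "pair_ideal x y = {x * q + y * r | q r. True}"

lemma pair_idealI: "z = x * q + y * r \<Longrightarrow> z \<in> pair_ideal x y"
  by (auto simp: pair_ideal_def)

lemma pair_ideal_0 [simp]: "z \<in> pair_ideal x 0 \<longleftrightarrow> x dvd z"
  by (auto simp: pair_ideal_def dvd_def)

lemma pair_ideal_gens [simp]: "x \<in> pair_ideal x y" "y \<in> pair_ideal x y" "0 \<in> pair_ideal x y"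
  by (rule pair_idealI[where q = 1 and r = 0], simp)
    (rule pair_idealI[where q = 0 and r = 1], simp, rule pair_idealI[where q = 0 and r = 0], simp)

lemma pair_ideal_add: "z \<in> pair_ideal x y \<Longrightarrow> z' \<in> pair_ideal x y \<Longrightarrow> z + z' \<in> pair_ideal x y"
  unfolding pair_ideal_def
  by clarify (metis (no_types, opaque_lifting) add.assoc add.left_commute distrib_left)

lemma pair_ideal_mult: "z \<in> pair_ideal x y \<Longrightarrow> c * z \<in> pair_ideal x y"
proof -
  assume "z \<in> pair_ideal x y"
  then obtain q r where "z = x * q + y * r" by (auto simp: pair_ideal_def)
  then show ?thesis by (intro pair_idealI[where q = "c * q" and r = "c * r"]) (simp add: algebra_simps)
qed

text \<open>
  The polynomials that are congruent to their image form a subring; it contains the constants and, by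
  assumption, the variables.
\<close>

lemma subst_congruence:
  fixes l :: "'n::finite \<Rightarrow> ('n, 'k::comm_ring_1) mpoly"
  assumes l: "\<And>i. var i - l i \<in> pair_ideal \<alpha> \<beta>"
  shows "p - subst l p \<in> pair_ideal \<alpha> \<beta>"
proof -
  let ?P = "\<lambda>p. p - subst l p \<in> pair_ideal \<alpha> \<beta>"
  have mult: "?P (p * q)" if "?P p" "?P q" for p q
  proof -
    have "p * q - subst l (p * q) = p * (q - subst l q) + subst l q * (p - subst l p)"
      by (simp add: cpoly_hom.insertion_mult algebra_simps)
    then show ?thesis using that by (auto intro: pair_ideal_add pair_ideal_mult)
  qed
  have add: "?P (p + q)" if "?P p" "?P q" for p q
  proof -
    have "p + q - subst l (p + q) = (p - subst l p) + (q - subst l q)"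
      by (simp only: cpoly_hom.insertion_add add_diff_add)
    then show ?thesis using that by (simp only: pair_ideal_add)
  qed
  have c: "?P (cpoly c)" for c by simp
  have v: "?P (var i)" for i using l by (simp add: cpoly_hom.insertion_var)
  have pow: "?P (var i ^ k)" for i k
  proof (induction k)
    case (Suc k)
    then show ?case unfolding power_Suc by (intro mult v)
  qed simp
  have prod: "?P (\<Prod>i\<in>I. var i ^ Poly_Mapping.lookup m i)" for m and I :: "'n set"
  proof (induction I rule: infinite_finite_induct)
    case (insert i I)
    show ?case unfolding prod.insert[OF insert.hyps] by (intro mult pow insert.IH)
  qed simp_all
  have mono: "?P (Poly_Mapping.single m c)" for m c
    unfolding single_monomial[of m c] by (intro mult c prod)
  have "?P (\<Sum>m\<in>M. Poly_Mapping.single m (Poly_Mapping.lookup p m))" for M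
  proof (induction M rule: infinite_finite_induct)
    case (insert m M)
    show ?case unfolding sum.insert[OF insert.hyps] by (intro add mono insert.IH)
  qed simp_all
  then show ?thesis using sum_monomials[of p] by metis
qed

lemma dual_vector:
  assumes "a \<noteq> (0 :: 'k::field ^ 'n::finite)"
  obtains p where "dot a p = 1"
proof -
  obtain i where "a $ i \<noteq> 0" using assms by (auto simp: vec_eq_iff)
  then have "dot a (axis i (inverse (a $ i))) = (\<Sum>j\<in>UNIV. if j = i then 1 else 0)"
    unfolding dot_def by (intro sum.cong) (auto simp: axis_def)
  then show ?thesis using that by simp
qed

text \<open>
  For a vector \<open>p\<close> with \<open>\<alpha>(p) = 1\<close> the projection along \<open>p\<close> is a linear change of variables that kills
  \<open>\<alpha>\<close> and is the identity modulo \<open>\<alpha>\<close>.  Hence \<open>(\<alpha>)\<close> is the kernel of a ring homomorphism into the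
  domain \<open>S\<close>.
\<close>

lemma prime_linear_form:
  fixes \<alpha> :: "('n::{finite,linorder}, 'k::field) mpoly"
  assumes "\<alpha> \<in> graded_part 1" "\<alpha> \<noteq> 0"
  shows "prime_elem \<alpha>"
proof -
  obtain a where \<alpha>: "\<alpha> = linear_form a" using assms graded_1_linear_form by metis
  then obtain p where p: "dot a p = 1" using assms dual_vector[of a] by auto
  let ?\<sigma> = "subst (\<lambda>i. var i - cpoly (p $ i) * \<alpha>)"
  have "var i - (var i - cpoly (p $ i) * \<alpha>) \<in> pair_ideal \<alpha> 0" for i by simp
  then have cong: "f - ?\<sigma> f \<in> pair_ideal \<alpha> 0" for f by (rule subst_congruence)
  have "?\<sigma> \<alpha> = (\<Sum>i\<in>UNIV. cpoly (a $ i) * var i - cpoly (a $ i * p $ i) * \<alpha>)"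
    unfolding \<alpha> cpoly_hom.insertion_linear_form
    by (simp add: right_diff_distrib cpoly_mult mult.assoc)
  also have "\<dots> = linear_form a - cpoly (dot a p) * \<alpha>"
    by (simp only: sum_subtractf linear_form_vars dot_def cpoly_sum sum_distrib_right)
  finally have "?\<sigma> \<alpha> = 0" using p \<alpha> by simp
  then have iff: "\<alpha> dvd f \<longleftrightarrow> ?\<sigma> f = 0" for f
    using cong[of f] by (auto simp: cpoly_hom.insertion_mult)
  have "\<not> \<alpha> dvd 1" by (simp add: iff cpoly_hom.insertion_one)
  then show ?thesis
    using assms(2) by (auto simp: prime_elem_def iff cpoly_hom.insertion_mult)
qed

lemma linear_form_dvd_linear_form:
  fixes \<alpha> :: "('n::{finite,linorder}, 'k::field) mpoly"
  assumes "\<alpha> \<in> graded_part 1" "\<beta> \<in> graded_part 1" "\<beta> \<noteq> 0" "\<alpha> dvd \<beta>"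
  obtains c where "c \<noteq> 0" "\<beta> = cpoly c * \<alpha>"
proof -
  obtain q where q: "\<beta> = \<alpha> * q" using assms by blast
  then have "q \<in> graded_part (1 - 1)" using assms by (intro graded_mult_cancel[of \<alpha>]) auto
  then have "q = cpoly (const_term q)" by (intro graded_0_const) simp
  then show ?thesis using q assms that[of "const_term q"] by (metis cpoly_eq_0_iff mult.commute mult_zero_right)
qed

text \<open>
  Over a finite field a polynomial is not determined by its zeros, but a linear form is, up to a
  scalar: \<open>v - \<alpha>(v) p\<close> lies in the kernel of \<open>\<alpha>\<close> whenever \<open>\<alpha>(p) = 1\<close>.
\<close>

lemma zero_locus_subset:
  fixes \<alpha> :: "('n::{finite,linorder}, 'k::field) mpoly"
  assumes "\<alpha> \<in> graded_part 1" "\<beta> \<in> graded_part 1" "\<alpha> \<noteq> 0" "zero_locus \<alpha> \<subseteq> zero_locus \<beta>"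
  obtains c where "\<beta> = cpoly c * \<alpha>"
proof -
  obtain a b where ab: "\<alpha> = linear_form a" "\<beta> = linear_form b"
    using assms graded_1_linear_form by metis
  then obtain p where p: "dot a p = 1" using assms dual_vector[of a] by auto
  have lin: "dot c (v - s *s p) = dot c v - s * dot c p" for c v s
    by (simp add: dot_def algebra_simps sum_subtractf sum_distrib_left)
  have "b $ i = dot b p * a $ i" for i
  proof -
    have ax: "dot c (axis i 1) = c $ i" for c :: "'k ^ 'n::{finite,linorder}"
      unfolding dot_def axis_def by (simp add: if_distrib cong: if_cong)
    have "axis i 1 - (a $ i) *s p \<in> zero_locus \<alpha>"
      using p by (simp add: zero_locus_def ab lin ax)
    then have "axis i 1 - (a $ i) *s p \<in> zero_locus \<beta>" using assms by blast
    then show ?thesis by (simp add: zero_locus_def ab lin ax mult.commute)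
  qed
  then have "b = dot b p *s a" by (simp add: vec_eq_iff)
  then show ?thesis using that ab linear_form_scale by metis
qed

lemma graded_var [simp]: "var i \<in> graded_part 1"
  by (auto simp: var_def graded_part_def monom_degree_single)

lemma poly_eval_var [simp]: "poly_eval (var i) v = v $ i"
  by (simp add: poly_eval_insertion id_hom.insertion_var)

definition const_deriv :: "'k ^ 'n \<Rightarrow> ('n::finite, 'k::comm_ring_1) deriv" where
  "const_deriv v = (\<chi> i. cpoly (v $ i))"

lemma apply_const_deriv:
  assumes "\<eta> \<in> graded_part 1"
  shows "apply_deriv (const_deriv v) \<eta> = cpoly (poly_eval \<eta> v)"
proof -
  obtain a where "\<eta> = linear_form a" using assms graded_1_linear_form by metis
  then show ?thesis
    by (simp add: apply_deriv_linear_form const_deriv_def dot_def cpoly_sum cpoly_mult mult.commute)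
qed

lemma homogeneous_const_deriv: "homogeneous_deriv 0 (const_deriv v)"
  by (simp add: homogeneous_deriv_def const_deriv_def)

text \<open>
  A basis \<open>\<alpha>, \<beta>, \<gamma>\<close> of the linear forms in three variables with its dual basis \<open>p, q, w\<close>.  The vector
  \<open>w\<close> spans the line \<open>\<alpha> = \<beta> = 0\<close>.
\<close>

locale linear_frame =
  fixes \<alpha> \<beta> \<gamma> :: "(3, 'k::field) mpoly" and p q w :: "'k ^ 3"
  assumes graded: "\<alpha> \<in> graded_part 1" "\<beta> \<in> graded_part 1" "\<gamma> \<in> graded_part 1"
    and p: "poly_eval \<alpha> p = 1" "poly_eval \<beta> p = 0" "poly_eval \<gamma> p = 0"
    and q: "poly_eval \<alpha> q = 0" "poly_eval \<beta> q = 1" "poly_eval \<gamma> q = 0"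
    and w: "poly_eval \<alpha> w = 0" "poly_eval \<beta> w = 0" "poly_eval \<gamma> w = 1"
    and expand: "\<eta> \<in> graded_part 1 \<Longrightarrow>
      \<eta> = cpoly (poly_eval \<eta> p) * \<alpha> + cpoly (poly_eval \<eta> q) * \<beta> + cpoly (poly_eval \<eta> w) * \<gamma>"
begin

lemma swap_last: "linear_frame \<alpha> \<gamma> \<beta> p w q"
  using graded p q w expand by unfold_locales (auto simp: add_ac)

lemma swap_first: "linear_frame \<beta> \<alpha> \<gamma> q p w"
  using graded p q w expand by unfold_locales (auto simp: add_ac)

lemma nonzero: "\<alpha> \<noteq> 0" "\<beta> \<noteq> 0" "\<gamma> \<noteq> 0"
  using p q w by auto

lemma not_dvd: "\<not> \<alpha> dvd \<beta>" "\<not> \<beta> dvd \<alpha>" "\<not> \<alpha> dvd \<gamma>" "\<not> \<gamma> dvd \<alpha>"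
  using p q w by (auto simp: dvd_def)

text \<open>
  Restriction to the line spanned by \<open>w\<close>, on which \<open>\<gamma>\<close> is the coordinate.  It maps \<open>\<alpha>\<close> and \<open>\<beta>\<close> to \<open>0\<close>
  and is the identity modulo \<open>(\<alpha>, \<beta>)\<close>, hence its kernel is this ideal.
\<close>

abbreviation proj :: "(3, 'k) mpoly \<Rightarrow> (3, 'k) mpoly" where
  "proj \<equiv> subst (\<lambda>i. cpoly (w $ i) * \<gamma>)"

lemma proj_linear:
  assumes "\<eta> \<in> graded_part 1"
  shows "proj \<eta> = cpoly (poly_eval \<eta> w) * \<gamma>"
proof -
  obtain a where "\<eta> = linear_form a" using assms graded_1_linear_form by metis
  then show ?thesis
    by (simp add: cpoly_hom.insertion_linear_form dot_def cpoly_sum cpoly_mult sum_distrib_right mult.assoc)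
qed

lemma pair_ideal_iff_proj: "f \<in> pair_ideal \<alpha> \<beta> \<longleftrightarrow> proj f = 0"
proof
  assume "f \<in> pair_ideal \<alpha> \<beta>"
  then obtain x y where "f = \<alpha> * x + \<beta> * y" by (auto simp: pair_ideal_def)
  then show "proj f = 0"
    by (simp add: cpoly_hom.insertion_simps proj_linear graded w)
next
  assume "proj f = 0"
  moreover have "var i - cpoly (w $ i) * \<gamma> \<in> pair_ideal \<alpha> \<beta>" for i
    using expand[of "var i"]
    by (intro pair_idealI[where q = "cpoly (p $ i)" and r = "cpoly (q $ i)"]) (simp add: algebra_simps)
  then have "f - proj f \<in> pair_ideal \<alpha> \<beta>" by (rule subst_congruence)
  ultimately show "f \<in> pair_ideal \<alpha> \<beta>" by simp
qed

lemma pair_ideal_prime: "f * g \<in> pair_ideal \<alpha> \<beta> \<Longrightarrow> f \<in> pair_ideal \<alpha> \<beta> \<or> g \<in> pair_ideal \<alpha> \<beta>"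
  by (simp add: pair_ideal_iff_proj cpoly_hom.insertion_mult)

lemma proj_graded:
  assumes f: "f \<in> graded_part (int k)"
  shows "proj f = cpoly (poly_eval f w) * \<gamma> ^ k"
proof -
  have "cpoly (Poly_Mapping.lookup f m) * (\<Prod>i\<in>UNIV. (cpoly (w $ i) * \<gamma>) ^ Poly_Mapping.lookup m i)
     = cpoly (Poly_Mapping.lookup f m * (\<Prod>i\<in>UNIV. w $ i ^ Poly_Mapping.lookup m i)) * \<gamma> ^ k"
    if "m \<in> Poly_Mapping.keys f" for m
  proof -
    have k: "k = (\<Sum>i\<in>UNIV. Poly_Mapping.lookup m i)"
      using that f unfolding graded_part_def monom_degree_def[symmetric] by auto
    have pow: "cpoly (c ^ n) = (cpoly c ^ n :: (3, 'k) mpoly)" for c n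
      by (induction n) (simp_all add: cpoly_mult)
    have prod: "cpoly (prod g I) = (\<Prod>i\<in>I. cpoly (g i) :: (3, 'k) mpoly)" for g and I :: "3 set"
      by (induction I rule: infinite_finite_induct) (simp_all add: cpoly_mult)
    show ?thesis
      by (simp add: k power_mult_distrib prod.distrib power_sum cpoly_mult pow prod mult.assoc)
  qed
  then show ?thesis
    by (simp add: insertion_def poly_eval_def cpoly_sum sum_distrib_right)
qed

text \<open>
  A homogeneous polynomial of degree \<open>k\<close> restricts to \<open>f(w) \<gamma>\<^sup>k\<close> on the line.  One value therefore decides
  membership in \<open>(\<alpha>, \<beta>)\<close>, even if the field is finite.
\<close>

lemma pair_ideal_graded_iff:
  assumes "f \<in> graded_part k"
  shows "f \<in> pair_ideal \<alpha> \<beta> \<longleftrightarrow> poly_eval f w = 0"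
proof (cases "k < 0")
  case True
  then have "f = 0" using assms graded_neg_eq_0 by blast
  then show ?thesis by simp
next
  case False
  then show ?thesis
    using assms proj_graded[of f "nat k"] nonzero by (simp add: pair_ideal_iff_proj)
qed

end

text \<open>
  If \<open>u\<close> is chosen with \<open>det (a, b, u) = 1\<close>, the basis dual to \<open>a, b, u\<close> consists of the cross products
  \<open>b \<times> u\<close>, \<open>u \<times> a\<close> and \<open>a \<times> b\<close>.
\<close>

lemma linear_frame_exists:
  fixes \<alpha> \<beta> :: "(3, 'k::field) mpoly"
  assumes "\<alpha> \<in> graded_part 1" "\<beta> \<in> graded_part 1" "\<alpha> \<noteq> 0" "\<not> \<alpha> dvd \<beta>"
  obtains \<gamma> p q w where "linear_frame \<alpha> \<beta> \<gamma> p q w"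
proof -
  define cross :: "'k ^ 3 \<Rightarrow> 'k ^ 3 \<Rightarrow> 'k ^ 3" where
    "cross a b = vector [a$2 * b$3 - a$3 * b$2, a$3 * b$1 - a$1 * b$3, a$1 * b$2 - a$2 * b$1]" for a b
  have dot3: "dot a b = a$1 * b$1 + a$2 * b$2 + a$3 * b$3" for a b :: "'k ^ 3"
    by (simp add: dot_def sum_3)
  obtain a b where ab: "\<alpha> = linear_form a" "\<beta> = linear_form b"
    using assms graded_1_linear_form by metis
  have "cross a b \<noteq> 0"
  proof
    assume "cross a b = 0"
    then have "cross a b $ 1 = 0" "cross a b $ 2 = 0" "cross a b $ 3 = 0" by auto
    then have 0: "a$2 * b$3 = a$3 * b$2" "a$3 * b$1 = a$1 * b$3" "a$1 * b$2 = a$2 * b$1"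
      by (simp_all add: cross_def)
    have "a $ 1 \<noteq> 0 \<or> a $ 2 \<noteq> 0 \<or> a $ 3 \<noteq> 0"
      using assms(3) ab by (auto simp: vec_eq_iff forall_3)
    then obtain i where i: "a $ i \<noteq> 0" by blast
    have prp: "a $ i * b $ j = a $ j * b $ i" for j
      using 0 exhaust_3[of i] exhaust_3[of j] by auto
    have "b = (b $ i / a $ i) *s a"
      using i prp by (simp add: vec_eq_iff field_simps)
    then have "\<beta> = cpoly (b $ i / a $ i) * \<alpha>" using ab linear_form_scale by metis
    then show False using assms(4) by simp
  qed
  then obtain i where i: "cross a b $ i \<noteq> 0" by (auto simp: vec_eq_iff)
  define u :: "'k ^ 3" where "u = axis i (inverse (cross a b $ i))"
  have "u $ 1 * cross a b $ 1 + u $ 2 * cross a b $ 2 + u $ 3 * cross a b $ 3 = 1"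
    using i exhaust_3[of i] by (auto simp: u_def axis_def)
  then have det: "u$1 * (a$2 * b$3 - a$3 * b$2) + u$2 * (a$3 * b$1 - a$1 * b$3) + u$3 * (a$1 * b$2 - a$2 * b$1) = 1"
    by (simp add: cross_def)
  have duals: "dot a (cross b u) = 1" "dot b (cross u a) = 1" "dot u (cross a b) = 1"
    "dot b (cross b u) = 0" "dot u (cross b u) = 0" "dot a (cross u a) = 0"
    "dot u (cross u a) = 0" "dot a (cross a b) = 0" "dot b (cross a b) = 0"
    using det by (simp_all add: dot3 cross_def algebra_simps)
  have expand: "c = dot c (cross b u) *s a + dot c (cross u a) *s b + dot c (cross a b) *s u" for c
  proof -
    let ?D = "u$1 * (a$2 * b$3 - a$3 * b$2) + u$2 * (a$3 * b$1 - a$1 * b$3) + u$3 * (a$1 * b$2 - a$2 * b$1)"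
    have "?D * c $ j = (dot c (cross b u) *s a + dot c (cross u a) *s b + dot c (cross a b) *s u) $ j" for j
      using exhaust_3[of j] by (auto simp: dot3 cross_def algebra_simps)
    then show ?thesis using det by (simp add: vec_eq_iff)
  qed
  have "linear_frame \<alpha> \<beta> (linear_form u) (cross b u) (cross u a) (cross a b)"
  proof
    fix \<eta> :: "(3, 'k) mpoly"
    assume "\<eta> \<in> graded_part 1"
    then obtain c where c: "\<eta> = linear_form c" using graded_1_linear_form by metis
    show "\<eta> = cpoly (poly_eval \<eta> (cross b u)) * \<alpha> + cpoly (poly_eval \<eta> (cross u a)) * \<beta>
        + cpoly (poly_eval \<eta> (cross a b)) * linear_form u"
      using arg_cong[OF expand[of c], of linear_form]
      unfolding c ab poly_eval_linear_form linear_form_add linear_form_scale .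
  qed (simp_all add: ab duals)
  then show ?thesis by (rule that)
qed

section \<open>Vectors of polynomials\<close>

lemma vector_matrix_mult_rows:
  fixes T :: "'a::comm_ring_1 ^ 'n ^ 'm::finite"
  shows "c v* T = (\<Sum>i\<in>UNIV. c $ i *s T $ i)"
  by (simp add: vec_eq_iff vector_matrix_mult_def mult.commute)

lemma vector_matrix_mult_add:
  fixes T :: "'a::comm_ring_1 ^ 'n ^ 'm::finite"
  shows "(c + e) v* T = c v* T + e v* T"
  by (simp add: vec_eq_iff vector_matrix_mult_def algebra_simps sum.distrib)

lemma vector_matrix_mult_scale:
  fixes T :: "'a::comm_ring_1 ^ 'n ^ 'm::finite"
  shows "(s *s c) v* T = s *s (c v* T)"
  by (simp add: vec_eq_iff vector_matrix_mult_def sum_distrib_left mult_ac)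

lemma vector_matrix_mult_diff:
  fixes T :: "'a::comm_ring_1 ^ 'n ^ 'm::finite"
  shows "(c - e) v* T = c v* T - e v* T"
  by (simp add: vec_eq_iff vector_matrix_mult_def algebra_simps sum_subtractf)

lemma vector_matrix_mult_zero:
  fixes T :: "'a::comm_ring_1 ^ 'n ^ 'm::finite"
  shows "0 v* T = 0"
  by (simp add: vec_eq_iff vector_matrix_mult_def)

lemma vector_matrix_mult_uminus:
  fixes T :: "'a::comm_ring_1 ^ 'n ^ 'm::finite"
  shows "(- c) v* T = - (c v* T)"
  by (simp add: vec_eq_iff vector_matrix_mult_def sum_negf)

lemma vector_matrix_mult_axis:
  fixes T :: "'a::comm_ring_1 ^ 'n ^ 'm::finite"
  shows "axis i 1 v* T = T $ i"
proof -
  have "axis i 1 v* T = (\<Sum>j\<in>UNIV. if j = i then T $ j else 0)"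
    unfolding vector_matrix_mult_rows by (intro sum.cong) (auto simp: axis_def)
  then show ?thesis by simp
qed

lemmas vector_matrix_mult_simps =
  vector_matrix_mult_add vector_matrix_mult_diff vector_matrix_mult_scale vector_matrix_mult_zero
  vector_matrix_mult_uminus

lemma smult_cancel_left:
  fixes x y :: "'a::idom ^ 'n"
  assumes "a \<noteq> 0" "a *s x = a *s y"
  shows "x = y"
  using assms by (simp add: vec_eq_iff)

lemma prime_divides_vector:
  fixes x y :: "'a::idom ^ 'n"
  assumes "prime_elem \<beta>" "\<not> \<beta> dvd \<alpha>" "\<alpha> *s x = \<beta> *s y"
  obtains z where "x = \<beta> *s z" "y = \<alpha> *s z"
proof -
  have "\<beta> dvd x $ i" for i
  proof -
    have "\<alpha> * x $ i = \<beta> * y $ i" using assms(3) by (simp add: vec_eq_iff)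
    then have "\<beta> dvd \<alpha> * x $ i" by simp
    then show ?thesis using assms prime_elem_dvd_multD by blast
  qed
  then have "\<forall>i. \<exists>q. x $ i = \<beta> * q" by (simp add: dvd_def)
  then obtain z where "\<forall>i. x $ i = \<beta> * z i" by metis
  then have x: "x = \<beta> *s (\<chi> i. z i)" by (simp add: vec_eq_iff)
  have "\<beta> \<noteq> 0" using assms(1) by auto
  moreover have "\<beta> *s y = \<beta> *s (\<alpha> *s (\<chi> i. z i))"
    using assms(3) x by (auto simp: vec_eq_iff mult_ac)
  ultimately have "y = \<alpha> *s (\<chi> i. z i)" by (rule smult_cancel_left)
  then show ?thesis using that x by blast
qed

section \<open>Homogeneous derivations\<close>

lemma homogeneous_diff: "homogeneous_deriv k x \<Longrightarrow> homogeneous_deriv k y \<Longrightarrow> homogeneous_deriv k (x - y)"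
  by (simp add: homogeneous_deriv_def graded_diff)

lemma homogeneous_zero [simp]: "homogeneous_deriv k 0"
  by (simp add: homogeneous_deriv_def)

lemma homogeneous_scale:
  "s \<in> graded_part j \<Longrightarrow> homogeneous_deriv k x \<Longrightarrow> homogeneous_deriv (j + k) (s *s x)"
  by (simp add: homogeneous_deriv_def graded_mult)

definition deriv_comp :: "int \<Rightarrow> ('n::finite, 'k::comm_ring_1) deriv \<Rightarrow> ('n, 'k) deriv" where
  "deriv_comp k x = (\<chi> i. hcomp k (x $ i))"

lemma homogeneous_deriv_comp [simp]: "homogeneous_deriv k (deriv_comp k x)"
  by (simp add: homogeneous_deriv_def deriv_comp_def)

lemma deriv_comp_add: "deriv_comp k (x + y) = deriv_comp k x + deriv_comp k y"
  by (simp add: deriv_comp_def vec_eq_iff hcomp_add)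

lemma deriv_comp_scale: "s \<in> graded_part j \<Longrightarrow> deriv_comp k (s *s x) = s *s deriv_comp (k - j) x"
  by (simp add: deriv_comp_def vec_eq_iff hcomp_mult_graded)

lemma homogeneous_neg_eq_0: "homogeneous_deriv k x \<Longrightarrow> k < 0 \<Longrightarrow> x = 0"
  by (auto simp: homogeneous_deriv_def vec_eq_iff intro: graded_neg_eq_0)

lemma deriv_comp_of_homogeneous: "homogeneous_deriv k x \<Longrightarrow> deriv_comp k x = x"
  by (simp add: vec_eq_iff homogeneous_deriv_def deriv_comp_def hcomp_of_graded[where j = k])

lemma deriv_comp_combination:
  fixes T :: "('n::finite, 'k::comm_ring_1) mpoly ^ 'n ^ 'm::finite"
  assumes "\<And>i. homogeneous_deriv (d i) (T $ i)"
  shows "deriv_comp k (c v* T) = (\<chi> i. hcomp (k - d i) (c $ i)) v* T"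
proof -
  have "hcomp k (c $ i * T $ i $ j) = hcomp (k - d i) (c $ i) * T $ i $ j" for i j
    using hcomp_mult_graded[of "T $ i $ j" "d i" k "c $ i"] assms
    by (simp add: homogeneous_deriv_def mult.commute)
  then show ?thesis
    by (simp add: vec_eq_iff deriv_comp_def vector_matrix_mult_def hcomp_sum)
qed

text \<open>
  Replacing arbitrary coordinates by their components of the right degree does not change a
  homogeneous element.
\<close>

lemma homogeneous_coordinates:
  fixes T :: "('n::finite, 'k::comm_ring_1) mpoly ^ 'n ^ 'm::finite"
  assumes "\<And>i. homogeneous_deriv (d i) (T $ i)" "x \<in> range (\<lambda>c. c v* T)" "homogeneous_deriv k x"
  obtains c where "x = c v* T" "\<And>i. c $ i \<in> graded_part (k - d i)"
proof -
  obtain c where c: "x = c v* T" using assms(2) by blast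
  have "x = deriv_comp k x" using assms(3) by (simp add: deriv_comp_of_homogeneous)
  also have "\<dots> = (\<chi> i. hcomp (k - d i) (c $ i)) v* T"
    unfolding c by (rule deriv_comp_combination) fact
  finally show ?thesis by (rule that) simp
qed

lemma sum_deriv_comp:
  obtains J where "finite J" "x = (\<Sum>j\<in>J. deriv_comp j x)"
proof -
  let ?J = "\<Union>i. (\<lambda>m. int (monom_degree m)) ` Poly_Mapping.keys (x $ i)"
  have fin: "finite ?J" by simp
  moreover have "x = (\<Sum>j\<in>?J. deriv_comp j x)"
    unfolding vec_eq_iff sum_component deriv_comp_def vec_lambda_beta
    using fin by (intro allI sum_hcomp[symmetric]) auto
  ultimately show ?thesis by (rule that)
qed

lemma apply_deriv_add: "apply_deriv (x + y) p = apply_deriv x p + apply_deriv y p"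
  by (simp add: apply_deriv_def algebra_simps sum.distrib)

lemma apply_deriv_diff: "apply_deriv (x - y) p = apply_deriv x p - apply_deriv y p"
  by (simp add: apply_deriv_def algebra_simps sum_subtractf)

lemma apply_deriv_scale: "apply_deriv (s *s x) p = s * apply_deriv x p"
  by (simp add: apply_deriv_def sum_distrib_left mult.assoc)

lemma apply_deriv_zero [simp]: "apply_deriv 0 p = 0"
  by (simp add: apply_deriv_def)

lemma apply_deriv_sum: "apply_deriv (\<Sum>i\<in>I. f i) p = (\<Sum>i\<in>I. apply_deriv (f i) p)"
  by (induction I rule: infinite_finite_induct) (simp_all add: apply_deriv_add)

lemma apply_deriv_combination: "apply_deriv (c v* T) p = (\<Sum>i\<in>UNIV. c $ i * apply_deriv (T $ i) p)"
  by (simp add: vector_matrix_mult_rows apply_deriv_scale apply_deriv_sum)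

lemmas apply_deriv_simps = apply_deriv_add apply_deriv_diff apply_deriv_scale apply_deriv_combination

lemma apply_deriv_form_combination:
  assumes "\<alpha> \<in> graded_part 1" "\<beta> \<in> graded_part 1"
  shows "apply_deriv x (cpoly a * \<alpha> + cpoly b * \<beta>) = cpoly a * apply_deriv x \<alpha> + cpoly b * apply_deriv x \<beta>"
proof -
  obtain u v where uv: "\<alpha> = linear_form u" "\<beta> = linear_form v" using assms graded_1_linear_form by metis
  have "cpoly a * \<alpha> + cpoly b * \<beta> = linear_form (a *s u + b *s v)"
    by (simp add: uv linear_form_add linear_form_scale)
  then show ?thesis
    by (simp add: uv apply_deriv_linear_form cpoly_add cpoly_mult algebra_simps sum.distrib sum_distrib_left)
qed

lemma apply_deriv_form_scale:
  assumes "\<alpha> \<in> graded_part 1"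
  shows "apply_deriv x (cpoly a * \<alpha>) = cpoly a * apply_deriv x \<alpha>"
  using apply_deriv_form_combination[OF assms assms, of x a 0] by simp

lemma apply_deriv_graded:
  assumes "\<alpha> \<in> graded_part 1" "homogeneous_deriv k x"
  shows "apply_deriv x \<alpha> \<in> graded_part k"
proof -
  obtain u where u: "\<alpha> = linear_form u" using assms graded_1_linear_form by metis
  have "x $ i * cpoly (u $ i) \<in> graded_part (k + 0)" for i
    using assms(2) by (intro graded_mult) (simp_all add: homogeneous_deriv_def)
  then show ?thesis unfolding u apply_deriv_linear_form by (intro graded_sum) simp
qed

lemma apply_deriv_comp:
  assumes "\<alpha> \<in> graded_part 1"
  shows "apply_deriv (deriv_comp k x) \<alpha> = hcomp k (apply_deriv x \<alpha>)"
proof -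
  obtain u where u: "\<alpha> = linear_form u" using assms graded_1_linear_form by metis
  have "hcomp k (x $ i * cpoly (u $ i)) = hcomp k (x $ i) * cpoly (u $ i)" for i
    using hcomp_mult_graded[OF graded_cpoly, of k "u $ i" "x $ i"] by (simp add: mult.commute)
  then show ?thesis by (simp add: u apply_deriv_linear_form deriv_comp_def hcomp_sum)
qed

definition euler_deriv :: "('n::finite, 'k::comm_ring_1) deriv" where
  "euler_deriv = (\<chi> i. var i)"

lemma apply_euler_deriv:
  assumes "\<alpha> \<in> graded_part 1"
  shows "apply_deriv euler_deriv \<alpha> = \<alpha>"
proof -
  obtain u where u: "\<alpha> = linear_form u" using assms graded_1_linear_form by metis
  show ?thesis unfolding u apply_deriv_linear_form by (simp add: linear_form_vars euler_deriv_def mult.commute)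
qed

lemma homogeneous_euler_deriv: "homogeneous_deriv 1 euler_deriv"
  by (simp add: homogeneous_deriv_def euler_deriv_def)

section \<open>Logarithmic derivations\<close>

lemma arrangement_form_nonzero:
  assumes "arrangement A" "H \<in> A" "H = zero_locus \<alpha>"
  shows "\<alpha> \<noteq> 0"
proof
  assume "\<alpha> = 0"
  then have "H = UNIV" using assms by (simp add: zero_locus_def)
  obtain \<beta> where \<beta>: "\<beta> \<in> graded_part 1" "\<beta> \<noteq> 0" "H = zero_locus \<beta>"
    using assms by (auto simp: arrangement_def linear_hyperplane_def)
  then obtain b where b: "\<beta> = linear_form b" using graded_1_linear_form by metis
  then obtain p where "dot b p = 1" using \<beta> dual_vector[of b] by auto
  then have "p \<notin> H" using \<beta> b by (simp add: zero_locus_def)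
  then show False using \<open>H = UNIV\<close> by simp
qed

lemma arrangement_formE:
  assumes "arrangement A" "H \<in> A"
  obtains \<alpha> where "\<alpha> \<in> graded_part 1" "\<alpha> \<noteq> 0" "H = zero_locus \<alpha>"
  using assms by (auto simp: arrangement_def linear_hyperplane_def)

lemma arrangement_minus: "arrangement A \<Longrightarrow> arrangement (A - B)"
  by (auto simp: arrangement_def)

lemma arrangement_forms_not_dvd:
  fixes A :: "('k::field ^ 'n::{finite,linorder}) set set"
  assumes "arrangement A" "H \<in> A" "H' \<in> A" "H \<noteq> H'"
    "\<alpha> \<in> graded_part 1" "H = zero_locus \<alpha>" "\<beta> \<in> graded_part 1" "H' = zero_locus \<beta>"
  shows "\<not> \<alpha> dvd \<beta>"
proof
  assume "\<alpha> dvd \<beta>"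
  moreover have "\<beta> \<noteq> 0" using assms arrangement_form_nonzero by blast
  ultimately obtain c where "c \<noteq> 0" "\<beta> = cpoly c * \<alpha>" using assms linear_form_dvd_linear_form by metis
  then have "H = H'" using assms by (simp add: zero_locus_def)
  then show False using assms by simp
qed

lemma log_derivsD:
  "x \<in> log_derivs A \<Longrightarrow> H \<in> A \<Longrightarrow> \<alpha> \<in> graded_part 1 \<Longrightarrow> H = zero_locus \<alpha> \<Longrightarrow> \<alpha> dvd apply_deriv x \<alpha>"
  by (simp add: log_derivs_def)

text \<open>
  Two defining forms of a hyperplane are proportional, and proportional forms impose the same
  condition on a derivation.
\<close>

lemma log_derivsI:
  fixes A :: "('k::field ^ 'n::{finite,linorder}) set set"
  assumes A: "arrangement A"
    and "\<And>H. H \<in> A \<Longrightarrow> \<exists>\<alpha>\<in>graded_part 1. H = zero_locus \<alpha> \<and> \<alpha> dvd apply_deriv x \<alpha>"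
  shows "x \<in> log_derivs A"
  unfolding log_derivs_def
proof (intro CollectI ballI impI)
  fix H \<beta>
  assume H: "H \<in> A" and \<beta>: "\<beta> \<in> graded_part 1" "H = zero_locus \<beta>"
  obtain \<alpha> where \<alpha>: "\<alpha> \<in> graded_part 1" "H = zero_locus \<alpha>" "\<alpha> dvd apply_deriv x \<alpha>"
    using assms(2) H by blast
  have nz: "\<alpha> \<noteq> 0" "\<beta> \<noteq> 0" using A H \<alpha> \<beta> arrangement_form_nonzero by blast+
  then obtain c where c: "\<beta> = cpoly c * \<alpha>" using \<alpha> \<beta> zero_locus_subset[of \<alpha> \<beta>] by auto
  obtain q where q: "apply_deriv x \<alpha> = \<alpha> * q" using \<alpha>(3) by blast
  have "apply_deriv x \<beta> = \<beta> * q"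
    by (simp add: c apply_deriv_form_scale \<alpha> q mult.assoc)
  then show "\<beta> dvd apply_deriv x \<beta>" by simp
qed

lemma log_derivs_zero [simp]: "0 \<in> log_derivs A"
  by (simp add: log_derivs_def)

lemma log_derivs_add: "x \<in> log_derivs A \<Longrightarrow> y \<in> log_derivs A \<Longrightarrow> x + y \<in> log_derivs A"
  by (simp add: log_derivs_def apply_deriv_add)

lemma log_derivs_diff: "x \<in> log_derivs A \<Longrightarrow> y \<in> log_derivs A \<Longrightarrow> x - y \<in> log_derivs A"
  by (simp add: log_derivs_def apply_deriv_diff)

lemma log_derivs_scale: "x \<in> log_derivs A \<Longrightarrow> s *s x \<in> log_derivs A"
  by (simp add: log_derivs_def apply_deriv_scale)

lemma log_derivs_sum: "(\<And>i. i \<in> I \<Longrightarrow> f i \<in> log_derivs A) \<Longrightarrow> sum f I \<in> log_derivs A"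
  by (induction I rule: infinite_finite_induct) (auto intro: log_derivs_add)

lemma log_derivs_antimono: "B \<subseteq> A \<Longrightarrow> log_derivs A \<subseteq> log_derivs B"
  by (auto simp: log_derivs_def)

lemma euler_deriv_log: "euler_deriv \<in> log_derivs A"
  by (simp add: log_derivs_def apply_euler_deriv)

lemma deriv_comp_log:
  assumes "x \<in> log_derivs A"
  shows "deriv_comp k x \<in> log_derivs A"
  unfolding log_derivs_def
proof (intro CollectI ballI impI)
  fix H \<alpha>
  assume "H \<in> A" "\<alpha> \<in> graded_part 1" "H = zero_locus \<alpha>"
  then obtain q where "apply_deriv x \<alpha> = \<alpha> * q" using log_derivsD[OF assms] by blast
  then show "\<alpha> dvd apply_deriv (deriv_comp k x) \<alpha>"
    using \<open>\<alpha> \<in> graded_part 1\<close> by (simp add: apply_deriv_comp hcomp_mult_graded)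
qed

locale marked_arrangement =
  fixes A :: "('k::field ^ 'n::{finite,linorder}) set set" and H and \<alpha> :: "('n, 'k) mpoly"
  assumes arr: "arrangement A" and H: "H \<in> A" and \<alpha>: "\<alpha> \<in> graded_part 1" "H = zero_locus \<alpha>"
begin

lemma form_nonzero: "\<alpha> \<noteq> 0"
  using arrangement_form_nonzero arr H \<alpha> by blast

lemma form_prime: "prime_elem \<alpha>"
  using prime_linear_form \<alpha> form_nonzero by blast

lemma const_term_form: "const_term \<alpha> = 0"
  using \<alpha>(1) by (rule const_term_graded) simp

lemma deletion_superset: "x \<in> log_derivs A \<Longrightarrow> x \<in> log_derivs (A - {H})"
  using log_derivs_antimono[of "A - {H}" A] by blast

lemma log_derivs_iff: "x \<in> log_derivs A \<longleftrightarrow> x \<in> log_derivs (A - {H}) \<and> \<alpha> dvd apply_deriv x \<alpha>"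
proof
  assume "x \<in> log_derivs A"
  then show "x \<in> log_derivs (A - {H}) \<and> \<alpha> dvd apply_deriv x \<alpha>"
    using log_derivsD[OF _ H \<alpha>] deletion_superset by simp
next
  assume *: "x \<in> log_derivs (A - {H}) \<and> \<alpha> dvd apply_deriv x \<alpha>"
  show "x \<in> log_derivs A"
  proof (rule log_derivsI[OF arr])
    fix H' assume "H' \<in> A"
    show "\<exists>\<beta>\<in>graded_part 1. H' = zero_locus \<beta> \<and> \<beta> dvd apply_deriv x \<beta>"
    proof (cases "H' = H")
      case True
      then show ?thesis using * \<alpha> by blast
    next
      case False
      obtain \<beta> where "\<beta> \<in> graded_part 1" "H' = zero_locus \<beta>"
        using arrangement_formE[OF arr \<open>H' \<in> A\<close>] by blast
      then show ?thesis using * False \<open>H' \<in> A\<close> log_derivsD[of x "A - {H}" H' \<beta>] by blast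
    qed
  qed
qed

text \<open>
  The defining forms of the other hyperplanes are coprime to \<open>\<alpha>\<close>, so a factor \<open>\<alpha>\<close> can be cancelled in
  their conditions.  This makes \<open>D(A - {H})\<close> the set of all \<open>x\<close> with \<open>\<alpha> x \<in> D(A)\<close>, a description in
  terms of \<open>D(A)\<close> alone on which the study of deletions rests.
\<close>

lemma deletion_iff: "x \<in> log_derivs (A - {H}) \<longleftrightarrow> \<alpha> *s x \<in> log_derivs A"
proof
  assume "x \<in> log_derivs (A - {H})"
  then show "\<alpha> *s x \<in> log_derivs A"
    by (simp add: log_derivs_iff log_derivs_scale apply_deriv_scale)
next
  assume *: "\<alpha> *s x \<in> log_derivs A"
  show "x \<in> log_derivs (A - {H})"
  proof (rule log_derivsI[OF arrangement_minus[OF arr]])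
    fix H' assume H': "H' \<in> A - {H}"
    then have "H' \<in> A" "H' \<noteq> H" by auto
    from \<open>H' \<in> A\<close> obtain \<beta> where \<beta>: "\<beta> \<in> graded_part 1" "\<beta> \<noteq> 0" "H' = zero_locus \<beta>"
      by (rule arrangement_formE[OF arr])
    have "\<beta> dvd \<alpha> * apply_deriv x \<beta>"
      using log_derivsD[OF * \<open>H' \<in> A\<close> \<beta>(1,3)] by (simp add: apply_deriv_scale)
    moreover have "\<not> \<beta> dvd \<alpha>"
      by (rule arrangement_forms_not_dvd[OF arr \<open>H' \<in> A\<close> H \<open>H' \<noteq> H\<close> \<beta>(1,3) \<alpha>])
    ultimately have "\<beta> dvd apply_deriv x \<beta>"
      using prime_linear_form[OF \<beta>(1,2)] prime_elem_dvd_multD by blast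
    then show "\<exists>\<beta>\<in>graded_part 1. H' = zero_locus \<beta> \<and> \<beta> dvd apply_deriv x \<beta>" using \<beta> by blast
  qed
qed

end

section \<open>Minimal resolutions\<close>

lemma vector_axis_expansion: "(v :: 'a::comm_ring_1 ^ 'p::finite) = (\<Sum>i\<in>UNIV. v $ i *s axis i 1)"
proof -
  have "(\<Sum>i\<in>UNIV. v $ i *s axis i 1) $ k = (\<Sum>i\<in>UNIV. if i = k then v $ i else 0)" for k
    unfolding sum_component by (intro sum.cong) (auto simp: axis_def)
  then show ?thesis by (simp add: vec_eq_iff)
qed

lemma sum_smult_swap:
  fixes w :: "'j \<Rightarrow> 'a::comm_ring_1 ^ 'p"
  shows "(\<Sum>i\<in>I. x i *s (\<Sum>j\<in>J. N i j *s w j)) = (\<Sum>j\<in>J. (\<Sum>i\<in>I. x i * N i j) *s w j)"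
  unfolding vec_eq_iff
proof
  fix k
  have "(\<Sum>i\<in>I. x i *s (\<Sum>j\<in>J. N i j *s w j)) $ k = (\<Sum>i\<in>I. \<Sum>j\<in>J. x i * N i j * w j $ k)"
    by (simp add: sum_distrib_left mult.assoc)
  also have "\<dots> = (\<Sum>j\<in>J. \<Sum>i\<in>I. x i * N i j * w j $ k)" by (rule sum.swap)
  also have "\<dots> = (\<Sum>j\<in>J. (\<Sum>i\<in>I. x i * N i j) *s w j) $ k"
    by (simp add: sum_distrib_right)
  finally show "(\<Sum>i\<in>I. x i *s (\<Sum>j\<in>J. N i j *s w j)) $ k = (\<Sum>j\<in>J. (\<Sum>i\<in>I. x i * N i j) *s w j) $ k" .
qed

lemma sum_vector_matrix_mult:
  fixes M :: "'a::comm_ring_1 ^ 'n ^ 'p::finite"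
  shows "(\<Sum>j\<in>I. f j) v* M = (\<Sum>j\<in>I. f j v* M)"
  by (induction I rule: infinite_finite_induct) (simp_all add: vector_matrix_mult_simps)

lemma matrix_row_in_range:
  fixes T :: "'a::comm_ring_1 ^ 'n ^ 'p::finite"
  shows "T $ i \<in> range (\<lambda>c. c v* T)"
  using rangeI[of "\<lambda>c. c v* T" "axis i 1"] by (simp add: vector_matrix_mult_axis)

lemma kernel_row:
  fixes M :: "'a::comm_ring_1 ^ 'p::finite ^ 'q::finite"
  assumes "range (\<lambda>e. e v* M) = {c. c v* \<Theta> = 0}"
  shows "M $ l v* \<Theta> = 0"
  using matrix_row_in_range[of M l] unfolding assms by simp

lemma injective_row_nonzero:
  fixes M :: "'a::comm_ring_1 ^ 'p::finite ^ 'q::finite"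
  assumes "inj (\<lambda>e. e v* M)"
  shows "M $ l \<noteq> 0"
proof
  assume "M $ l = 0"
  then have "axis l 1 v* M = 0 v* M" by (simp add: vector_matrix_mult_axis vector_matrix_mult_zero)
  then have "axis l 1 = (0 :: 'a ^ 'q)" by (rule injD[OF assms])
  then show False by (simp add: axis_eq_0_iff)
qed

text \<open>
  A free module has no relations among minimal generators.  Since \<open>D\<close> has the basis \<open>w\<close>, the surjection
  \<open>c \<mapsto> c v* \<Theta>\<close> has a section, and \<open>r(c) = c - section (c v* \<Theta>)\<close> is a retraction onto the module of
  relations.  Writing \<open>r(e\<^sub>i) = E\<^sub>i v* M\<close>, a row of \<open>M\<close> is \<open>M\<^sub>l = r(M\<^sub>l) = (\<Sum>\<^sub>i M\<^sub>l\<^sub>i E\<^sub>i) v* M\<close>, so by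
  injectivity \<open>e\<^sub>l = \<Sum>\<^sub>i M\<^sub>l\<^sub>i E\<^sub>i\<close>.  By minimality the right-hand side has no constant terms.
\<close>

lemma minimal_resolution_not_split:
  fixes M :: "('n::finite, 'k::field) mpoly ^ 'p::finite ^ 'q::finite" and w :: "'j \<Rightarrow> ('n, 'k) deriv"
  assumes res: "minimal_free_resolution b a M D"
    and J: "finite J"
    and D: "D = {\<Sum>j\<in>J. c j *s w j | c. True}"
    and indep: "\<And>c. (\<Sum>j\<in>J. c j *s w j) = 0 \<Longrightarrow> \<forall>j\<in>J. c j = 0"
  shows False
proof -
  obtain \<Theta> where inj: "inj (\<lambda>e. e v* M)" and ker: "range (\<lambda>e. e v* M) = {c. c v* \<Theta> = 0}"
    and img: "range (\<lambda>c. c v* \<Theta>) = D" and min: "\<And>l i. const_term (M $ l $ i) = 0"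
    using res unfolding minimal_free_resolution_def by blast
  have "\<exists>c. c v* \<Theta> = w j" if "j \<in> J" for j
  proof -
    have "w j = (\<Sum>i\<in>J. (if i = j then 1 else 0) *s w i)"
      using J that by (simp add: if_distrib[where f = "\<lambda>c. c *s _"] cong: if_cong)
    then have "w j \<in> D" unfolding D by auto
    then show ?thesis using img by force
  qed
  then obtain pre where pre: "\<And>j. j \<in> J \<Longrightarrow> pre j v* \<Theta> = w j" by metis
  have "\<exists>N. \<Theta> $ i = (\<Sum>j\<in>J. N j *s w j)" for i
  proof -
    have "\<Theta> $ i \<in> D" using matrix_row_in_range[of \<Theta> i] unfolding img .
    then show ?thesis unfolding D by auto
  qed
  then obtain N where N: "\<And>i. \<Theta> $ i = (\<Sum>j\<in>J. N i j *s w j)" by metis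
  have pres: "(\<Sum>j\<in>J. c j *s pre j) v* \<Theta> = (\<Sum>j\<in>J. c j *s w j)" for c
    by (simp add: sum_vector_matrix_mult vector_matrix_mult_scale pre)
  have "axis i 1 - (\<Sum>j\<in>J. N i j *s pre j) \<in> range (\<lambda>e. e v* M)" for i
    unfolding ker by (simp add: vector_matrix_mult_diff pres vector_matrix_mult_axis N[symmetric])
  then have "\<forall>i. \<exists>E. axis i 1 - (\<Sum>j\<in>J. N i j *s pre j) = E v* M" by blast
  then obtain E where E: "\<And>i. axis i 1 - (\<Sum>j\<in>J. N i j *s pre j) = E i v* M" by metis
  fix l :: 'q
  have "M $ l v* \<Theta> = 0" by (rule kernel_row[OF ker])
  then have "(\<Sum>i\<in>UNIV. M $ l $ i *s (\<Sum>j\<in>J. N i j *s w j)) = 0"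
    by (simp add: vector_matrix_mult_rows N)
  also have "(\<Sum>i\<in>UNIV. M $ l $ i *s (\<Sum>j\<in>J. N i j *s w j)) =
      (\<Sum>j\<in>J. (\<Sum>i\<in>UNIV. M $ l $ i * N i j) *s w j)"
    by (rule sum_smult_swap)
  finally have zero: "(\<Sum>i\<in>UNIV. M $ l $ i * N i j) = 0" if "j \<in> J" for j
    using indep[of "\<lambda>j. \<Sum>i\<in>UNIV. M $ l $ i * N i j"] that by blast
  have "M $ l = (\<Sum>i\<in>UNIV. M $ l $ i *s axis i 1)"
    by (rule vector_axis_expansion)
  also have "\<dots> = (\<Sum>i\<in>UNIV. M $ l $ i *s (axis i 1 - (\<Sum>j\<in>J. N i j *s pre j)))
      + (\<Sum>j\<in>J. (\<Sum>i\<in>UNIV. M $ l $ i * N i j) *s pre j)"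
    unfolding sum_smult_swap[symmetric] vector_ssub_ldistrib sum_subtractf by simp
  also have "\<dots> = (\<Sum>i\<in>UNIV. M $ l $ i *s (E i v* M))"
    by (simp add: E zero)
  also have "\<dots> = (\<Sum>i\<in>UNIV. M $ l $ i *s E i) v* M"
    by (simp add: sum_vector_matrix_mult vector_matrix_mult_scale)
  finally have "axis l 1 v* M = (\<Sum>i\<in>UNIV. M $ l $ i *s E i) v* M"
    by (simp add: vector_matrix_mult_axis)
  then have "axis l 1 = (\<Sum>i\<in>UNIV. M $ l $ i *s E i)" by (rule injD[OF inj])
  then have "axis l 1 $ l = (\<Sum>i\<in>UNIV. M $ l $ i *s E i) $ l" by simp
  then have "(1 :: ('n, 'k) mpoly) = (\<Sum>i\<in>UNIV. M $ l $ i * E i $ l)"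
    by (simp add: axis_def)
  then have "const_term (1 :: ('n, 'k) mpoly) = const_term (\<Sum>i\<in>UNIV. M $ l $ i * E i $ l)" by simp
  then show False by (simp add: min del: const_term_sum) (simp add: min)
qed

text \<open>
  The given basis may be infinite and inhomogeneous, but finitely many of its elements suffice to
  express the generators of the resolution, and these already span.
\<close>

lemma minimal_resolution_not_free:
  fixes M :: "('n::finite, 'k::field) mpoly ^ 'p::finite ^ 'q::finite"
  assumes res: "minimal_free_resolution b a M (log_derivs A)"
  shows "\<not> free_arrangement A"
proof
  assume "free_arrangement A"
  then obtain B where B: "\<not> vecmod.dependent B" "vecmod.span B = log_derivs A"
    unfolding free_arrangement_def by blast
  obtain \<Theta> :: "('n, 'k) mpoly ^ 'n ^ 'p" where img: "range (\<lambda>c. c v* \<Theta>) = log_derivs A"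
    using res unfolding minimal_free_resolution_def by blast
  have in_span: "\<Theta> $ i \<in> vecmod.span B" for i
    unfolding B(2) using matrix_row_in_range[of \<Theta> i] unfolding img .
  define J where "J = (\<Union>i. {v. vecmod.representation B (\<Theta> $ i) v \<noteq> 0})"
  have fin: "finite J" unfolding J_def by (intro finite_UN_I) (simp_all add: vecmod.finite_representation)
  have sub: "J \<subseteq> B" unfolding J_def using vecmod.representation_ne_zero by blast
  have "\<Theta> $ i \<in> vecmod.span J" for i
  proof -
    have "\<Theta> $ i = (\<Sum>v | vecmod.representation B (\<Theta> $ i) v \<noteq> 0. vecmod.representation B (\<Theta> $ i) v *s v)"
      using vecmod.sum_nonzero_representation_eq[OF B(1) in_span] by simp
    also have "\<dots> \<in> vecmod.span J"
      by (intro vecmod.span_sum vecmod.span_scale vecmod.span_base) (auto simp: J_def)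
    finally show ?thesis .
  qed
  then have "c v* \<Theta> \<in> vecmod.span J" for c
    unfolding vector_matrix_mult_rows by (intro vecmod.span_sum vecmod.span_scale)
  then have "range (\<lambda>c. c v* \<Theta>) \<subseteq> vecmod.span J" by blast
  then have "log_derivs A = vecmod.span J"
    using vecmod.span_mono[OF sub] unfolding img B(2) by blast
  then have D: "log_derivs A = {\<Sum>v\<in>J. c v *s v | c. True}"
    using vecmod.span_finite[OF fin] by auto
  have "\<not> vecmod.dependent J" using B(1) sub vecmod.dependent_mono by blast
  then have "\<forall>v\<in>J. c v = 0" if "(\<Sum>v\<in>J. c v *s v) = 0" for c
    using that vecmod.dependent_finite[OF fin] by blast
  then show False using minimal_resolution_not_split[OF res fin D] by blast
qed

lemma vector_matrix_mult_assoc: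
  fixes N :: "'a::comm_ring_1 ^ 'm::finite ^ 'p::finite"
  assumes "\<And>i. T' $ i = N $ i v* T"
  shows "c v* T' = (c v* N) v* T"
  unfolding vec_eq_iff
proof
  fix j
  have "(c v* T') $ j = (\<Sum>i\<in>UNIV. c $ i * (\<Sum>k\<in>UNIV. N $ i $ k * T $ k $ j))"
    by (simp add: vector_matrix_mult_def assms mult_ac)
  also have "\<dots> = (\<Sum>k\<in>UNIV. (\<Sum>i\<in>UNIV. c $ i * N $ i $ k) * T $ k $ j)"
    by (simp add: sum_distrib_left sum_distrib_right mult.assoc) (rule sum.swap)
  also have "\<dots> = ((c v* N) v* T) $ j"
    by (simp add: vector_matrix_mult_def mult_ac)
  finally show "(c v* T') $ j = ((c v* N) v* T) $ j" .
qed

lemma resolution_generator_coordinates: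
  fixes \<Theta> :: "('n::finite, 'k::comm_ring_1) mpoly ^ 'n ^ 'p::finite" and \<Theta>' :: "('n, 'k) mpoly ^ 'n ^ 'p'::finite"
  assumes "\<And>i. homogeneous_deriv (a $ i) (\<Theta> $ i)" "\<And>i. homogeneous_deriv (a' $ i) (\<Theta>' $ i)"
    "range (\<lambda>c. c v* \<Theta>') \<subseteq> range (\<lambda>c. c v* \<Theta>)"
  obtains N where "\<And>i. \<Theta>' $ i = N $ i v* \<Theta>" "\<And>i k. N $ i $ k \<in> graded_part (a' $ i - a $ k)"
proof -
  have "\<exists>c. \<Theta>' $ i = c v* \<Theta> \<and> (\<forall>k. c $ k \<in> graded_part (a' $ i - a $ k))" for i
  proof -
    have "\<Theta>' $ i \<in> range (\<lambda>c. c v* \<Theta>)"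
      using assms(3) matrix_row_in_range[of \<Theta>' i] by blast
    then show ?thesis using homogeneous_coordinates[OF assms(1) _ assms(2)[of i]] by metis
  qed
  then obtain c where "\<And>i. \<Theta>' $ i = c i v* \<Theta> \<and> (\<forall>k. c i $ k \<in> graded_part (a' $ i - a $ k))" by metis
  then show ?thesis using that[of "\<chi> i. c i"] by simp
qed

lemma vector_matrix_mult_1:
  fixes M :: "'a::comm_ring_1 ^ 'p ^ 1"
  shows "e v* M = e $ 1 *s M $ 1"
  by (simp add: vector_matrix_mult_rows)

text \<open>
  Let \<open>N\<close> and \<open>P\<close> express each of the two systems of generators by the other one, and let \<open>R\<close> and \<open>R'\<close> be
  the relations.  Then \<open>R' N = s R\<close> and \<open>R P = s' R'\<close>, while \<open>N P\<close> is the identity up to multiples of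
  \<open>R'\<close>.  Since \<open>R'\<close> has no constant terms, those of \<open>s s'\<close> and of \<open>N P\<close> are those of \<open>1\<close> and of the
  identity matrix.  So \<open>s\<close> has degree \<open>0\<close>, and every row of \<open>N\<close> contains an entry of degree \<open>0\<close>.
\<close>

lemma one_relation_resolution_unique:
  fixes M :: "('n::{finite,linorder}, 'k::field) mpoly ^ 'p::finite ^ 1"
    and M' :: "('n, 'k) mpoly ^ 'p'::finite ^ 1"
  assumes res: "minimal_free_resolution b a M D" "minimal_free_resolution b' a' M' D"
  shows "b' $ 1 = b $ 1" "\<exists>i. a' $ i' = a $ i"
proof -
  obtain \<Theta> where M: "\<And>i. M $ 1 $ i \<in> graded_part (b $ 1 - a $ i)"
    and \<Theta>: "\<And>i. homogeneous_deriv (a $ i) (\<Theta> $ i)" and inj: "inj (\<lambda>e. e v* M)"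
    and ker: "range (\<lambda>e. e v* M) = {c. c v* \<Theta> = 0}" and img: "range (\<lambda>c. c v* \<Theta>) = D"
    using res(1) unfolding minimal_free_resolution_def by blast
  obtain \<Theta>' where M': "\<And>i. M' $ 1 $ i \<in> graded_part (b' $ 1 - a' $ i)"
    and \<Theta>': "\<And>i. homogeneous_deriv (a' $ i) (\<Theta>' $ i)" and inj': "inj (\<lambda>e. e v* M')"
    and ker': "range (\<lambda>e. e v* M') = {c. c v* \<Theta>' = 0}" and img': "range (\<lambda>c. c v* \<Theta>') = D"
    and min': "\<And>i. const_term (M' $ 1 $ i) = 0"
    using res(2) unfolding minimal_free_resolution_def by blast
  define R R' where "R = M $ 1" and "R' = M' $ 1"
  have kerE: "\<exists>s. c = s *s R" if "c v* \<Theta> = 0" for c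
    using that ker unfolding R_def vector_matrix_mult_1 by auto
  have kerE': "\<exists>s. c = s *s R'" if "c v* \<Theta>' = 0" for c
    using that ker' unfolding R'_def vector_matrix_mult_1 by auto
  have R: "R v* \<Theta> = 0" "R \<noteq> 0"
    unfolding R_def by (rule kernel_row[OF ker], rule injective_row_nonzero[OF inj])
  have R': "R' v* \<Theta>' = 0" "R' \<noteq> 0"
    unfolding R'_def by (rule kernel_row[OF ker'], rule injective_row_nonzero[OF inj'])
  obtain N where N: "\<And>i. \<Theta>' $ i = N $ i v* \<Theta>" "\<And>i k. N $ i $ k \<in> graded_part (a' $ i - a $ k)"
    using resolution_generator_coordinates[OF \<Theta> \<Theta>'] img img' by auto
  obtain P where P: "\<And>i. \<Theta> $ i = P $ i v* \<Theta>'"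
  proof -
    have "range (\<lambda>c. c v* \<Theta>) \<subseteq> range (\<lambda>c. c v* \<Theta>')" using img img' by simp
    then show ?thesis by (rule resolution_generator_coordinates[OF \<Theta>' \<Theta>]) (rule that)
  qed
  have "(R' v* N) v* \<Theta> = 0" using R'(1) vector_matrix_mult_assoc[OF N(1)] by simp
  then obtain s where s: "R' v* N = s *s R" using kerE by blast
  have "(R v* P) v* \<Theta>' = 0" using R(1) vector_matrix_mult_assoc[OF P] by simp
  then obtain s' where s': "R v* P = s' *s R'" using kerE' by blast
  have "\<exists>e. axis i 1 - N $ i v* P = e *s R'" for i
  proof (rule kerE')
    show "(axis i 1 - N $ i v* P) v* \<Theta>' = 0"
      using vector_matrix_mult_assoc[OF P, of "N $ i"]
      by (simp add: vector_matrix_mult_diff vector_matrix_mult_axis N(1))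
  qed
  then obtain E where E: "\<And>i. axis i 1 - N $ i v* P = E i *s R'" by metis
  have E_comp: "(axis i 1 :: ('n, 'k) mpoly ^ 'p') $ j = (\<Sum>k\<in>UNIV. N $ i $ k * P $ k $ j) + E i * R' $ j" for i j
  proof -
    have "axis i 1 = N $ i v* P + E i *s R'" using E[of i] by (simp add: algebra_simps)
    then show ?thesis by (simp add: vector_matrix_mult_def mult.commute)
  qed
  have "const_term s \<noteq> 0"
  proof -
    obtain j where j: "R' $ j \<noteq> 0" using R'(2) by (auto simp: vec_eq_iff)
    have "R' $ j = (\<Sum>i\<in>UNIV. R' $ i * (axis i 1 :: ('n, 'k) mpoly ^ 'p') $ j)"
      by (simp add: axis_def if_distrib cong: if_cong)
    also have "\<dots> = (\<Sum>i\<in>UNIV. R' $ i * (\<Sum>k\<in>UNIV. N $ i $ k * P $ k $ j)) + (\<Sum>i\<in>UNIV. R' $ i * E i) * R' $ j"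
      unfolding E_comp by (simp add: algebra_simps sum.distrib sum_distrib_left)
    also have "(\<Sum>i\<in>UNIV. R' $ i * (\<Sum>k\<in>UNIV. N $ i $ k * P $ k $ j)) = ((R' v* N) v* P) $ j"
      using arg_cong[OF vector_matrix_mult_assoc[of "N ** P" N P R'], of "\<lambda>v. v $ j"]
      by (simp add: vector_matrix_mult_def matrix_matrix_mult_def mult_ac vec_eq_iff)
    also have "(R' v* N) v* P = (s * s') *s R'"
      by (simp add: s vector_matrix_mult_scale s' vec_eq_iff mult.assoc)
    finally have "(s * s' + (\<Sum>i\<in>UNIV. R' $ i * E i)) * R' $ j = 1 * R' $ j"
      by (simp add: algebra_simps)
    then have "s * s' + (\<Sum>i\<in>UNIV. R' $ i * E i) = 1"
      using mult_right_cancel[OF j] by blast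
    from arg_cong[OF this, of const_term]
    have "const_term (s * s' + (\<Sum>i\<in>UNIV. R' $ i * E i)) = 1" by (simp only: lookup_one_zero)
    then have "const_term s * const_term s' = 1"
      using min' by (simp add: R'_def)
    then show ?thesis by auto
  qed
  moreover have "s \<in> graded_part (b' $ 1 - b $ 1)"
  proof -
    obtain k where k: "R $ k \<noteq> 0" using R(2) by (auto simp: vec_eq_iff)
    have "R $ k * s = (R' v* N) $ k" by (simp add: s mult.commute)
    also have "\<dots> = (\<Sum>i\<in>UNIV. R' $ i * N $ i $ k)" by (simp add: vector_matrix_mult_def mult.commute)
    also have "\<dots> \<in> graded_part (b' $ 1 - a $ k)"
    proof (rule graded_sum)
      fix i
      show "R' $ i * N $ i $ k \<in> graded_part (b' $ 1 - a $ k)"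
        using graded_mult[OF M'[of i] N(2)[of i k]] by (simp add: R'_def)
    qed
    finally show ?thesis
      using graded_mult_cancel[OF M[of k], folded R_def] k by fastforce
  qed
  ultimately show "b' $ 1 = b $ 1" using const_term_graded by fastforce
  have "(1 :: ('n, 'k) mpoly) = (\<Sum>k\<in>UNIV. N $ i' $ k * P $ k $ i') + E i' * R' $ i'"
    using E_comp[of i' i'] by (simp add: axis_def)
  then have "const_term (1 :: ('n, 'k) mpoly) = const_term ((\<Sum>k\<in>UNIV. N $ i' $ k * P $ k $ i') + E i' * R' $ i')"
    by simp
  then have "(\<Sum>k\<in>UNIV. const_term (N $ i' $ k) * const_term (P $ k $ i')) = 1"
    using min' by (simp add: R'_def)
  then have "\<exists>k. const_term (N $ i' $ k) \<noteq> 0"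
    by (metis (no_types, lifting) mult_zero_left sum.neutral zero_neq_one)
  then show "\<exists>k. a' $ i' = a $ k" using const_term_graded[OF N(2)] by fastforce
qed

text \<open>
  The form in which a module generated by a free module and one further element \<open>x\<close> is shown to have
  a resolution: only the coefficient of \<open>x\<close> in a syzygy has to be controlled, as it determines the
  remaining ones.
\<close>

lemma one_relation_resolution:
  fixes T :: "('n::{finite,linorder}, 'k::field) mpoly ^ 'n::{finite,linorder} ^ 'n::{finite,linorder}" and x :: "('n::{finite,linorder}, 'k) deriv"
  assumes indep: "\<And>c. c v* T = 0 \<Longrightarrow> c = 0"
    and hom: "\<And>i. homogeneous_deriv (d i) (T $ i)" "homogeneous_deriv e x"
    and D: "\<And>y. y \<in> D \<longleftrightarrow> (\<exists>s c. y = s *s x + c v* T)"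
    and rel: "\<alpha> *s x + f v* T = 0" and syz: "\<And>s c. s *s x + c v* T = 0 \<Longrightarrow> \<alpha> dvd s"
    and deg: "\<alpha> \<noteq> 0" "\<alpha> \<in> graded_part (b - e)" "\<And>i. f $ i \<in> graded_part (b - d i)"
    and min: "const_term \<alpha> = 0" "\<And>i. const_term (f $ i) = 0"
  shows "minimal_free_resolution ((\<chi> j. b) :: int ^ 1)
      (\<chi> i. case i of None \<Rightarrow> e | Some k \<Rightarrow> d k)
      (\<chi> j i. case i of None \<Rightarrow> \<alpha> | Some k \<Rightarrow> f $ k) D"
proof -
  let ?\<Theta> = "\<chi> i. case i of None \<Rightarrow> x | Some k \<Rightarrow> T $ k"
  let ?M = "(\<chi> j i. case i of None \<Rightarrow> \<alpha> | Some k \<Rightarrow> f $ k) :: ('n::{finite,linorder}, 'k::field) mpoly ^ 'n option ^ 1"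
  have \<Theta>: "c v* ?\<Theta> = c $ None *s x + (\<chi> k. c $ Some k) v* T" for c
    unfolding vector_matrix_mult_rows UNIV_option_conv
    by (subst sum.insert) (auto simp: sum.reindex)
  have M: "e' v* ?M = (\<chi> i. case i of None \<Rightarrow> e' $ 1 * \<alpha> | Some k \<Rightarrow> e' $ 1 * f $ k)" for e'
    unfolding vector_matrix_mult_1 by (simp add: vec_eq_iff split: option.split)
  have inj: "inj (\<lambda>e'. e' v* ?M)"
  proof (rule injI)
    fix u v assume eq: "u v* ?M = v v* ?M"
    have "u $ 1 * \<alpha> = v $ 1 * \<alpha>"
      using arg_cong[OF eq, of "\<lambda>v. v $ None"] unfolding M by simp
    then show "u = v" using deg(1) by (simp add: vec_eq_iff)
  qed
  have "e' v* ?M \<in> {c. c v* ?\<Theta> = 0}" for e'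
  proof -
    have "(e' v* ?M) v* ?\<Theta> = e' $ 1 *s (\<alpha> *s x + f v* T)"
      unfolding \<Theta> M by (simp add: vec_eq_iff vector_matrix_mult_def sum_distrib_left algebra_simps)
    then show ?thesis by (simp add: rel)
  qed
  moreover have "c \<in> range (\<lambda>e'. e' v* ?M)" if "c v* ?\<Theta> = 0" for c
  proof -
    have c: "c $ None *s x + (\<chi> k. c $ Some k) v* T = 0" using that unfolding \<Theta> .
    then obtain r where r: "c $ None = \<alpha> * r" using syz by (metis dvdE)
    have "((\<chi> k. c $ Some k) - r *s f) v* T = (c $ None *s x + (\<chi> k. c $ Some k) v* T) - r *s (\<alpha> *s x + f v* T)"
      by (simp add: vector_matrix_mult_simps vector_add_ldistrib vector_smult_assoc r mult.commute)
    also have "\<dots> = 0" using c rel by simp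
    finally have "(\<chi> k. c $ Some k) - r *s f = 0" by (rule indep)
    then have "c $ Some k = r * f $ k" for k by (simp add: vec_eq_iff)
    then have "c = (\<chi> j. r) v* ?M"
      unfolding M by (simp add: vec_eq_iff r mult.commute split: option.split)
    then show ?thesis by blast
  qed
  ultimately have ker: "range (\<lambda>e'. e' v* ?M) = {c. c v* ?\<Theta> = 0}" by blast
  have img: "range (\<lambda>c. c v* ?\<Theta>) = D"
  proof (intro equalityI subsetI)
    fix y assume "y \<in> range (\<lambda>c. c v* ?\<Theta>)"
    then show "y \<in> D" unfolding D \<Theta> by blast
  next
    fix y assume "y \<in> D"
    then obtain s c where "y = s *s x + c v* T" unfolding D by blast
    then have "y = (\<chi> i. case i of None \<Rightarrow> s | Some k \<Rightarrow> c $ k) v* ?\<Theta>" unfolding \<Theta> by simp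
    then show "y \<in> range (\<lambda>c. c v* ?\<Theta>)" by blast
  qed
  show ?thesis
    unfolding minimal_free_resolution_def
    using inj ker img hom deg min by (intro exI[of _ ?\<Theta>]) (simp split: option.split)
qed

lemma minimal_resolution_reindex:
  fixes M :: "('n::finite, 'k::field) mpoly ^ 'p::finite ^ 'q::finite" and \<pi> :: "'p'::finite \<Rightarrow> 'p"
  assumes res: "minimal_free_resolution b a M D" and \<pi>: "bij \<pi>"
  shows "minimal_free_resolution b (\<chi> i. a $ \<pi> i) (\<chi> j i. M $ j $ \<pi> i) D"
proof -
  obtain \<Theta> where M: "\<forall>j i. M $ j $ i \<in> graded_part (b $ j - a $ i)"
    and \<Theta>: "\<forall>i. homogeneous_deriv (a $ i) (\<Theta> $ i)" and inj: "inj (\<lambda>e. e v* M)"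
    and ker: "range (\<lambda>e. e v* M) = {c. c v* \<Theta> = 0}" and img: "range (\<lambda>c. c v* \<Theta>) = D"
    and min: "\<forall>j i. const_term (M $ j $ i) = 0"
    using res unfolding minimal_free_resolution_def by blast
  define re :: "('n, 'k) mpoly ^ 'p \<Rightarrow> ('n, 'k) mpoly ^ 'p'" where "re = (\<lambda>c. \<chi> i. c $ \<pi> i)"
  define un :: "('n, 'k) mpoly ^ 'p' \<Rightarrow> ('n, 'k) mpoly ^ 'p" where "un = (\<lambda>c. \<chi> i. c $ inv \<pi> i)"
  have re_un: "re (un c) = c" "un (re c') = c'" for c c'
    using \<pi> by (simp_all add: re_def un_def vec_eq_iff bij_is_inj bij_is_surj surj_f_inv_f)
  let ?\<Theta> = "\<chi> i. \<Theta> $ \<pi> i" and ?M = "\<chi> j i. M $ j $ \<pi> i"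
  have \<Theta>': "re c v* ?\<Theta> = c v* \<Theta>" for c
    unfolding vector_matrix_mult_rows re_def
    using sum.reindex_bij_betw[of \<pi> UNIV UNIV "\<lambda>i. c $ i *s \<Theta> $ i"] \<pi> by simp
  have M': "e v* ?M = re (e v* M)" for e
    by (simp add: re_def vec_eq_iff vector_matrix_mult_def)
  have inj_re: "inj re" using re_un(2) by (rule inj_on_inverseI)
  have "range (\<lambda>e. e v* ?M) = re ` range (\<lambda>e. e v* M)" unfolding M' by auto
  also have "\<dots> = {c. c v* ?\<Theta> = 0}"
    unfolding ker using \<Theta>' re_un by (auto simp: image_iff) metis
  finally have ker': "range (\<lambda>e. e v* ?M) = {c. c v* ?\<Theta> = 0}" .
  have img': "range (\<lambda>c. c v* ?\<Theta>) = D"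
    unfolding img[symmetric] using \<Theta>' re_un by (auto simp: image_iff) metis+
  have "inj (\<lambda>e. e v* ?M)" unfolding M' using inj_compose[OF inj_re inj] by (simp add: comp_def)
  then show ?thesis
    unfolding minimal_free_resolution_def using M \<Theta> min ker' img' by (intro exI[of _ ?\<Theta>]) simp
qed

lemma free_basis:
  assumes "free_with_exponents A d"
  obtains T where "range (\<lambda>c. c v* T) = log_derivs A" "\<And>c. c v* T = 0 \<Longrightarrow> c = 0"
    "\<And>i. homogeneous_deriv (int (d $ i)) (T $ i)"
proof -
  obtain \<theta> where inj: "inj \<theta>" and ind: "\<not> vecmod.dependent (range \<theta>)"
    and span: "vecmod.span (range \<theta>) = log_derivs A" and hom: "\<And>i. homogeneous_deriv (int (d $ i)) (\<theta> i)"
    using assms unfolding free_with_exponents_def by blast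
  let ?T = "\<chi> i. \<theta> i"
  have fin: "finite (range \<theta>)" by simp
  have T: "c v* ?T = (\<Sum>v\<in>range \<theta>. c $ inv \<theta> v *s v)" for c
    unfolding vector_matrix_mult_rows using inj by (simp add: sum.reindex)
  show ?thesis
  proof (rule that)
    show "range (\<lambda>c. c v* ?T) = log_derivs A"
    proof (intro equalityI subsetI)
      fix y assume "y \<in> range (\<lambda>c. c v* ?T)"
      then show "y \<in> log_derivs A" unfolding T span[symmetric] vecmod.span_finite[OF fin] by auto
    next
      fix y assume "y \<in> log_derivs A"
      then obtain u where "y = (\<Sum>v\<in>range \<theta>. u v *s v)"
        unfolding span[symmetric] vecmod.span_finite[OF fin] by auto
      then have "y = (\<chi> i. u (\<theta> i)) v* ?T" unfolding T using inj by (simp add: sum.reindex)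
      then show "y \<in> range (\<lambda>c. c v* ?T)" by blast
    qed
    fix c assume c: "c v* ?T = 0"
    have "\<forall>u. \<not> ((\<exists>v\<in>range \<theta>. u v \<noteq> 0) \<and> (\<Sum>v\<in>range \<theta>. u v *s v) = 0)"
      using ind unfolding vecmod.dependent_finite[OF fin] not_ex .
    from spec[OF this, of "\<lambda>v. c $ inv \<theta> v"] have "\<forall>v\<in>range \<theta>. c $ inv \<theta> v = 0"
      using c unfolding T by blast
    then show "c = 0" using inj by (simp add: vec_eq_iff)
  qed (simp add: hom)
qed

section \<open>Deleting one hyperplane from a free arrangement\<close>

text \<open>
  A free arrangement with a homogeneous basis, the rows of \<open>T\<close>, of its module, a hyperplane \<open>H\<close> to be
  deleted, and another hyperplane \<open>H'\<close>.
\<close>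

locale free_deletion = marked_arrangement A H \<alpha>
  for A :: "('k::field ^ 3) set set" and H and \<alpha> :: "(3, 'k) mpoly" +
  fixes H' and \<beta> :: "(3, 'k) mpoly" and T :: "(3, 'k) mpoly ^ 3 ^ 3" and d :: "nat ^ 3"
  assumes H': "H' \<in> A" "H' \<noteq> H" and \<beta>: "\<beta> \<in> graded_part 1" "H' = zero_locus \<beta>"
    and T_range: "range (\<lambda>c. c v* T) = log_derivs A"
    and T_indep: "c v* T = 0 \<Longrightarrow> c = 0"
    and T_hom: "homogeneous_deriv (int (d $ i)) (T $ i)"
begin

lemma \<beta>_nonzero: "\<beta> \<noteq> 0"
  using arrangement_form_nonzero[OF arr H'(1) \<beta>(2)] .

lemma \<beta>_prime: "prime_elem \<beta>"
  using prime_linear_form[OF \<beta>(1) \<beta>_nonzero] .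

lemma not_dvd: "\<not> \<alpha> dvd \<beta>" "\<not> \<beta> dvd \<alpha>"
  using arrangement_forms_not_dvd[OF arr H H'(1) H'(2)[symmetric] \<alpha> \<beta>]
    arrangement_forms_not_dvd[OF arr H'(1) H H'(2) \<beta> \<alpha>] by auto

lemma T_log: "c v* T \<in> log_derivs A"
  using T_range by blast

lemma T_log_deletion: "c v* T \<in> log_derivs (A - {H})"
  using T_log by (rule deletion_superset)

lemma T_unique: "c v* T = c' v* T \<Longrightarrow> c = c'"
  using T_indep[of "c - c'"] by (simp add: vector_matrix_mult_diff)

lemma T_coords:
  assumes "x \<in> log_derivs A"
  obtains c where "x = c v* T"
  using assms T_range by blast

lemma T_coords_hom:
  assumes "x \<in> log_derivs A" "homogeneous_deriv k x"
  obtains c where "x = c v* T" "\<And>i. c $ i \<in> graded_part (k - int (d $ i))"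
  using homogeneous_coordinates[of "\<lambda>i. int (d $ i)" T x k] T_hom assms T_range by metis

lemma coords_graded:
  assumes "homogeneous_deriv k (c v* T)"
  shows "c $ i \<in> graded_part (k - int (d $ i))"
  using T_coords_hom[OF T_log assms] T_unique by metis

lemma smult_log_iff:
  assumes "x \<in> log_derivs (A - {H})" "x \<notin> log_derivs A"
  shows "s *s x \<in> log_derivs A \<longleftrightarrow> \<alpha> dvd s"
  using assms form_prime by (auto simp: log_derivs_iff log_derivs_scale apply_deriv_scale dest: prime_elem_dvd_multD)

text \<open>
  A generator of \<open>D(A - {H}) / D(A)\<close>, which in particular is not the zero module.
\<close>

definition generator :: "(3, 'k) deriv \<Rightarrow> bool" where
  "generator \<phi> \<longleftrightarrow> \<phi> \<in> log_derivs (A - {H}) \<and> \<phi> \<notin> log_derivs A \<and>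
    (\<forall>x\<in>log_derivs (A - {H}). \<exists>s c. x = s *s \<phi> + c v* T)"

lemma generatorD:
  assumes "generator \<phi>"
  shows "\<phi> \<in> log_derivs (A - {H})" "\<phi> \<notin> log_derivs A"
    "x \<in> log_derivs (A - {H}) \<Longrightarrow> \<exists>s c. x = s *s \<phi> + c v* T"
  using assms by (auto simp: generator_def)

text \<open>
  The map \<open>x \<mapsto> x(\<alpha>) mod \<alpha>\<close> has kernel \<open>D(A)\<close> on \<open>D(A - {H})\<close>, so that \<open>y(\<alpha>) x - x(\<alpha>) y\<close> lies in \<open>D(A)\<close>:
  modulo \<open>\<alpha>\<close> the coordinates of \<open>\<alpha> x\<close> and \<open>\<alpha> y\<close> are proportional.
\<close>

lemma minors_divisible:
  assumes x: "x \<in> log_derivs (A - {H})" "\<alpha> *s x = a v* T"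
    and y: "y \<in> log_derivs (A - {H})" "\<alpha> *s y = b v* T"
  shows "\<alpha> dvd a $ i * b $ j - a $ j * b $ i"
proof (cases "y \<in> log_derivs A")
  case True
  then obtain c where "y = c v* T" by (rule T_coords)
  then have "b v* T = (\<alpha> *s c) v* T" using y(2) by (simp add: vector_matrix_mult_scale)
  then have "b = \<alpha> *s c" by (rule T_unique)
  then have "a $ i * b $ j - a $ j * b $ i = \<alpha> * (a $ i * c $ j - a $ j * c $ i)"
    by (simp add: algebra_simps)
  then show ?thesis by simp
next
  case False
  define u v where "u = apply_deriv y \<alpha>" and "v = apply_deriv x \<alpha>"
  have "u *s x - v *s y \<in> log_derivs A"
    unfolding log_derivs_iff using x y
    by (simp add: log_derivs_diff log_derivs_scale apply_deriv_diff apply_deriv_scale u_def v_def mult.commute)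
  then obtain c where c: "u *s x - v *s y = c v* T" by (rule T_coords)
  have "(u *s a - v *s b) v* T = \<alpha> *s (u *s x - v *s y)"
    by (simp add: vector_matrix_mult_simps x(2)[symmetric] y(2)[symmetric] vec_eq_iff algebra_simps)
  also have "\<dots> = (\<alpha> *s c) v* T" by (simp add: c vector_matrix_mult_scale)
  finally have "u *s a - v *s b = \<alpha> *s c" by (rule T_unique)
  then have uv: "u * a $ k = v * b $ k + \<alpha> * c $ k" for k by (simp add: vec_eq_iff algebra_simps)
  have "u * (a $ i * b $ j - a $ j * b $ i) = (u * a $ i) * b $ j - (u * a $ j) * b $ i"
    by (simp add: algebra_simps)
  also have "\<dots> = \<alpha> * (c $ i * b $ j - c $ j * b $ i)" unfolding uv by (simp add: algebra_simps)
  finally have "\<alpha> dvd u * (a $ i * b $ j - a $ j * b $ i)" by simp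
  moreover have "\<not> \<alpha> dvd u" using False y(1) by (simp add: u_def log_derivs_iff)
  ultimately show ?thesis using form_prime prime_elem_dvd_multD by blast
qed

text \<open>
  If the coordinates of \<open>\<alpha> y\<close> vanish at \<open>w\<close>, they lie in \<open>(\<alpha>, \<beta>)\<close>; up to elements of \<open>D(A)\<close> they are then
  divisible by \<open>\<beta>\<close>, and so is \<open>y\<close>.  The quotient is again in \<open>D(A - {H})\<close>, because \<open>\<alpha>\<close> times it is a
  combination of the rows of \<open>T\<close>.
\<close>

lemma divide_by_form:
  assumes fr: "linear_frame \<alpha> \<beta> \<gamma> p q w"
    and y: "y \<in> log_derivs (A - {H})" "homogeneous_deriv m y" "\<alpha> *s y = b v* T"
    and vanish: "\<And>i. poly_eval (b $ i) w = 0"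
  obtains \<zeta> c where "\<zeta> \<in> log_derivs (A - {H})" "homogeneous_deriv (m - 1) \<zeta>" "y = \<beta> *s \<zeta> + c v* T"
proof -
  interpret linear_frame \<alpha> \<beta> \<gamma> p q w by fact
  have hom: "homogeneous_deriv (m + 1) (b v* T)"
    unfolding y(3)[symmetric] using homogeneous_scale[OF \<alpha>(1) y(2)] by (simp add: add.commute)
  have "\<exists>q r. b $ i = \<alpha> * q + \<beta> * r" for i
    using pair_ideal_graded_iff[OF coords_graded[OF hom]] vanish by (auto simp: pair_ideal_def)
  then obtain f r where fr: "\<And>i. b $ i = \<alpha> * f i + \<beta> * r i" by metis
  have b: "b = \<alpha> *s (\<chi> i. f i) + \<beta> *s (\<chi> i. r i)" using fr by (simp add: vec_eq_iff)
  have "\<alpha> *s (y - (\<chi> i. f i) v* T) = \<beta> *s ((\<chi> i. r i) v* T)"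
    unfolding vector_ssub_ldistrib y(3) b by (simp add: vector_matrix_mult_simps)
  then obtain z where z: "y - (\<chi> i. f i) v* T = \<beta> *s z" "(\<chi> i. r i) v* T = \<alpha> *s z"
    using prime_divides_vector[OF \<beta>_prime] not_dvd by metis
  have "z \<in> log_derivs (A - {H})" unfolding deletion_iff z(2)[symmetric] by (rule T_log)
  then have "deriv_comp (m - 1) z \<in> log_derivs (A - {H})" by (rule deriv_comp_log)
  moreover have "y = \<beta> *s deriv_comp (m - 1) z + (\<chi> i. hcomp (m - int (d $ i)) (f i)) v* T"
  proof -
    have "y = deriv_comp m (\<beta> *s z + (\<chi> i. f i) v* T)"
      using z(1) y(2) by (simp add: deriv_comp_of_homogeneous flip: z(1))
    also have "\<dots> = \<beta> *s deriv_comp (m - 1) z + (\<chi> i. hcomp (m - int (d $ i)) (f i)) v* T"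
      using deriv_comp_combination[OF T_hom, of m "\<chi> i. f i"]
      by (simp add: deriv_comp_add deriv_comp_scale[OF \<beta>(1)])
    finally show ?thesis .
  qed
  ultimately show ?thesis by (intro that) auto
qed

text \<open>
  Choose \<open>\<phi>\<close> of minimal degree outside \<open>D(A)\<close>, and let \<open>w\<close> span the line \<open>\<alpha> = \<beta> = 0\<close>.  By minimality
  the coordinates of \<open>\<alpha> \<phi>\<close> do not all vanish at \<open>w\<close>.  Those of \<open>\<alpha> x\<close>, for another homogeneous \<open>x\<close>, are
  proportional to them modulo \<open>\<alpha>\<close>; so subtracting a multiple of \<open>\<phi>\<close> from \<open>x\<close> makes them vanish at \<open>w\<close>.
  The difference is divisible by \<open>\<beta>\<close> modulo \<open>D(A)\<close>, and induction on the degree applies to the quotient.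
\<close>

lemma generator_exists:
  assumes "log_derivs (A - {H}) \<noteq> log_derivs A"
  obtains e \<phi> where "generator \<phi>" "homogeneous_deriv (int e) \<phi>"
proof -
  obtain x0 where x0: "x0 \<in> log_derivs (A - {H})" "x0 \<notin> log_derivs A"
    using assms deletion_superset by blast
  define P where "P = (\<lambda>e \<phi>. \<phi> \<in> log_derivs (A - {H}) \<and> \<phi> \<notin> log_derivs A \<and> homogeneous_deriv (int e) \<phi>)"
  have ex: "\<exists>e \<phi>. P e \<phi>"
  proof -
    obtain J where J: "finite J" "x0 = (\<Sum>j\<in>J. deriv_comp j x0)" by (rule sum_deriv_comp)
    then obtain j where j: "deriv_comp j x0 \<notin> log_derivs A"
      using x0(2) log_derivs_sum[of J "\<lambda>j. deriv_comp j x0" A] by metis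
    then have "deriv_comp j x0 \<noteq> 0" by auto
    then have "j \<ge> 0" using homogeneous_neg_eq_0[OF homogeneous_deriv_comp, of j x0] by force
    then have "P (nat j) (deriv_comp j x0)"
      using j deriv_comp_log[OF x0(1)] by (simp add: P_def)
    then show ?thesis by blast
  qed
  define e where "e = (LEAST e. \<exists>\<phi>. P e \<phi>)"
  have "\<exists>\<phi>. P e \<phi>" unfolding e_def using ex by (rule LeastI_ex)
  then obtain \<phi> where \<phi>: "\<phi> \<in> log_derivs (A - {H})" "\<phi> \<notin> log_derivs A" "homogeneous_deriv (int e) \<phi>"
    by (auto simp: P_def)
  have minimal: "x \<in> log_derivs A" if "x \<in> log_derivs (A - {H})" "homogeneous_deriv k x" "k < int e" for x k
  proof (rule ccontr)
    assume not: "x \<notin> log_derivs A"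
    then have "x \<noteq> 0" by auto
    then have "k \<ge> 0" using homogeneous_neg_eq_0[OF that(2)] by force
    then have "P (nat k) x" using that not by (simp add: P_def)
    then have "e \<le> nat k" unfolding e_def by (intro Least_le) blast
    then show False using that(3) \<open>k \<ge> 0\<close> by simp
  qed
  obtain \<gamma> p q w where fr: "linear_frame \<alpha> \<beta> \<gamma> p q w"
    using linear_frame_exists[OF \<alpha>(1) \<beta>(1) form_nonzero not_dvd(1)] by blast
  interpret linear_frame \<alpha> \<beta> \<gamma> p q w by fact
  have "\<alpha> *s \<phi> \<in> log_derivs A" using \<phi>(1) by (simp add: deletion_iff)
  then obtain a where a: "\<alpha> *s \<phi> = a v* T" by (rule T_coords)
  obtain j where j: "poly_eval (a $ j) w \<noteq> 0"
  proof (rule ccontr)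
    assume "\<not> thesis"
    then have "\<And>i. poly_eval (a $ i) w = 0" using that by blast
    then obtain \<zeta> c where \<zeta>: "\<zeta> \<in> log_derivs (A - {H})" "homogeneous_deriv (int e - 1) \<zeta>"
      and eq: "\<phi> = \<beta> *s \<zeta> + c v* T"
      by (rule divide_by_form[OF fr \<phi>(1) \<phi>(3) a])
    have "\<zeta> \<in> log_derivs A" using minimal[OF \<zeta>] by simp
    then have "\<phi> \<in> log_derivs A" unfolding eq by (intro log_derivs_add log_derivs_scale T_log)
    then show False using \<phi>(2) by simp
  qed
  have hom_case: "\<exists>s c. x = s *s \<phi> + c v* T"
    if "x \<in> log_derivs (A - {H})" "homogeneous_deriv (int k) x" for k x
    using that
  proof (induction k arbitrary: x rule: less_induct)
    case (less k)
    show ?case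
    proof (cases "x \<in> log_derivs A")
      case True
      then obtain c where "x = c v* T" by (rule T_coords)
      then show ?thesis by (intro exI[of _ 0] exI[of _ c]) simp
    next
      case False
      then have ke: "e \<le> k" using minimal[OF less.prems] by force
      have "\<alpha> *s x \<in> log_derivs A" using less.prems(1) by (simp add: deletion_iff)
      then obtain b where b: "\<alpha> *s x = b v* T" by (rule T_coords)
      define l where "l = poly_eval (b $ j) w / poly_eval (a $ j) w"
      define s where "s = cpoly l * \<gamma> ^ (k - e)"
      have eval: "poly_eval (b $ i) w = l * poly_eval (a $ i) w" for i
      proof -
        obtain r where "a $ j * b $ i - a $ i * b $ j = \<alpha> * r"
          using minors_divisible[OF \<phi>(1) a less.prems(1) b, of j i] by (auto simp: dvd_def)
        from arg_cong[OF this, of "\<lambda>p. poly_eval p w"]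
        show ?thesis using j w by (simp add: l_def field_simps)
      qed
      have "s \<in> graded_part (int (k - e))"
        unfolding s_def using graded_cmult[OF graded_power[OF graded(3)]] by simp
      then have "homogeneous_deriv (int (k - e) + int e) (s *s \<phi>)"
        by (rule homogeneous_scale) (rule \<phi>(3))
      then have hom: "homogeneous_deriv (int k) (x - s *s \<phi>)"
        using ke less.prems(2) by (intro homogeneous_diff) (simp_all add: of_nat_diff)
      have log: "x - s *s \<phi> \<in> log_derivs (A - {H})"
        using less.prems(1) \<phi>(1) by (intro log_derivs_diff log_derivs_scale)
      have eq: "\<alpha> *s (x - s *s \<phi>) = (b - s *s a) v* T"
        by (simp add: vector_matrix_mult_simps a[symmetric] b[symmetric] vec_eq_iff algebra_simps)
      have "poly_eval ((b - s *s a) $ i) w = 0" for i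
        by (simp add: eval s_def w)
      then obtain \<zeta> c where \<zeta>: "\<zeta> \<in> log_derivs (A - {H})" "homogeneous_deriv (int k - 1) \<zeta>"
        "x - s *s \<phi> = \<beta> *s \<zeta> + c v* T" by (rule divide_by_form[OF fr log hom eq])
      have "\<exists>s c. \<zeta> = s *s \<phi> + c v* T"
      proof (cases "k = 0")
        case True
        then have "\<zeta> = 0" using \<zeta>(2) homogeneous_neg_eq_0 by force
        then show ?thesis by (intro exI[of _ 0]) (simp add: vector_matrix_mult_zero)
      next
        case False
        then show ?thesis using less.IH[of "k - 1" \<zeta>] \<zeta> by (simp add: of_nat_diff)
      qed
      then obtain s' c' where "\<zeta> = s' *s \<phi> + c' v* T" by blast
      then have "x = (s + \<beta> * s') *s \<phi> + (\<beta> *s c' + c) v* T"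
        using \<zeta>(3) by (simp add: vector_matrix_mult_simps vec_eq_iff algebra_simps)
      then show ?thesis by blast
    qed
  qed
  have "\<exists>s c. x = s *s \<phi> + c v* T" if x: "x \<in> log_derivs (A - {H})" for x
  proof -
    have "\<exists>s c. deriv_comp j x = s *s \<phi> + c v* T" for j
    proof (cases "j < 0")
      case True
      then have "deriv_comp j x = 0" using homogeneous_neg_eq_0[OF homogeneous_deriv_comp] by blast
      then show ?thesis by (intro exI[of _ 0]) (simp add: vector_matrix_mult_zero)
    next
      case False
      then show ?thesis
        using hom_case[OF deriv_comp_log[OF x], of "nat j" j] by simp
    qed
    then obtain s c where sc: "\<And>j. deriv_comp j x = s j *s \<phi> + c j v* T" by metis
    obtain J where J: "finite J" "x = (\<Sum>j\<in>J. deriv_comp j x)" by (rule sum_deriv_comp)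
    note J(2)
    also have "(\<Sum>j\<in>J. deriv_comp j x) = (\<Sum>j\<in>J. s j) *s \<phi> + (\<Sum>j\<in>J. c j) v* T"
      unfolding sc sum_vector_matrix_mult sum.distrib by (simp add: vec_eq_iff sum_distrib_right)
    finally show ?thesis by blast
  qed
  then have "generator \<phi>" unfolding generator_def using \<phi> by blast
  then show ?thesis using \<phi>(3) by (rule that)
qed

end

section \<open>The relation of a deletion\<close>

lemma other_indices_3:
  fixes i :: 3
  obtains j k where "UNIV = {i, j, k}" "i \<noteq> j" "i \<noteq> k" "j \<noteq> k"
proof -
  have U: "UNIV = {1, 2, 3 :: 3}" "UNIV = {2, 1, 3 :: 3}" "UNIV = {3, 1, 2 :: 3}"
    unfolding UNIV_3 by blast+
  consider "i = 1" | "i = 2" | "i = 3" using exhaust_3 by blast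
  then show ?thesis
  proof cases
    case 1
    show ?thesis by (rule that[of 2 3]) (use U(1) in \<open>simp_all add: 1\<close>)
  next
    case 2
    show ?thesis by (rule that[of 1 3]) (use U(2) in \<open>simp_all add: 2\<close>)
  next
    case 3
    show ?thesis by (rule that[of 1 2]) (use U(3) in \<open>simp_all add: 3\<close>)
  qed
qed

context free_deletion begin

lemma generator_coords:
  assumes "generator \<phi>"
  obtains f where "\<alpha> *s \<phi> = f v* T"
  using generatorD(1)[OF assms] T_coords[of "\<alpha> *s \<phi>"] by (auto simp: deletion_iff)

lemma generator_syzygy:
  assumes "generator \<phi>" "s *s \<phi> + c v* T = 0"
  shows "\<alpha> dvd s"
proof -
  have "s *s \<phi> = (- c) v* T" using assms(2) by (simp add: vector_matrix_mult_uminus eq_neg_iff_add_eq_0)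
  then have "s *s \<phi> \<in> log_derivs A" using T_log by metis
  then show ?thesis using smult_log_iff generatorD(1,2)[OF assms(1)] by blast
qed

lemma deriv_comp_generator:
  assumes "homogeneous_deriv e \<phi>"
  shows "deriv_comp k (s *s \<phi>) = hcomp (k - e) s *s \<phi>"
proof -
  have "hcomp k (s * \<phi> $ i) = hcomp (k - e) s * \<phi> $ i" for i
    using hcomp_mult_graded[of "\<phi> $ i" e k s] assms by (simp add: homogeneous_deriv_def mult.commute)
  then show ?thesis by (simp add: deriv_comp_def vec_eq_iff)
qed

lemma generator_coords_hom:
  assumes \<phi>: "generator \<phi>" "homogeneous_deriv e \<phi>"
    and x: "x \<in> log_derivs (A - {H})" "homogeneous_deriv k x"
  obtains s c where "x = s *s \<phi> + c v* T" "s \<in> graded_part (k - e)"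
proof -
  obtain s c where sc: "x = s *s \<phi> + c v* T" using generatorD(3)[OF \<phi>(1) x(1)] by blast
  have "x = deriv_comp k x" using x(2) by (simp add: deriv_comp_of_homogeneous)
  also have "\<dots> = hcomp (k - e) s *s \<phi> + (\<chi> i. hcomp (k - int (d $ i)) (c $ i)) v* T"
    unfolding sc deriv_comp_add deriv_comp_generator[OF \<phi>(2)] deriv_comp_combination[OF T_hom] ..
  finally show ?thesis by (rule that) simp
qed

lemma generator_combination: "generator \<phi> \<Longrightarrow> y \<in> log_derivs (A - {H}) \<longleftrightarrow> (\<exists>s c. y = s *s \<phi> + c v* T)"
  using generatorD by (auto intro!: log_derivs_add log_derivs_scale T_log_deletion)

lemma not_SPOG_if_trivial: "SPOG (A - {H}) p c \<Longrightarrow> log_derivs (A - {H}) \<noteq> log_derivs A"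
proof
  assume "SPOG (A - {H}) p c" and eq: "log_derivs (A - {H}) = log_derivs A"
  then obtain b :: "int ^ 1" and a and M :: "(3, 'k) mpoly ^ 3 option ^ 1"
    where res: "minimal_free_resolution b a M (log_derivs A)"
    unfolding SPOG_def by auto
  have comb: "(\<Sum>i\<in>UNIV. c i *s T $ i) = (\<chi> i. c i) v* T" for c
    by (simp add: vector_matrix_mult_rows)
  show False
  proof (rule minimal_resolution_not_split[OF res, of UNIV "\<lambda>i. T $ i"])
    show "log_derivs A = {\<Sum>i\<in>UNIV. c i *s T $ i | c. True}"
    proof (intro equalityI subsetI)
      fix x assume "x \<in> log_derivs A"
      then obtain c where "x = c v* T" by (rule T_coords)
      then show "x \<in> {\<Sum>i\<in>UNIV. c i *s T $ i | c. True}"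
        by (intro CollectI exI[of _ "\<lambda>i. c $ i"]) (simp add: vector_matrix_mult_rows)
    next
      fix x assume "x \<in> {\<Sum>i\<in>UNIV. c i *s T $ i | c. True}"
      then show "x \<in> log_derivs A" unfolding comb using T_log by auto
    qed
    fix c assume "(\<Sum>i\<in>UNIV. c i *s T $ i) = 0"
    then have "(\<chi> i. c i) = 0" unfolding comb by (rule T_indep)
    then show "\<forall>j\<in>UNIV. c j = 0" by (simp add: vec_eq_iff)
  qed simp
qed

text \<open>
  If a coefficient \<open>f $ j\<close> were a unit, the relation \<open>\<alpha> \<phi> = f v* T\<close> would eliminate \<open>T $ j\<close>, and
  \<open>D(A - {H})\<close> would be free on \<open>\<phi>\<close> and the other two rows.
\<close>

lemma generator_min:
  fixes b :: "int ^ 'q::finite" and M :: "(3, 'k) mpoly ^ 'p::finite ^ 'q"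
  assumes res: "minimal_free_resolution b a M (log_derivs (A - {H}))"
    and \<phi>: "generator \<phi>" "homogeneous_deriv e \<phi>" "\<alpha> *s \<phi> = f v* T"
  shows "const_term (f $ j) = 0"
proof (rule ccontr)
  assume nz: "const_term (f $ j) \<noteq> 0"
  have "homogeneous_deriv (1 + e) (f v* T)"
    unfolding \<phi>(3)[symmetric] by (rule homogeneous_scale[OF \<alpha>(1) \<phi>(2)])
  then have fj: "f $ j \<in> graded_part (1 + e - int (d $ j))" by (rule coords_graded)
  then have "1 + e - int (d $ j) = 0" using nz const_term_graded by blast
  then have f: "f $ j = cpoly (const_term (f $ j))" using fj graded_0_const by simp
  define k where "k = inverse (const_term (f $ j))"
  have k: "cpoly k * f $ j = 1" using nz by (subst f) (simp add: k_def cpoly_inverse mult.commute)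
  define w where "w i = (if i = j then \<phi> else T $ i)" for i
  have comb: "(\<Sum>i\<in>UNIV. c i *s w i) = c j *s \<phi> + (\<chi> i. if i = j then 0 else c i) v* T" for c
  proof -
    have "(\<Sum>i\<in>UNIV. c i *s w i) = (\<Sum>i\<in>UNIV. (if i = j then c j *s \<phi> else 0) + (if i = j then 0 else c i) *s T $ i)"
      by (intro sum.cong) (auto simp: w_def)
    then show ?thesis by (simp add: sum.distrib vector_matrix_mult_rows)
  qed
  show False
  proof (rule minimal_resolution_not_split[OF res, of UNIV w])
    show "log_derivs (A - {H}) = {\<Sum>i\<in>UNIV. c i *s w i | c. True}"
    proof (intro equalityI subsetI)
      fix x assume "x \<in> log_derivs (A - {H})"
      then obtain s c where x: "x = s *s \<phi> + c v* T" using generatorD(3)[OF \<phi>(1)] by blast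
      \<comment> \<open>subtract the multiple of the relation that eliminates \<open>T $ j\<close>\<close>
      define t where "t = c $ j * cpoly k"
      define c' where "c' = c - t *s f"
      have "t * f $ j = c $ j" using k by (simp add: t_def mult.assoc)
      then have "c' $ j = 0" by (simp add: c'_def)
      then have c': "(\<chi> i. if i = j then 0 else c' $ i) = c'" by (auto simp: vec_eq_iff)
      have "x = (s + t * \<alpha>) *s \<phi> + c' v* T"
        by (simp add: x c'_def vector_matrix_mult_simps \<phi>(3)[symmetric] vec_eq_iff algebra_simps)
      also have "\<dots> = (\<Sum>i\<in>UNIV. (if i = j then s + t * \<alpha> else c' $ i) *s w i)"
        unfolding comb using c' by (simp cong: if_cong)
      finally show "x \<in> {\<Sum>i\<in>UNIV. c i *s w i | c. True}"
        by (intro CollectI exI[of _ "\<lambda>i. if i = j then s + t * \<alpha> else c' $ i"]) simp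
    next
      fix x assume "x \<in> {\<Sum>i\<in>UNIV. c i *s w i | c. True}"
      then show "x \<in> log_derivs (A - {H})"
        using generatorD(1)[OF \<phi>(1)] by (auto simp: comb intro!: log_derivs_add log_derivs_scale T_log_deletion)
    qed
    fix c assume "(\<Sum>i\<in>UNIV. c i *s w i) = 0"
    then have 0: "c j *s \<phi> + (\<chi> i. if i = j then 0 else c i) v* T = 0" unfolding comb .
    then obtain r where r: "c j = \<alpha> * r" using generator_syzygy[OF \<phi>(1)] by blast
    have "(r *s f + (\<chi> i. if i = j then 0 else c i)) v* T = 0"
      using 0 by (simp add: r vector_matrix_mult_simps \<phi>(3)[symmetric] vector_smult_assoc mult.commute)
    then have z: "r *s f + (\<chi> i. if i = j then 0 else c i) = 0" by (rule T_indep)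
    have "r * f $ j = 0" using arg_cong[OF z, of "\<lambda>v. v $ j"] by simp
    then have "r = 0" using nz by auto
    then have "c i = 0" for i
      using arg_cong[OF z, of "\<lambda>v. v $ i"] r by (cases "i = j") simp_all
    then show "\<forall>j\<in>UNIV. c j = 0" by simp
  qed simp
qed

lemma SPOG_min:
  assumes "SPOG (A - {H}) p c" "generator \<phi>" "homogeneous_deriv e \<phi>" "\<alpha> *s \<phi> = f v* T"
  shows "const_term (f $ i) = 0"
proof -
  obtain b :: "int ^ 1" and a and M :: "(3, 'k) mpoly ^ 3 option ^ 1"
    where "minimal_free_resolution b a M (log_derivs (A - {H}))"
    using assms(1) unfolding SPOG_def by blast
  then show ?thesis using generator_min assms(2-4) by blast
qed

text \<open>
  The level is determined by \<open>D(A - {H})\<close>, because \<open>\<phi>\<close> and the rows of \<open>T\<close> provide a second minimal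
  resolution.
\<close>

lemma generator_degree:
  assumes spog: "SPOG (A - {H}) p c"
    and \<phi>: "generator \<phi>" "homogeneous_deriv (int e) \<phi>"
  shows "e = c"
proof -
  obtain g and h :: "(3, 'k) mpoly ^ 3" where res: "minimal_free_resolution ((\<chi> j. int c + 1) :: int ^ 1)
      (\<chi> i. case i of None \<Rightarrow> int c | Some k \<Rightarrow> int (p $ k))
      (\<chi> j i. case i of None \<Rightarrow> g | Some k \<Rightarrow> h $ k) (log_derivs (A - {H}))"
    using spog unfolding SPOG_def by blast
  obtain f where f: "\<alpha> *s \<phi> = f v* T" using generator_coords[OF \<phi>(1)] .
  have hom: "homogeneous_deriv (1 + int e) (f v* T)"
    unfolding f[symmetric] by (rule homogeneous_scale[OF \<alpha>(1) \<phi>(2)])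
  have "minimal_free_resolution ((\<chi> j. 1 + int e) :: int ^ 1)
      (\<chi> i. case i of None \<Rightarrow> int e | Some k \<Rightarrow> int (d $ k))
      (\<chi> j i. case i of None \<Rightarrow> \<alpha> | Some k \<Rightarrow> (- f) $ k) (log_derivs (A - {H}))"
  proof (rule one_relation_resolution)
    show "\<alpha> *s \<phi> + (- f) v* T = 0" by (simp add: f vector_matrix_mult_uminus)
    show "const_term ((- f) $ i) = 0" for i using generator_min[OF res \<phi> f] by simp
    show "(- f) $ i \<in> graded_part (1 + int e - int (d $ i))" for i
      using coords_graded[OF hom] by (simp add: graded_uminus)
  qed (use T_indep T_hom \<phi>(2) generator_combination[OF \<phi>(1)] generator_syzygy[OF \<phi>(1)] form_nonzero \<alpha>(1)
      const_term_form in auto)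
  from one_relation_resolution_unique(1)[OF this res] show ?thesis by simp
qed

lemma SPOG_generator:
  assumes "SPOG (A - {H}) p c"
  obtains \<phi> where "generator \<phi>" "homogeneous_deriv (int c) \<phi>"
proof -
  obtain e \<phi> where \<phi>: "generator \<phi>" "homogeneous_deriv (int e) \<phi>"
    using generator_exists[OF not_SPOG_if_trivial[OF assms]] .
  then show ?thesis using generator_degree[OF assms \<phi>] that by simp
qed

text \<open>
  Suppose that \<open>f\<close> and \<open>\<epsilon>\<close> both vanish at \<open>i\<close>, and subtract from all derivations the multiple of the Euler
  derivation \<open>E\<close> that makes them vanish on \<open>\<beta>\<close>.  The two other rows \<open>T $ j\<close>, \<open>T $ k\<close>, whose span contains
  \<open>E\<close>, then become multiples of one derivation \<open>\<omega>\<close>, and the relation becomes \<open>\<alpha> \<psi> = u \<omega>\<close> with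
  \<open>\<psi> = \<phi> - h E\<close>.  Either \<open>\<alpha>\<close> divides \<open>u\<close>, and \<open>\<psi> \<in> D(A)\<close>; or \<open>\<omega> = \<alpha> \<omega>'\<close>, and \<open>\<psi> = u \<omega>'\<close> is a proper multiple in
  \<open>D(A - {H})\<close>, because \<open>u\<close> has no constant term.  Both contradict that \<open>\<phi>\<close> is a generator.
\<close>

lemma relation_coefficient_nonzero:
  assumes \<phi>: "generator \<phi>" "\<alpha> *s \<phi> = f v* T" and min: "\<And>i. const_term (f $ i) = 0"
    and euler: "euler_deriv = \<epsilon> v* T" and \<epsilon>: "\<epsilon> $ i = 0"
  shows "f $ i \<noteq> 0"
proof
  assume fi: "f $ i = 0"
  obtain j k where ijk: "UNIV = {i, j, k}" "i \<noteq> j" "i \<noteq> k" "j \<noteq> k"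
    by (rule other_indices_3)
  have sum3: "sum g UNIV = g i + g j + g k" for g :: "3 \<Rightarrow> (3, 'k) mpoly"
    unfolding ijk(1) using ijk(2-4) by (simp add: add.assoc)
  have "\<forall>m. \<exists>t. apply_deriv (T $ m) \<beta> = \<beta> * t"
    using log_derivsD[OF _ H'(1) \<beta>, of "T $ _"] T_log[of "axis _ 1"]
    by (simp add: vector_matrix_mult_axis dvd_def)
  then obtain t where t: "\<And>m. apply_deriv (T $ m) \<beta> = \<beta> * t m" by metis
  have "\<beta> dvd apply_deriv \<phi> \<beta>"
    using log_derivsD[OF generatorD(1)[OF \<phi>(1)] _ \<beta>] H' by simp
  then obtain h where h: "apply_deriv \<phi> \<beta> = \<beta> * h" by blast
  \<comment> \<open>make \<open>\<phi>\<close> vanish on \<open>\<beta>\<close> by subtracting a multiple of the Euler derivation\<close>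
  define \<psi> where "\<psi> = \<phi> - h *s euler_deriv"
  define f' where "f' = f - (\<alpha> * h) *s \<epsilon>"
  have \<psi>: "\<alpha> *s \<psi> = f' v* T"
    by (simp add: \<psi>_def f'_def \<phi>(2)[symmetric] euler[symmetric] vector_matrix_mult_simps
        vector_ssub_ldistrib vector_smult_assoc)
  have E1: "\<epsilon> $ j * t j + \<epsilon> $ k * t k = 1"
  proof -
    have "\<beta> * 1 = apply_deriv (\<epsilon> v* T) \<beta>" using apply_euler_deriv[OF \<beta>(1)] euler by simp
    also have "\<dots> = \<beta> * (\<epsilon> $ j * t j + \<epsilon> $ k * t k)"
      by (simp add: apply_deriv_combination sum3 t \<epsilon> algebra_simps)
    finally show ?thesis using \<beta>_nonzero by (metis mult_left_cancel)
  qed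
  have f'i: "f' $ i = 0" by (simp add: f'_def fi \<epsilon>)
  have F0: "f' $ j * t j + f' $ k * t k = 0"
  proof -
    have "apply_deriv \<psi> \<beta> = 0"
      by (simp add: \<psi>_def apply_deriv_simps h apply_euler_deriv[OF \<beta>(1)] mult.commute)
    then have "0 = apply_deriv (f' v* T) \<beta>" by (simp add: \<psi>[symmetric] apply_deriv_scale)
    also have "\<dots> = \<beta> * (f' $ j * t j + f' $ k * t k)"
      by (simp add: apply_deriv_combination sum3 t f'i algebra_simps)
    finally show ?thesis using \<beta>_nonzero by auto
  qed
  define u where "u = f $ j * \<epsilon> $ k - f $ k * \<epsilon> $ j"
  have u: "u = f' $ j * \<epsilon> $ k - f' $ k * \<epsilon> $ j" by (simp add: u_def f'_def algebra_simps)
  have fj: "f' $ j = u * t k"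
  proof -
    have "f' $ j = f' $ j * (\<epsilon> $ j * t j + \<epsilon> $ k * t k)" using E1 by simp
    also have "\<dots> = \<epsilon> $ j * (f' $ j * t j + f' $ k * t k) + u * t k" unfolding u by (simp add: algebra_simps)
    finally show ?thesis using F0 by simp
  qed
  have fk: "f' $ k = - u * t j"
  proof -
    have "f' $ k = f' $ k * (\<epsilon> $ j * t j + \<epsilon> $ k * t k)" using E1 by simp
    also have "\<dots> = \<epsilon> $ k * (f' $ j * t j + f' $ k * t k) - u * t j" unfolding u by (simp add: algebra_simps)
    finally show ?thesis using F0 by simp
  qed
  define \<omega> where "\<omega> = t k *s T $ j - t j *s T $ k"
  have "\<omega> = (t k *s axis j 1 - t j *s axis k 1) v* T"
    by (simp add: \<omega>_def vector_matrix_mult_simps vector_matrix_mult_axis)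
  then have \<omega>: "\<omega> \<in> log_derivs A" using T_log by metis
  have "(\<Sum>m\<in>UNIV. f' $ m *s T $ m) = f' $ i *s T $ i + f' $ j *s T $ j + f' $ k *s T $ k"
    unfolding ijk(1) using ijk(2-4) by (simp add: add.assoc)
  then have "\<alpha> *s \<psi> = u *s \<omega>"
    unfolding \<psi> vector_matrix_mult_rows
    by (simp add: f'i fj fk \<omega>_def vec_eq_iff algebra_simps)
  have \<psi>_not: "\<psi> \<notin> log_derivs A"
  proof
    assume "\<psi> \<in> log_derivs A"
    then have "\<psi> + h *s euler_deriv \<in> log_derivs A" by (intro log_derivs_add log_derivs_scale euler_deriv_log)
    then show False using generatorD(2)[OF \<phi>(1)] by (simp add: \<psi>_def)
  qed
  have "\<not> \<alpha> dvd u"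
  proof
    assume "\<alpha> dvd u"
    then obtain r where "u = \<alpha> * r" by blast
    then have "\<alpha> *s \<psi> = \<alpha> *s (r *s \<omega>)" using \<open>\<alpha> *s \<psi> = u *s \<omega>\<close> by (simp add: vector_smult_assoc)
    then have "\<psi> = r *s \<omega>" by (rule smult_cancel_left[OF form_nonzero])
    then show False using \<psi>_not \<omega> log_derivs_scale by metis
  qed
  then obtain \<omega>' where \<omega>': "\<omega> = \<alpha> *s \<omega>'" "\<psi> = u *s \<omega>'"
    using prime_divides_vector[OF form_prime _ \<open>\<alpha> *s \<psi> = u *s \<omega>\<close>[symmetric]] by metis
  have "\<omega>' \<in> log_derivs (A - {H})" using \<omega> by (simp add: deletion_iff \<omega>'(1))
  then obtain s c where sc: "\<omega>' = s *s \<phi> + c v* T" using generatorD(3)[OF \<phi>(1)] by blast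
  have "(1 - s * u) *s \<omega>' = (s * h) *s euler_deriv + c v* T"
  proof -
    have "\<phi> = u *s \<omega>' + h *s euler_deriv" using \<omega>'(2) by (simp add: \<psi>_def algebra_simps)
    then have "\<omega>' = s *s (u *s \<omega>' + h *s euler_deriv) + c v* T" using sc by metis
    then show ?thesis by (simp add: vec_eq_iff algebra_simps)
  qed
  then have "(1 - s * u) *s \<omega>' \<in> log_derivs A"
    by (auto intro!: log_derivs_add log_derivs_scale euler_deriv_log T_log)
  moreover have "\<omega>' \<notin> log_derivs A" using \<psi>_not \<omega>'(2) log_derivs_scale by metis
  ultimately have "\<alpha> dvd 1 - s * u" using smult_log_iff \<open>\<omega>' \<in> log_derivs (A - {H})\<close> by blast
  then obtain r where "1 - s * u = \<alpha> * r" by blast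
  from arg_cong[OF this, of const_term]
  have "const_term (1 :: (3, 'k) mpoly) - const_term (s * u) = const_term (\<alpha> * r)"
    by (simp only: const_term_diff)
  then show False by (simp add: u_def min const_term_form)
qed

text \<open>
  A derivation of degree \<open>0\<close> in \<open>D(A)\<close> kills \<open>\<alpha>\<close>.  If only such rows occurred in \<open>\<alpha> \<phi>\<close>, then \<open>\<phi>(\<alpha>) = 0\<close>.
\<close>

lemma relation_coefficient_degree_pos:
  assumes \<phi>: "generator \<phi>" "\<alpha> *s \<phi> = f v* T"
  obtains i where "f $ i \<noteq> 0" "d $ i \<ge> 1"
proof (rule ccontr)
  assume "\<not> thesis"
  then have *: "f $ i = 0 \<or> d $ i = 0" for i using that[of i] by (cases "d $ i") auto
  have "f $ i * apply_deriv (T $ i) \<alpha> = 0" for i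
  proof (cases "f $ i = 0")
    case False
    then have "d $ i = 0" using * by blast
    then have "apply_deriv (T $ i) \<alpha> \<in> graded_part 0"
      using apply_deriv_graded[OF \<alpha>(1) T_hom[of i]] by simp
    moreover obtain r where r: "apply_deriv (T $ i) \<alpha> = \<alpha> * r"
      using log_derivsD[OF T_log[of "axis i 1"] H \<alpha>] by (auto simp: vector_matrix_mult_axis)
    ultimately have "r \<in> graded_part (0 - 1)"
      using graded_mult_cancel[OF \<alpha>(1) form_nonzero, of r 0] by simp
    then have "r = 0" by (rule graded_neg_eq_0) simp
    then show ?thesis using r by simp
  qed simp
  then have "apply_deriv (\<alpha> *s \<phi>) \<alpha> = 0"
    unfolding \<phi>(2) apply_deriv_combination by (intro sum.neutral) blast
  then have "apply_deriv \<phi> \<alpha> = 0" using form_nonzero by (simp add: apply_deriv_scale)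
  then show False using generatorD(1,2)[OF \<phi>(1)] by (simp add: log_derivs_iff)
qed

text \<open>
  The coefficients \<open>f $ i\<close> have degree \<open>e + 1 - d $ i\<close> and no constant terms, so the nonzero ones give
  \<open>d $ i \<le> e\<close>.  The Euler derivation has degree \<open>1\<close> and hence does not involve rows with \<open>d $ i \<ge> 2\<close>; their
  coefficients are nonzero.  A row with \<open>d $ i \<le> 1\<close> is covered by comparison with a row of positive
  degree that does occur; if \<open>e \<le> 1\<close>, the latter has degree \<open>e\<close>.
\<close>

lemma generator_degree_bounds:
  assumes \<phi>: "generator \<phi>" "homogeneous_deriv (int e) \<phi>" "\<alpha> *s \<phi> = f v* T"
    and min: "\<And>i. const_term (f $ i) = 0"
  shows "d $ i \<le> e" and "d $ j = e \<Longrightarrow> \<exists>i. d $ i = e \<and> f $ i \<noteq> 0"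
proof -
  have "homogeneous_deriv (1 + int e) (f v* T)"
    unfolding \<phi>(3)[symmetric] by (rule homogeneous_scale[OF \<alpha>(1) \<phi>(2)])
  then have f: "f $ i \<in> graded_part (1 + int e - int (d $ i))" for i by (rule coords_graded)
  have le: "d $ i \<le> e" if "f $ i \<noteq> 0" for i
    using graded_nonzero_degree_pos[OF f that min] by simp
  obtain \<epsilon> where \<epsilon>: "euler_deriv = \<epsilon> v* T" "\<And>i. \<epsilon> $ i \<in> graded_part (1 - int (d $ i))"
    using T_coords_hom[OF euler_deriv_log homogeneous_euler_deriv] by blast
  have nz: "f $ i \<noteq> 0" if "d $ i \<ge> 2" for i
  proof (rule relation_coefficient_nonzero[OF \<phi>(1,3) min \<epsilon>(1)])
    show "\<epsilon> $ i = 0" using graded_neg_eq_0[OF \<epsilon>(2)[of i]] that by simp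
  qed
  obtain k where k: "f $ k \<noteq> 0" "d $ k \<ge> 1" using relation_coefficient_degree_pos[OF \<phi>(1,3)] by blast
  show "d $ i \<le> e" using le[OF nz] le[OF k(1)] k(2) by (cases "d $ i \<ge> 2") auto
  show "\<exists>i. d $ i = e \<and> f $ i \<noteq> 0" if "d $ j = e"
  proof (cases "e \<ge> 2")
    case True
    then show ?thesis using nz[of j] that by blast
  next
    case False
    then show ?thesis using le[OF k(1)] k by (intro exI[of _ k]) simp
  qed
qed

end

section \<open>Deleting two hyperplanes\<close>

lemma prime_not_dvd_prod:
  assumes "prime_elem p" "finite I" "\<And>i. i \<in> I \<Longrightarrow> \<not> p dvd f i"
  shows "\<not> p dvd prod f I"
  using assms(2,3)
proof (induction I rule: finite_induct)
  case empty
  then show ?case using assms(1) by (simp add: prime_elem_def)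
next
  case (insert i I)
  then show ?case using assms(1) by (auto dest: prime_elem_dvd_multD)
qed

lemma prod_of_primes_dvd:
  assumes "finite I" "\<And>i. i \<in> I \<Longrightarrow> prime_elem (f i) \<and> f i dvd z"
    "\<And>i j. i \<in> I \<Longrightarrow> j \<in> I \<Longrightarrow> i \<noteq> j \<Longrightarrow> \<not> f i dvd f j"
  shows "prod f I dvd z"
  using assms
proof (induction I rule: finite_induct)
  case (insert i I)
  then have "prod f I dvd z" by simp
  then obtain y where y: "z = prod f I * y" by blast
  have "f i dvd prod f I * y" using insert.prems(1)[of i] y by simp
  moreover have "\<not> f i dvd prod f I"
    using insert.hyps insert.prems by (intro prime_not_dvd_prod) auto
  ultimately have "f i dvd y" using insert.prems(1)[of i] prime_elem_dvd_multD by blast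
  then have "f i * prod f I dvd z" unfolding y by (simp add: mult.commute mult_dvd_mono)
  then show ?case using insert.hyps by simp
qed simp

text \<open>
  The axis \<open>H1 \<inter> H2\<close> is spanned by the vector \<open>w\<close> of the frame.
\<close>

locale two_deletions =
  D1: free_deletion A H1 \<alpha>1 H2 \<alpha>2 T d + D2: free_deletion A H2 \<alpha>2 H1 \<alpha>1 T d +
  fr: linear_frame \<alpha>1 \<alpha>2 \<gamma> p q w
  for A :: "('k::field ^ 3) set set" and H1 H2 and \<alpha>1 \<alpha>2 :: "(3, 'k) mpoly"
    and T :: "(3, 'k) mpoly ^ 3 ^ 3" and d :: "nat ^ 3" and \<gamma> p q w +
  fixes \<phi>1 \<phi>2 :: "(3, 'k) deriv" and c1 c2 :: nat
  assumes gen1: "D1.generator \<phi>1" "homogeneous_deriv (int c1) \<phi>1"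
    and gen2: "D2.generator \<phi>2" "homogeneous_deriv (int c2) \<phi>2"
begin

lemma swap: "two_deletions A H2 H1 \<alpha>2 \<alpha>1 T d \<gamma> q p w \<phi>2 \<phi>1 c2 c1"
  using D1.free_deletion_axioms D2.free_deletion_axioms fr.swap_first gen1 gen2
  by (intro two_deletions.intro two_deletions_axioms.intro)

abbreviation D12 :: "(3, 'k) deriv set" where
  "D12 \<equiv> log_derivs (A - {H1, H2})"

lemma D12_iff1: "x \<in> D12 \<longleftrightarrow> \<alpha>1 *s x \<in> log_derivs (A - {H2})"
proof -
  interpret marked_arrangement "A - {H2}" H1 \<alpha>1
    using D1.arr D1.H D1.H' D1.\<alpha> by unfold_locales (auto intro: arrangement_minus)
  have "A - {H1, H2} = A - {H2} - {H1}" by blast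
  then show ?thesis using deletion_iff by simp
qed

lemma D12_iff2: "x \<in> D12 \<longleftrightarrow> \<alpha>2 *s x \<in> log_derivs (A - {H1})"
proof -
  have "A - {H1, H2} = A - {H2, H1}" by blast
  then show ?thesis using two_deletions.D12_iff1[OF swap] by simp
qed

lemma D12_superset: "x \<in> log_derivs (A - {H1}) \<Longrightarrow> x \<in> D12" "x \<in> log_derivs (A - {H2}) \<Longrightarrow> x \<in> D12"
  using log_derivs_antimono[of "A - {H1, H2}" "A - {H1}"] log_derivs_antimono[of "A - {H1, H2}" "A - {H2}"]
  by auto

lemma form1_dvd: "x \<in> log_derivs (A - {H2}) \<Longrightarrow> \<alpha>1 dvd apply_deriv x \<alpha>1"
  using log_derivsD[of x "A - {H2}" H1 \<alpha>1] D1.H D1.H' D1.\<alpha> by auto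

text \<open>
  Membership in \<open>D(A - {H1}) + D(A - {H2})\<close>.
\<close>

definition decomposable :: "(3, 'k) deriv \<Rightarrow> bool" where
  "decomposable x \<longleftrightarrow> (\<exists>s t c. x = s *s \<phi>1 + t *s \<phi>2 + c v* T)"

lemma decomposable_swap: "two_deletions.decomposable T \<phi>2 \<phi>1 x \<longleftrightarrow> decomposable x"
proof -
  have "(x = s *s \<phi>2 + t *s \<phi>1 + c v* T) = (x = t *s \<phi>1 + s *s \<phi>2 + c v* T)" for s t c
    by (simp add: add.commute)
  then show ?thesis unfolding two_deletions.decomposable_def[OF swap] decomposable_def by blast
qed

lemma decomposableI: "x = s *s \<phi>1 + t *s \<phi>2 + c v* T \<Longrightarrow> decomposable x"
  by (auto simp: decomposable_def)

lemma decomposable_T [intro]: "decomposable (c v* T)"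
  by (rule decomposableI[of _ 0 0 c]) simp

lemma decomposable_gens [intro]: "decomposable (s *s \<phi>1)" "decomposable (s *s \<phi>2)"
  by (rule decomposableI[of _ s 0 0], simp add: vector_matrix_mult_zero)
    (rule decomposableI[of _ 0 s 0], simp add: vector_matrix_mult_zero)

lemma decomposable_add:
  assumes "decomposable x" "decomposable y"
  shows "decomposable (x + y)"
proof -
  obtain s t c s' t' c' where "x = s *s \<phi>1 + t *s \<phi>2 + c v* T" "y = s' *s \<phi>1 + t' *s \<phi>2 + c' v* T"
    using assms unfolding decomposable_def by blast
  then have "x + y = (s + s') *s \<phi>1 + (t + t') *s \<phi>2 + (c + c') v* T"
    by (simp add: vector_matrix_mult_simps vector_sadd_rdistrib)
  then show ?thesis by (rule decomposableI)
qed

lemma decomposable_scale: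
  assumes "decomposable x"
  shows "decomposable (r *s x)"
proof -
  obtain s t c where "x = s *s \<phi>1 + t *s \<phi>2 + c v* T"
    using assms unfolding decomposable_def by blast
  then have "r *s x = (r * s) *s \<phi>1 + (r * t) *s \<phi>2 + (r *s c) v* T"
    by (simp add: vector_matrix_mult_simps vector_add_ldistrib vector_smult_assoc)
  then show ?thesis by (rule decomposableI)
qed

lemma decomposable_deriv_comp:
  assumes "decomposable x"
  shows "decomposable (deriv_comp k x)"
proof -
  obtain s t c where "x = s *s \<phi>1 + t *s \<phi>2 + c v* T"
    using assms unfolding decomposable_def by blast
  then have "deriv_comp k x = hcomp (k - int c1) s *s \<phi>1 + hcomp (k - int c2) t *s \<phi>2
      + (\<chi> i. hcomp (k - int (d $ i)) (c $ i)) v* T"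
    by (simp only: deriv_comp_add D1.deriv_comp_generator[OF gen1(2)] D1.deriv_comp_generator[OF gen2(2)]
        deriv_comp_combination[OF D1.T_hom])
  then show ?thesis by (rule decomposableI)
qed

lemma decomposable_deletion1: "x \<in> log_derivs (A - {H1}) \<Longrightarrow> decomposable x"
  using D1.generatorD(3)[OF gen1(1)] decomposable_add by blast

text \<open>
  Write \<open>h = \<alpha>1 a + \<alpha>2 b\<close>.  Since \<open>\<alpha>2 \<phi>2 \<in> D(A)\<close>, also \<open>\<alpha>1 (x - a \<phi>2) \<in> D(A)\<close>, which means
  \<open>x - a \<phi>2 \<in> D(A - {H1})\<close>.
\<close>

lemma decomposable_if_coefficient:
  assumes x: "\<alpha>1 *s x = h *s \<phi>2 + f v* T" and h: "h \<in> pair_ideal \<alpha>1 \<alpha>2"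
  shows "decomposable x"
proof -
  obtain a b where ab: "h = \<alpha>1 * a + \<alpha>2 * b" using h by (auto simp: pair_ideal_def)
  have "\<alpha>1 *s (x - a *s \<phi>2) = b *s (\<alpha>2 *s \<phi>2) + f v* T"
    by (simp add: vector_ssub_ldistrib x ab vec_eq_iff algebra_simps)
  also have "\<dots> \<in> log_derivs A"
  proof -
    have "\<alpha>2 *s \<phi>2 \<in> log_derivs A" using D2.generatorD(1)[OF gen2(1)] D2.deletion_iff by blast
    then show ?thesis by (rule log_derivs_add[OF log_derivs_scale D1.T_log])
  qed
  finally have "x - a *s \<phi>2 \<in> log_derivs (A - {H1})" by (simp add: D1.deletion_iff)
  then have "decomposable ((x - a *s \<phi>2) + a *s \<phi>2)"
    by (rule decomposable_add[OF decomposable_deletion1 decomposable_gens(2)])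
  then show ?thesis by simp
qed

text \<open>
  \<open>S / (\<alpha>1, \<alpha>2)\<close> is the polynomial ring in \<open>\<gamma>\<close>; a homogeneous coefficient outside the ideal is
  congruent to a nonzero multiple of a power of \<open>\<gamma>\<close>.
\<close>

lemma homogeneous_leading_coefficient:
  assumes x: "x \<in> D12" "homogeneous_deriv (int n) x" "\<not> decomposable x"
  obtains h f l k where "\<alpha>1 *s x = h *s \<phi>2 + f v* T" "l \<noteq> 0" "int n + 1 = int c2 + int k"
    "h \<in> graded_part (int k)" "h - cpoly l * \<gamma> ^ k \<in> pair_ideal \<alpha>1 \<alpha>2"
proof -
  have "homogeneous_deriv (1 + int n) (\<alpha>1 *s x)" by (rule homogeneous_scale[OF D1.\<alpha>(1) x(2)])
  then obtain h f where hf: "\<alpha>1 *s x = h *s \<phi>2 + f v* T" "h \<in> graded_part (1 + int n - int c2)"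
    using D2.generator_coords_hom[OF gen2] x(1) D12_iff1 by metis
  have "h \<notin> pair_ideal \<alpha>1 \<alpha>2" using decomposable_if_coefficient[OF hf(1)] x(3) by blast
  then have l: "poly_eval h w \<noteq> 0" using fr.pair_ideal_graded_iff[OF hf(2)] by blast
  then have "1 + int n - int c2 \<ge> 0" using graded_neg_eq_0[OF hf(2)] by force
  then obtain k where k: "1 + int n - int c2 = int k" using nonneg_int_cases by blast
  let ?g = "cpoly (poly_eval h w) * \<gamma> ^ k"
  have "?g \<in> graded_part (int k)" using graded_cmult[OF graded_power[OF fr.graded(3)]] by simp
  then have "h - ?g \<in> graded_part (int k)" using hf(2) unfolding k by (intro graded_diff)
  then have "h - ?g \<in> pair_ideal \<alpha>1 \<alpha>2" by (simp add: fr.pair_ideal_graded_iff fr.w)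
  moreover have "int n + 1 = int c2 + int k" using k by simp
  moreover have "h \<in> graded_part (int k)" using hf(2) unfolding k .
  ultimately show ?thesis using that[OF hf(1) l] by blast
qed

text \<open>
  Here \<open>\<alpha>1 x \<equiv> h \<phi>2\<close> and \<open>\<alpha>2 x \<equiv> h' \<phi>1\<close> modulo \<open>D(A)\<close>, where modulo \<open>(\<alpha>1, \<alpha>2)\<close> and up to
  scalars \<open>h\<close> and \<open>h'\<close> are powers of \<open>\<gamma>\<close>.  If the exponent for \<open>h\<close> is positive, so is that for \<open>h'\<close>, since \<open>c1 \<le> c2\<close>.  Equating \<open>\<alpha>2 (\<alpha>1 x)\<close>
  with \<open>\<alpha>1 (\<alpha>2 x)\<close> modulo \<open>\<gamma>\<close> then shows that the coordinates of the remainder of \<open>\<alpha>1 x\<close> lie in \<open>(\<alpha>1, \<gamma>)\<close>.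
  Consequently \<open>x\<close> becomes divisible by \<open>\<gamma>\<close> after subtraction of a decomposable element.
\<close>

lemma descent_step:
  assumes le: "c1 \<le> c2" and x: "x \<in> D12" "homogeneous_deriv (int n) x" "\<not> decomposable x"
    and big: "int n + 1 > int c2"
  obtains z where "z \<in> D12" "homogeneous_deriv (int n - 1) z" "\<not> decomposable z"
proof -
  obtain h f l k where h: "\<alpha>1 *s x = h *s \<phi>2 + f v* T" "int n + 1 = int c2 + int k"
    "h - cpoly l * \<gamma> ^ k \<in> pair_ideal \<alpha>1 \<alpha>2"
    using homogeneous_leading_coefficient[OF x] by metis
  have "\<alpha>2 *s x \<in> log_derivs (A - {H1})" using x(1) D12_iff2 by blast
  interpret S: two_deletions A H2 H1 \<alpha>2 \<alpha>1 T d \<gamma> q p w \<phi>2 \<phi>1 c2 c1 by (rule swap)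
  have "A - {H2, H1} = A - {H1, H2}" by blast
  then obtain h' f' l' k' where h': "\<alpha>2 *s x = h' *s \<phi>1 + f' v* T" "int n + 1 = int c1 + int k'"
    "h' - cpoly l' * \<gamma> ^ k' \<in> pair_ideal \<alpha>2 \<alpha>1"
    using S.homogeneous_leading_coefficient[of x n] x decomposable_swap by metis
  have "k \<ge> 1" "k' \<ge> 1" using h(2) h'(2) big le by auto
  then obtain g g' where g: "cpoly l * \<gamma> ^ k = \<gamma> * g" "cpoly l' * \<gamma> ^ k' = \<gamma> * g'"
    by (metis Suc_le_D One_nat_def mult.left_commute power_Suc)
  obtain a b where ab: "h = \<gamma> * g + \<alpha>1 * a + \<alpha>2 * b"
    using h(3) unfolding g pair_ideal_def by (auto simp: algebra_simps)
  obtain a' b' where ab': "h' = \<gamma> * g' + \<alpha>2 * a' + \<alpha>1 * b'"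
    using h'(3) unfolding g pair_ideal_def by (auto simp: algebra_simps)
  obtain u where u: "\<alpha>1 *s \<phi>1 = u v* T" using D1.generator_coords[OF gen1(1)] .
  obtain v where v: "\<alpha>2 *s \<phi>2 = v v* T" using D2.generator_coords[OF gen2(1)] .
  \<comment> \<open>modulo \<open>D(A - {H1}) + D(A - {H2})\<close> the two coefficients become multiples of \<open>\<gamma>\<close>\<close>
  define y where "y = x - a *s \<phi>2 - a' *s \<phi>1"
  define m m' where "m = f + b *s v - a' *s u" and "m' = f' + b' *s u - a *s v"
  have y1: "\<alpha>1 *s y = (\<gamma> * g) *s \<phi>2 + m v* T"
  proof -
    have "\<alpha>1 *s y = \<alpha>1 *s x - (\<alpha>1 * a) *s \<phi>2 - a' *s (\<alpha>1 *s \<phi>1)"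
      by (simp add: y_def vec_eq_iff algebra_simps)
    also have "\<dots> = (\<gamma> * g) *s \<phi>2 + b *s (\<alpha>2 *s \<phi>2) + f v* T - a' *s (\<alpha>1 *s \<phi>1)"
      by (simp add: h(1) ab vec_eq_iff algebra_simps)
    also have "\<dots> = (\<gamma> * g) *s \<phi>2 + m v* T"
      unfolding u v by (simp add: m_def vector_matrix_mult_simps)
    finally show ?thesis .
  qed
  have y2: "\<alpha>2 *s y = (\<gamma> * g') *s \<phi>1 + m' v* T"
  proof -
    have "\<alpha>2 *s y = \<alpha>2 *s x - (\<alpha>2 * a') *s \<phi>1 - a *s (\<alpha>2 *s \<phi>2)"
      by (simp add: y_def vec_eq_iff algebra_simps)
    also have "\<dots> = (\<gamma> * g') *s \<phi>1 + b' *s (\<alpha>1 *s \<phi>1) + f' v* T - a *s (\<alpha>2 *s \<phi>2)"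
      by (simp add: h'(1) ab' vec_eq_iff algebra_simps)
    also have "\<dots> = (\<gamma> * g') *s \<phi>1 + m' v* T"
      unfolding u v by (simp add: m'_def vector_matrix_mult_simps)
    finally show ?thesis .
  qed
  have "((\<gamma> * g) *s v + \<alpha>2 *s m) v* T = \<alpha>2 *s (\<alpha>1 *s y)"
    by (simp add: y1 vector_matrix_mult_simps v[symmetric] vec_eq_iff algebra_simps)
  also have "\<dots> = \<alpha>1 *s (\<alpha>2 *s y)" by (simp add: vec_eq_iff algebra_simps)
  also have "\<dots> = ((\<gamma> * g') *s u + \<alpha>1 *s m') v* T"
    by (simp add: y2 vector_matrix_mult_simps u[symmetric] vec_eq_iff algebra_simps)
  finally have "(\<gamma> * g) *s v + \<alpha>2 *s m = (\<gamma> * g') *s u + \<alpha>1 *s m'" by (rule D1.T_unique)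
  then have coeffs: "\<gamma> * g * v $ i + \<alpha>2 * m $ i = \<gamma> * g' * u $ i + \<alpha>1 * m' $ i" for i
    by (simp add: vec_eq_iff)
  interpret R: linear_frame \<alpha>1 \<gamma> \<alpha>2 p w q by (rule fr.swap_last)
  have "m $ i \<in> pair_ideal \<alpha>1 \<gamma>" for i
  proof -
    have "\<alpha>2 * m $ i = \<alpha>1 * m' $ i + \<gamma> * (g' * u $ i - g * v $ i)"
      using coeffs[of i] by (simp add: algebra_simps)
    then have "\<alpha>2 * m $ i \<in> pair_ideal \<alpha>1 \<gamma>" by (rule pair_idealI)
    moreover have "\<alpha>2 \<notin> pair_ideal \<alpha>1 \<gamma>"
      using R.pair_ideal_graded_iff[OF R.graded(3)] R.w by simp
    ultimately show ?thesis using R.pair_ideal_prime by blast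
  qed
  then have "\<forall>i. \<exists>e r. m $ i = \<alpha>1 * e + \<gamma> * r" by (auto simp: pair_ideal_def)
  then obtain e r where er: "\<And>i. m $ i = \<alpha>1 * e i + \<gamma> * r i" by metis
  have m: "m = \<alpha>1 *s (\<chi> i. e i) + \<gamma> *s (\<chi> i. r i)" using er by (simp add: vec_eq_iff)
  have eq: "\<alpha>1 *s (y - (\<chi> i. e i) v* T) = \<gamma> *s (g *s \<phi>2 + (\<chi> i. r i) v* T)"
    unfolding vector_ssub_ldistrib y1 m
    by (simp add: vector_matrix_mult_simps vector_add_ldistrib vector_smult_assoc)
  have "prime_elem \<gamma>" "\<not> \<gamma> dvd \<alpha>1"
    using prime_linear_form fr.graded(3) fr.nonzero(3) fr.not_dvd(4) by blast+
  then obtain z where z: "y - (\<chi> i. e i) v* T = \<gamma> *s z" "g *s \<phi>2 + (\<chi> i. r i) v* T = \<alpha>1 *s z"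
    using prime_divides_vector[OF _ _ eq] by metis
  have "z \<in> D12"
    unfolding D12_iff1 z(2)[symmetric]
    by (intro log_derivs_add log_derivs_scale D2.T_log_deletion D2.generatorD(1)[OF gen2(1)])
  then have z': "deriv_comp (int n - 1) z \<in> D12" by (rule deriv_comp_log)
  define rest where "rest = a *s \<phi>2 + a' *s \<phi>1 + (\<chi> i. e i) v* T"
  have rest: "decomposable rest" unfolding rest_def by (intro decomposable_add) auto
  have x_eq: "x = \<gamma> *s z + rest"
    using z(1) by (simp add: y_def rest_def algebra_simps)
  have "x = deriv_comp (int n) x" using x(2) by (simp add: deriv_comp_of_homogeneous)
  also have "\<dots> = \<gamma> *s deriv_comp (int n - 1) z + deriv_comp (int n) rest"
    unfolding x_eq deriv_comp_add deriv_comp_scale[OF fr.graded(3)] ..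
  finally have "\<not> decomposable (deriv_comp (int n - 1) z)"
    using x(3) decomposable_add decomposable_scale decomposable_deriv_comp[OF rest] by metis
  then show ?thesis using that z' by simp
qed

text \<open>
  An indecomposable element of minimal degree admits no descent, so its coefficient \<open>h\<close> is a nonzero
  constant: modulo \<open>D(A)\<close> and up to a scalar, \<open>\<alpha>1 \<psi>\<close> is \<open>\<phi>2\<close>.
\<close>

lemma indecomposable_element:
  assumes le: "c1 \<le> c2" and x0: "x0 \<in> D12" "homogeneous_deriv (int n0) x0" "\<not> decomposable x0"
  obtains \<psi> where "\<psi> \<in> D12" "homogeneous_deriv (int c2 - 1) \<psi>" "D2.generator (\<alpha>1 *s \<psi>)"
proof -
  define P where "P = (\<lambda>n. \<exists>x. x \<in> D12 \<and> homogeneous_deriv (int n) x \<and> \<not> decomposable x)"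
  define n where "n = (LEAST n. P n)"
  have "P n0" unfolding P_def using x0 by blast
  then have "P n" unfolding n_def by (rule LeastI)
  then obtain x where x: "x \<in> D12" "homogeneous_deriv (int n) x" "\<not> decomposable x"
    unfolding P_def by blast
  obtain h f l k where h: "\<alpha>1 *s x = h *s \<phi>2 + f v* T" "l \<noteq> 0" "int n + 1 = int c2 + int k"
    "h \<in> graded_part (int k)" "h - cpoly l * \<gamma> ^ k \<in> pair_ideal \<alpha>1 \<alpha>2"
    using homogeneous_leading_coefficient[OF x] by metis
  have "k = 0"
  proof (rule ccontr)
    assume "k \<noteq> 0"
    then have "int n + 1 > int c2" using h(3) by simp
    then obtain z where z: "z \<in> D12" "homogeneous_deriv (int n - 1) z" "\<not> decomposable z"
      by (rule descent_step[OF le x])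
    have "z \<noteq> 0" using z(3) decomposable_T[of 0] by (auto simp: vector_matrix_mult_zero)
    then have "n \<ge> 1" using homogeneous_neg_eq_0[OF z(2)] by force
    then have "P (n - 1)" unfolding P_def using z by (auto simp: of_nat_diff)
    then have "n \<le> n - 1" unfolding n_def by (rule Least_le)
    then show False using \<open>n \<ge> 1\<close> by simp
  qed
  then have hc: "h = cpoly (const_term h)" using h(4) graded_0_const by simp
  have nz: "const_term h \<noteq> 0"
  proof
    assume "const_term h = 0"
    then have "h = 0" using hc by simp
    then have "decomposable x" using decomposable_if_coefficient[OF h(1)] by simp
    then show False using x(3) by blast
  qed
  define s :: "(3, 'k) mpoly" where "s = cpoly (inverse (const_term h))"
  have sh: "s * h = 1" using nz by (subst hc) (simp add: s_def cpoly_inverse mult.commute)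
  have "\<alpha>1 *s (s *s x) = s *s (\<alpha>1 *s x)" by (simp add: vec_eq_iff mult_ac)
  also have "\<dots> = \<phi>2 + (s *s f) v* T"
    by (simp add: h(1) vector_add_ldistrib vector_smult_assoc sh vector_matrix_mult_simps)
  finally have eq: "\<alpha>1 *s (s *s x) = \<phi>2 + (s *s f) v* T" .
  have "D2.generator (\<phi>2 + (s *s f) v* T)"
    unfolding D2.generator_def
  proof (intro conjI ballI)
    show "\<phi>2 + (s *s f) v* T \<in> log_derivs (A - {H2})"
      by (intro log_derivs_add D2.T_log_deletion D2.generatorD(1)[OF gen2(1)])
    show "\<phi>2 + (s *s f) v* T \<notin> log_derivs A"
      using log_derivs_diff[OF _ D1.T_log[of "s *s f"]] D2.generatorD(2)[OF gen2(1)] by force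
    fix y assume "y \<in> log_derivs (A - {H2})"
    then obtain t c where "y = t *s \<phi>2 + c v* T" using D2.generatorD(3)[OF gen2(1)] by blast
    then have "y = t *s (\<phi>2 + (s *s f) v* T) + (c - t *s (s *s f)) v* T"
      by (simp add: vector_matrix_mult_simps vector_add_ldistrib)
    then show "\<exists>t c. y = t *s (\<phi>2 + (s *s f) v* T) + c v* T" by blast
  qed
  then have "D2.generator (\<alpha>1 *s (s *s x))" by (simp only: eq)
  moreover have "homogeneous_deriv (int c2 - 1) (s *s x)"
  proof -
    have "int c2 - 1 = int n" using h(3) \<open>k = 0\<close> by simp
    then show ?thesis using homogeneous_scale[OF _ x(2), of s 0] by (simp add: s_def)
  qed
  moreover have "s *s x \<in> D12" using x(1) by (rule log_derivs_scale)
  ultimately show ?thesis using that by blast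
qed

end

section \<open>Generic and special intersections\<close>

context two_deletions begin

lemma forms_exist:
  obtains F where "\<And>H. H \<in> A \<Longrightarrow> F H \<in> graded_part 1 \<and> F H \<noteq> 0 \<and> H = zero_locus (F H)"
proof -
  have "\<forall>H\<in>A. \<exists>\<eta>. \<eta> \<in> graded_part 1 \<and> \<eta> \<noteq> 0 \<and> H = zero_locus \<eta>"
    using arrangement_formE[OF D1.arr] by metis
  then show ?thesis using that by (metis bchoice)
qed

lemma axis_in_inter: "w \<in> H1 \<inter> H2"
  unfolding D1.\<alpha>(2) D1.\<beta>(2) by (simp add: zero_locus_def fr.w)

lemma contains_axis_iff:
  assumes "\<eta> \<in> graded_part 1"
  shows "H1 \<inter> H2 \<subseteq> zero_locus \<eta> \<longleftrightarrow> poly_eval \<eta> w = 0"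
proof
  assume "H1 \<inter> H2 \<subseteq> zero_locus \<eta>"
  then show "poly_eval \<eta> w = 0" using axis_in_inter by (auto simp: zero_locus_def)
next
  assume 0: "poly_eval \<eta> w = 0"
  show "H1 \<inter> H2 \<subseteq> zero_locus \<eta>"
  proof
    fix v assume "v \<in> H1 \<inter> H2"
    then have v: "poly_eval \<alpha>1 v = 0" "poly_eval \<alpha>2 v = 0"
      unfolding D1.\<alpha>(2) D1.\<beta>(2) by (simp_all add: zero_locus_def)
    have "poly_eval \<eta> v = poly_eval (cpoly (poly_eval \<eta> p) * \<alpha>1 + cpoly (poly_eval \<eta> q) * \<alpha>2
        + cpoly (poly_eval \<eta> w) * \<gamma>) v"
      using fr.expand[OF assms] by simp
    also have "\<dots> = 0" by (simp add: v 0)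
    finally show "v \<in> zero_locus \<eta>" by (simp add: zero_locus_def)
  qed
qed

text \<open>
  Let \<open>Q\<close> be the product of the forms of the remaining hyperplanes and \<open>\<partial>\<close> the constant derivation with
  \<open>\<partial>(\<alpha>1) = 0\<close> and \<open>\<partial>(\<alpha>2) = 1\<close>.  Then \<open>Q \<partial> \<in> D(A - {H2})\<close>, hence \<open>Q \<equiv> s \<phi>2(\<alpha>2)\<close> modulo \<open>\<alpha>2\<close> for some \<open>s\<close>.
  Applying \<open>\<alpha>1 x = h \<phi>2 + ...\<close> to \<open>\<alpha>2\<close> gives \<open>Q h \<in> (\<alpha>1, \<alpha>2)\<close>.  No factor of \<open>Q\<close> vanishes at \<open>w\<close>, and the
  ideal is prime, so \<open>h\<close> lies in it.
\<close>

lemma decomposable_if_generic: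
  assumes generic: "\<And>H. H \<in> A - {H1, H2} \<Longrightarrow> \<not> H1 \<inter> H2 \<subseteq> H" and x: "x \<in> D12"
  shows "decomposable x"
proof -
  obtain F where F: "\<And>H. H \<in> A \<Longrightarrow> F H \<in> graded_part 1 \<and> F H \<noteq> 0 \<and> H = zero_locus (F H)"
    by (rule forms_exist) blast
  have fin: "finite (A - {H1, H2})" using D1.arr by (simp add: arrangement_def)
  define Q where "Q = (\<Prod>H\<in>A - {H1, H2}. F H)"
  define \<rho> where "\<rho> = Q *s const_deriv q"
  have "\<rho> \<in> log_derivs (A - {H2})"
  proof (rule log_derivsI[OF arrangement_minus[OF D1.arr]])
    fix H assume H: "H \<in> A - {H2}"
    show "\<exists>\<eta>\<in>graded_part 1. H = zero_locus \<eta> \<and> \<eta> dvd apply_deriv \<rho> \<eta>"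
    proof (cases "H = H1")
      case True
      then show ?thesis
        using D1.\<alpha> by (intro bexI[of _ \<alpha>1]) (simp_all add: \<rho>_def apply_deriv_scale apply_const_deriv fr.q)
    next
      case False
      then have "F H dvd Q" unfolding Q_def using H fin by (intro dvd_prodI) auto
      then show ?thesis using F[of H] H by (intro bexI[of _ "F H"]) (auto simp: \<rho>_def apply_deriv_scale)
    qed
  qed
  then obtain s c where s: "\<rho> = s *s \<phi>2 + c v* T" using D2.generatorD(3)[OF gen2(1)] by blast
  obtain h f where h: "\<alpha>1 *s x = h *s \<phi>2 + f v* T"
    using D2.generatorD(3)[OF gen2(1)] x D12_iff1 by metis
  have T2: "\<exists>r. apply_deriv (c v* T) \<alpha>2 = \<alpha>2 * r" for c
    using log_derivsD[OF D1.T_log D2.H D2.\<alpha>] by (auto simp: dvd_def)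
  obtain r where r: "apply_deriv (c v* T) \<alpha>2 = \<alpha>2 * r" using T2 by blast
  obtain r' where r': "apply_deriv (f v* T) \<alpha>2 = \<alpha>2 * r'" using T2 by blast
  have "Q = apply_deriv \<rho> \<alpha>2" by (simp add: \<rho>_def apply_deriv_scale apply_const_deriv D2.\<alpha> fr.q)
  then have Q: "Q = s * apply_deriv \<phi>2 \<alpha>2 + \<alpha>2 * r" unfolding s apply_deriv_add apply_deriv_scale r .
  have X: "\<alpha>1 * apply_deriv x \<alpha>2 = h * apply_deriv \<phi>2 \<alpha>2 + \<alpha>2 * r'"
    using arg_cong[OF h, of "\<lambda>x. apply_deriv x \<alpha>2"] unfolding apply_deriv_add apply_deriv_scale r' .
  have "Q * h = s * (h * apply_deriv \<phi>2 \<alpha>2) + \<alpha>2 * r * h" unfolding Q by (simp add: algebra_simps)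
  also have "h * apply_deriv \<phi>2 \<alpha>2 = \<alpha>1 * apply_deriv x \<alpha>2 - \<alpha>2 * r'" using X by simp
  finally have "Q * h = \<alpha>1 * (s * apply_deriv x \<alpha>2) + \<alpha>2 * (r * h - s * r')"
    by (simp add: algebra_simps)
  then have "Q * h \<in> pair_ideal \<alpha>1 \<alpha>2" by (rule pair_idealI)
  moreover have "Q \<notin> pair_ideal \<alpha>1 \<alpha>2"
  proof -
    have "poly_eval (F H) w \<noteq> 0" if "H \<in> A - {H1, H2}" for H
      using generic[OF that] contains_axis_iff[of "F H"] F[of H] that by auto
    then have "poly_eval Q w \<noteq> 0" using fin by (simp add: Q_def)
    moreover have "Q \<in> graded_part (int (card (A - {H1, H2})))"
      unfolding Q_def using fin F by (intro graded_prod) auto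
    ultimately show ?thesis using fr.pair_ideal_graded_iff by blast
  qed
  ultimately have "h \<in> pair_ideal \<alpha>1 \<alpha>2" using fr.pair_ideal_prime by blast
  then show ?thesis by (rule decomposable_if_coefficient[OF h])
qed

text \<open>
  Let \<open>L\<close> be the set of the remaining hyperplanes through the axis, \<open>R\<close> the product of the forms of the
  hyperplanes that do not contain it, and \<open>\<partial>\<close> a constant derivation with \<open>\<partial>(\<alpha>1) = 1\<close> that kills the form
  \<open>\<alpha>3\<close> of \<open>H3\<close>.  The witness is \<open>\<eta> = R P \<partial>\<close>, where \<open>P\<close> is the product over \<open>L - {H3}\<close>.

  An element of \<open>D(A - {H2})\<close> maps \<open>\<alpha>1\<close> into \<open>(\<alpha>1)\<close>.  An element of \<open>D(A - {H1})\<close> becomes one that kills \<open>\<alpha>2\<close>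
  after subtraction of a multiple of the Euler derivation; its value on \<open>\<alpha>1\<close> is then divisible by the
  forms of all members of \<open>L\<close>.  So a decomposable \<open>\<eta>\<close> would satisfy \<open>R P \<in> (\<alpha>1, P \<alpha>3)\<close>; cancelling \<open>P\<close>
  and evaluating at \<open>w\<close> gives \<open>R(w) = 0\<close>, although no factor of \<open>R\<close> vanishes there.
\<close>

lemma indecomposable_if_special:
  assumes H3: "H3 \<in> A - {H1, H2}" "H1 \<inter> H2 \<subseteq> H3"
  obtains x n where "x \<in> D12" "homogeneous_deriv (int n) x" "\<not> decomposable x"
proof -
  obtain F where F: "\<And>H. H \<in> A \<Longrightarrow> F H \<in> graded_part 1 \<and> F H \<noteq> 0 \<and> H = zero_locus (F H)"
    by (rule forms_exist) blast
  have finA: "finite A" using D1.arr by (simp add: arrangement_def)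
  define L where "L = {H \<in> A - {H1, H2}. H1 \<inter> H2 \<subseteq> H}"
  define U where "U = {H \<in> A. \<not> H1 \<inter> H2 \<subseteq> H}"
  have fin: "finite L" "finite U" unfolding L_def U_def using finA by auto
  have LA: "L \<subseteq> A" "U \<subseteq> A" "H3 \<in> L" using H3 by (auto simp: L_def U_def)
  define R P where "R = prod F U" and "P = prod F (L - {H3})"
  \<comment> \<open>the forms of the members of \<open>L\<close> are combinations \<open>a \<alpha>1 + b \<alpha>2\<close> with nonzero coefficients\<close>
  have F_exp: "F H = cpoly (poly_eval (F H) p) * \<alpha>1 + cpoly (poly_eval (F H) q) * \<alpha>2"
    if "H \<in> L" for H
  proof -
    have "poly_eval (F H) w = 0" using contains_axis_iff[of "F H"] F[of H] that by (auto simp: L_def)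
    then show ?thesis using fr.expand[of "F H"] F[of H] that LA(1) by auto
  qed
  have F_not_dvd: "\<not> F H dvd F H'" if "H \<in> A" "H' \<in> A" "H \<noteq> H'" for H H'
    using arrangement_forms_not_dvd[OF D1.arr that] F that by blast
  have form1: "\<not> \<alpha>1 dvd F H" "\<not> F H dvd \<alpha>1" if "H \<in> A" "H \<noteq> H1" for H
    using arrangement_forms_not_dvd[OF D1.arr D1.H that(1) that(2)[symmetric] D1.\<alpha>]
      arrangement_forms_not_dvd[OF D1.arr that(1) D1.H that(2) _ _ D1.\<alpha>] F[OF that(1)] by blast+
  have form2: "\<not> \<alpha>2 dvd F H" if "H \<in> A" "H \<noteq> H2" for H
    using arrangement_forms_not_dvd[OF D1.arr D2.H that(1) that(2)[symmetric] D2.\<alpha>] F[OF that(1)] by blast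
  have ap: "poly_eval (F H) p \<noteq> 0" if "H \<in> L" for H
  proof
    assume 0: "poly_eval (F H) p = 0"
    have "\<alpha>2 dvd F H" by (subst F_exp[OF that]) (simp add: 0)
    moreover have "H \<in> A" "H \<noteq> H2" using that unfolding L_def by blast+
    ultimately show False using form2 by blast
  qed
  have aq: "poly_eval (F H) q \<noteq> 0" if "H \<in> L" for H
  proof
    assume 0: "poly_eval (F H) q = 0"
    have "\<alpha>1 dvd F H" by (subst F_exp[OF that]) (simp add: 0)
    moreover have "H \<in> A" "H \<noteq> H1" using that unfolding L_def by blast+
    ultimately show False using form1(1) by blast
  qed
  define v where "v = p - (poly_eval (F H3) p / poly_eval (F H3) q) *s q"
  have eval_v: "poly_eval \<eta> v = poly_eval \<eta> p - poly_eval (F H3) p / poly_eval (F H3) q * poly_eval \<eta> q"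
    if gr: "\<eta> \<in> graded_part 1" for \<eta>
  proof -
    obtain a where a: "\<eta> = linear_form a" by (rule graded_1_linear_form[OF gr])
    show ?thesis
      unfolding a poly_eval_linear_form by (simp add: v_def dot_def algebra_simps sum_subtractf sum_distrib_left)
  qed
  have v1: "poly_eval \<alpha>1 v = 1" using eval_v[OF D1.\<alpha>(1)] by (simp add: fr.p fr.q)
  have v3: "poly_eval (F H3) v = 0" using eval_v[of "F H3"] F[of H3] aq[OF LA(3)] H3 by simp
  define \<eta> where "\<eta> = (R * P) *s const_deriv v"
  have "\<eta> \<in> D12"
  proof (rule log_derivsI[OF arrangement_minus[OF D1.arr]])
    fix H assume H: "H \<in> A - {H1, H2}"
    then have FH: "F H \<in> graded_part 1" "H = zero_locus (F H)" using F[of H] by auto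
    have "F H dvd apply_deriv \<eta> (F H)"
    proof (cases "H = H3")
      case True
      then show ?thesis using FH v3 by (simp add: \<eta>_def apply_deriv_scale apply_const_deriv)
    next
      case False
      then have "H \<in> U \<or> H \<in> L - {H3}" using H by (auto simp: U_def L_def)
      then have "F H dvd R * P"
        using fin by (auto simp: R_def P_def intro: dvd_mult dvd_mult2 dvd_prodI)
      then show ?thesis by (simp add: \<eta>_def apply_deriv_scale)
    qed
    then show "\<exists>\<eta>'\<in>graded_part 1. H = zero_locus \<eta>' \<and> \<eta>' dvd apply_deriv \<eta> \<eta>'" using FH by blast
  qed
  moreover have "homogeneous_deriv (int (card U + card (L - {H3}))) \<eta>"
  proof -
    have gr: "F H \<in> graded_part 1" if "H \<in> U \<or> H \<in> L" for H using F LA that by blast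
    have "R \<in> graded_part (int (card U))" "P \<in> graded_part (int (card (L - {H3})))"
      unfolding R_def P_def using fin gr by (intro graded_prod; blast)+
    then have "R * P \<in> graded_part (int (card U) + int (card (L - {H3})))" by (rule graded_mult)
    from homogeneous_scale[OF this homogeneous_const_deriv] show ?thesis by (simp add: \<eta>_def)
  qed
  moreover have "\<not> decomposable \<eta>"
  proof
    assume "decomposable \<eta>"
    then obtain s t c where stc: "\<eta> = s *s \<phi>1 + t *s \<phi>2 + c v* T" by (auto simp: decomposable_def)
    define y where "y = t *s \<phi>2 + c v* T"
    have "y \<in> log_derivs (A - {H2})"
      unfolding y_def by (intro log_derivs_add log_derivs_scale D2.T_log_deletion D2.generatorD(1)[OF gen2(1)])
    then obtain r where r: "apply_deriv y \<alpha>1 = \<alpha>1 * r" using form1_dvd by (auto simp: dvd_def)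
    have z: "s *s \<phi>1 \<in> log_derivs (A - {H1})"
      by (intro log_derivs_scale D1.generatorD(1)[OF gen1(1)])
    then have "\<alpha>2 dvd apply_deriv (s *s \<phi>1) \<alpha>2"
      using log_derivsD[of _ "A - {H1}" H2 \<alpha>2] D1.H' D1.\<beta> by auto
    then obtain r' where r': "apply_deriv (s *s \<phi>1) \<alpha>2 = \<alpha>2 * r'" by blast
    \<comment> \<open>\<open>s \<phi>1 - r' E\<close> kills \<open>\<alpha>2\<close>, so the forms of all members of \<open>L\<close> divide its value on \<open>\<alpha>1\<close>\<close>
    define g where "g = apply_deriv (s *s \<phi>1) \<alpha>1 - r' * \<alpha>1"
    have g_dvd: "F H dvd g" if "H \<in> L" for H
    proof -
      let ?a = "poly_eval (F H) p" and ?b = "poly_eval (F H) q"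
      have HA: "H \<in> A - {H1}" "H \<in> A" using that by (auto simp: L_def)
      have "F H dvd apply_deriv (s *s \<phi>1) (F H)"
        using log_derivsD[OF z HA(1)] F[OF HA(2)] by blast
      also have "apply_deriv (s *s \<phi>1) (F H) = cpoly ?a * apply_deriv (s *s \<phi>1) \<alpha>1 + cpoly ?b * (\<alpha>2 * r')"
        using apply_deriv_form_combination[OF D1.\<alpha>(1) D2.\<alpha>(1), of "s *s \<phi>1" ?a ?b]
        unfolding F_exp[OF that, symmetric] r' .
      also have "\<dots> = cpoly ?a * g + (cpoly ?a * \<alpha>1 + cpoly ?b * \<alpha>2) * r'"
        by (simp add: g_def algebra_simps)
      also have "cpoly ?a * \<alpha>1 + cpoly ?b * \<alpha>2 = F H" by (rule F_exp[OF that, symmetric])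
      finally have "F H dvd cpoly ?a * g" by (simp add: dvd_add_left_iff)
      then have "F H dvd cpoly (inverse ?a) * (cpoly ?a * g)" by (rule dvd_mult)
      moreover have "cpoly (inverse ?a) * (cpoly ?a * g) = g"
      proof -
        have "cpoly (inverse ?a) * (cpoly ?a * g) = (cpoly ?a * cpoly (inverse ?a)) * g" by (simp only: mult_ac)
        then show ?thesis by (simp only: cpoly_inverse[OF ap[OF that]] mult_1_left)
      qed
      ultimately show ?thesis by simp
    qed
    have "prod F L dvd g"
    proof (rule prod_of_primes_dvd[OF fin(1)])
      fix H assume "H \<in> L"
      then show "prime_elem (F H) \<and> F H dvd g" using g_dvd F LA prime_linear_form by blast
    next
      fix H H' assume "H \<in> L" "H' \<in> L" "H \<noteq> H'"
      then show "\<not> F H dvd F H'" using F_not_dvd LA by blast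
    qed
    then obtain m where m: "g = prod F L * m" by blast
    have prodL: "prod F L = F H3 * P" unfolding P_def using fin LA by (simp add: prod.remove)
    have "R * P = apply_deriv \<eta> \<alpha>1" by (simp add: \<eta>_def apply_deriv_scale apply_const_deriv D1.\<alpha> v1)
    also have "\<dots> = apply_deriv (s *s \<phi>1) \<alpha>1 + apply_deriv y \<alpha>1"
      unfolding stc y_def by (simp add: apply_deriv_add)
    also have "\<dots> = g + \<alpha>1 * (r + r')" unfolding r by (simp add: g_def algebra_simps)
    finally have "P * (R - F H3 * m) = \<alpha>1 * (r + r')" unfolding m prodL by (simp add: algebra_simps)
    then have "\<alpha>1 dvd P * (R - F H3 * m)" by simp
    moreover have "\<not> \<alpha>1 dvd P"
      unfolding P_def using fin LA form1 by (intro prime_not_dvd_prod D1.form_prime) (auto simp: L_def)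
    ultimately have "\<alpha>1 dvd R - F H3 * m" using D1.form_prime prime_elem_dvd_multD by blast
    then obtain e where "R - F H3 * m = \<alpha>1 * e" by blast
    from arg_cong[OF this, of "\<lambda>f. poly_eval f w"]
    have "poly_eval R w = poly_eval (F H3) w * poly_eval m w" by (simp add: fr.w)
    moreover have "poly_eval (F H3) w = 0" using contains_axis_iff[of "F H3"] F[of H3] H3 by auto
    moreover have "poly_eval R w \<noteq> 0"
    proof -
      have "poly_eval (F H) w \<noteq> 0" if "H \<in> U" for H
        using contains_axis_iff[of "F H"] F[of H] that by (auto simp: U_def)
      then show ?thesis using fin by (simp add: R_def)
    qed
    ultimately show False by simp
  qed
  ultimately show ?thesis by (rule that)
qed

end

section \<open>Resolutions with explicitly listed generators\<close>

lemma exhaust_5: "(x :: 5) = 1 \<or> x = 2 \<or> x = 3 \<or> x = 4 \<or> x = 5"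
proof (induct x)
  case (of_int z)
  then have "z = 0 \<or> z = 1 \<or> z = 2 \<or> z = 3 \<or> z = 4" by auto
  then show ?case by auto
qed

lemma forall_5: "(\<forall>i::5. P i) \<longleftrightarrow> P 1 \<and> P 2 \<and> P 3 \<and> P 4 \<and> P 5"
  by (metis exhaust_5)

lemma UNIV_5: "UNIV = {1, 2, 3, 4, 5 :: 5}"
  using exhaust_5 by auto

lemma sum_5: "sum f (UNIV :: 5 set) = f 1 + f 2 + f 3 + f 4 + f 5"
  unfolding UNIV_5 by (simp add: ac_simps)

lemma vector_4 [simp]:
  "(vector [a, b, c, e] :: 'a::zero ^ 4) $ 1 = a" "(vector [a, b, c, e] :: 'a ^ 4) $ 2 = b"
  "(vector [a, b, c, e] :: 'a ^ 4) $ 3 = c" "(vector [a, b, c, e] :: 'a ^ 4) $ 4 = e"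
  unfolding vector_def by simp_all

lemma vector_5 [simp]:
  "(vector [a, b, c, e, f] :: 'a::zero ^ 5) $ 1 = a" "(vector [a, b, c, e, f] :: 'a ^ 5) $ 2 = b"
  "(vector [a, b, c, e, f] :: 'a ^ 5) $ 3 = c" "(vector [a, b, c, e, f] :: 'a ^ 5) $ 4 = e"
  "(vector [a, b, c, e, f] :: 'a ^ 5) $ 5 = f"
  unfolding vector_def by simp_all

text \<open>
  As in the case of one relation, the coefficients of \<open>x\<close> and \<open>y\<close> determine a syzygy.  The triangular
  shape of the relations makes the first map injective.
\<close>

lemma two_relations_resolution:
  fixes T :: "(3, 'k::field) mpoly ^ 3 ^ 3" and x y :: "(3, 'k) deriv"
  assumes indep: "\<And>c. c v* T = 0 \<Longrightarrow> c = 0"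
    and hom: "\<And>i. homogeneous_deriv (d i) (T $ i)" "homogeneous_deriv e1 x" "homogeneous_deriv e2 y"
    and D: "\<And>z. z \<in> D \<longleftrightarrow> (\<exists>s t c. z = s *s x + t *s y + c v* T)"
    and rel: "\<alpha>1 *s x + f v* T = 0" "g *s x + \<alpha>2 *s y + h v* T = 0"
    and syz: "\<And>s t c. s *s x + t *s y + c v* T = 0 \<Longrightarrow> \<exists>r u. s = r * \<alpha>1 + u * g \<and> t = u * \<alpha>2"
    and nz: "\<alpha>1 \<noteq> 0" "\<alpha>2 \<noteq> 0"
    and deg: "\<alpha>1 \<in> graded_part (b1 - e1)" "\<And>i. f $ i \<in> graded_part (b1 - d i)"
      "g \<in> graded_part (b2 - e1)" "\<alpha>2 \<in> graded_part (b2 - e2)" "\<And>i. h $ i \<in> graded_part (b2 - d i)"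
    and min: "const_term \<alpha>1 = 0" "\<And>i. const_term (f $ i) = 0"
      "const_term g = 0" "const_term \<alpha>2 = 0" "\<And>i. const_term (h $ i) = 0"
  shows "minimal_free_resolution (vector [b1, b2] :: int ^ 2)
      (vector [e1, e2, d 1, d 2, d 3] :: int ^ 5)
      (vector [vector [\<alpha>1, 0, f $ 1, f $ 2, f $ 3], vector [g, \<alpha>2, h $ 1, h $ 2, h $ 3]]) D"
proof -
  let ?\<Theta> = "vector [x, y, T $ 1, T $ 2, T $ 3] :: (3, 'k) mpoly ^ 3 ^ 5"
  let ?M = "vector [vector [\<alpha>1, 0, f $ 1, f $ 2, f $ 3], vector [g, \<alpha>2, h $ 1, h $ 2, h $ 3]] :: (3, 'k) mpoly ^ 5 ^ 2"
  define tail :: "(3, 'k) mpoly ^ 5 \<Rightarrow> (3, 'k) mpoly ^ 3" where "tail c = vector [c $ 3, c $ 4, c $ 5]" for c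
  have tail: "tail c $ 1 = c $ 3" "tail c $ 2 = c $ 4" "tail c $ 3 = c $ 5" for c
    by (simp_all add: tail_def)
  have \<Theta>: "c v* ?\<Theta> = c $ 1 *s x + c $ 2 *s y + tail c v* T" for c
    unfolding vector_matrix_mult_rows sum_5 sum_3 tail by (simp add: add.assoc)
  have M: "e v* ?M = e $ 1 *s ?M $ 1 + e $ 2 *s ?M $ 2" for e
    unfolding vector_matrix_mult_rows sum_2 ..
  have M1: "(e v* ?M) $ 1 = e $ 1 * \<alpha>1 + e $ 2 * g" for e unfolding M by simp
  have M2: "(e v* ?M) $ 2 = e $ 2 * \<alpha>2" for e unfolding M by simp
  have Mt: "tail (e v* ?M) = e $ 1 *s f + e $ 2 *s h" for e
    unfolding vec_eq_iff forall_3 tail M by simp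
  have inj: "inj (\<lambda>e. e v* ?M)"
  proof (rule injI)
    fix u v assume eq: "u v* ?M = v v* ?M"
    have "u $ 2 * \<alpha>2 = v $ 2 * \<alpha>2" using arg_cong[OF eq, of "\<lambda>v. v $ 2"] unfolding M2 .
    then have 2: "u $ 2 = v $ 2" using nz by simp
    have "u $ 1 * \<alpha>1 + u $ 2 * g = v $ 1 * \<alpha>1 + v $ 2 * g"
      using arg_cong[OF eq, of "\<lambda>v. v $ 1"] unfolding M1 .
    then have "u $ 1 = v $ 1" using nz 2 by simp
    then show "u = v" using 2 by (simp add: vec_eq_iff forall_2)
  qed
  have "e v* ?M \<in> {c. c v* ?\<Theta> = 0}" for e
  proof -
    have "(e v* ?M) v* ?\<Theta> = e $ 1 *s (\<alpha>1 *s x + f v* T) + e $ 2 *s (g *s x + \<alpha>2 *s y + h v* T)"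
      unfolding \<Theta> M1 M2 Mt by (simp add: vector_matrix_mult_simps vec_eq_iff algebra_simps)
    then show ?thesis by (simp add: rel)
  qed
  moreover have "c \<in> range (\<lambda>e. e v* ?M)" if "c v* ?\<Theta> = 0" for c
  proof -
    have c: "c $ 1 *s x + c $ 2 *s y + tail c v* T = 0" using that unfolding \<Theta> .
    then obtain r u where ru: "c $ 1 = r * \<alpha>1 + u * g" "c $ 2 = u * \<alpha>2" using syz by blast
    have "(tail c - (r *s f + u *s h)) v* T = (c $ 1 *s x + c $ 2 *s y + tail c v* T)
        - r *s (\<alpha>1 *s x + f v* T) - u *s (g *s x + \<alpha>2 *s y + h v* T)"
      unfolding ru by (simp add: vector_matrix_mult_simps vec_eq_iff algebra_simps)
    also have "\<dots> = 0" using c rel by simp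
    finally have t: "tail c = r *s f + u *s h" using indep by fastforce
    let ?e = "vector [r, u] :: (3, 'k) mpoly ^ 2"
    have "tail (?e v* ?M) = tail c" unfolding Mt t by simp
    moreover have "(?e v* ?M) $ 1 = c $ 1" "(?e v* ?M) $ 2 = c $ 2" unfolding M1 M2 ru by simp_all
    ultimately have "c = ?e v* ?M"
      unfolding vec_eq_iff forall_5 using tail by metis
    then show ?thesis by blast
  qed
  ultimately have ker: "range (\<lambda>e. e v* ?M) = {c. c v* ?\<Theta> = 0}" by blast
  have img: "range (\<lambda>c. c v* ?\<Theta>) = D"
  proof (intro equalityI subsetI)
    fix z assume "z \<in> range (\<lambda>c. c v* ?\<Theta>)"
    then show "z \<in> D" unfolding D \<Theta> by blast
  next
    fix z assume "z \<in> D"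
    then obtain s t c where "z = s *s x + t *s y + c v* T" unfolding D by blast
    moreover have "tail (vector [s, t, c $ 1, c $ 2, c $ 3]) = c"
      unfolding vec_eq_iff forall_3 tail by simp
    ultimately have "z = vector [s, t, c $ 1, c $ 2, c $ 3] v* ?\<Theta>" unfolding \<Theta> by simp
    then show "z \<in> range (\<lambda>c. c v* ?\<Theta>)" by blast
  qed
  show ?thesis
    unfolding minimal_free_resolution_def
  proof (intro exI[of _ ?\<Theta>] conjI)
    show "\<forall>j i. ?M $ j $ i \<in> graded_part (vector [b1, b2] $ j - vector [e1, e2, d 1, d 2, d 3] $ i)"
      unfolding forall_2 forall_5 using deg by simp
    show "\<forall>i. homogeneous_deriv ((vector [e1, e2, d 1, d 2, d 3] :: int ^ 5) $ i) (?\<Theta> $ i)"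
      unfolding forall_5 using hom by simp
    show "\<forall>j i. const_term (?M $ j $ i) = 0"
      unfolding forall_2 forall_5 using min by simp
  qed (fact inj ker img)+
qed

lemma one_relation_resolution_vector:
  fixes f :: "(3, 'k::field) mpoly ^ 3"
  assumes "minimal_free_resolution ((\<chi> j. b) :: int ^ 1)
      (\<chi> i. case i of None \<Rightarrow> e | Some k \<Rightarrow> d k)
      (\<chi> j i. case i of None \<Rightarrow> \<alpha> | Some k \<Rightarrow> f $ k) D"
  shows "minimal_free_resolution (vector [b] :: int ^ 1) (vector [e, d 1, d 2, d 3] :: int ^ 4)
      (vector [vector [\<alpha>, f $ 1, f $ 2, f $ 3]]) D"
proof -
  define \<pi> :: "4 \<Rightarrow> 3 option" where
    "\<pi> = (\<lambda>i. if i = 1 then None else if i = 2 then Some 1 else if i = 3 then Some 2 else Some 3)"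
  have \<pi>: "\<pi> 1 = None" "\<pi> 2 = Some 1" "\<pi> 3 = Some 2" "\<pi> 4 = Some 3"
    by (simp_all add: \<pi>_def)
  have "\<exists>i. \<pi> i = y" for y
  proof (cases y)
    case None
    then show ?thesis using \<pi> by blast
  next
    case (Some k)
    then show ?thesis using exhaust_3[of k] \<pi> by metis
  qed
  then have "surj \<pi>" by (metis surjI)
  moreover have "inj \<pi>"
    unfolding inj_def forall_4 \<pi> by simp
  ultimately have "bij \<pi>" by (simp add: bij_def)
  from minimal_resolution_reindex[OF assms this]
  have "minimal_free_resolution ((\<chi> j. b) :: int ^ 1)
      (\<chi> i. (\<chi> i. case i of None \<Rightarrow> e | Some k \<Rightarrow> d k) $ \<pi> i)
      (\<chi> j i. (\<chi> j i. case i of None \<Rightarrow> \<alpha> | Some k \<Rightarrow> f $ k) $ j $ \<pi> i) D" .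
  moreover have "((\<chi> j. b) :: int ^ 1) = vector [b]" by (simp add: vec_eq_iff)
  moreover have "(\<chi> i. (\<chi> i. case i of None \<Rightarrow> e | Some k \<Rightarrow> d k) $ \<pi> i) = (vector [e, d 1, d 2, d 3] :: int ^ 4)"
    by (simp add: vec_eq_iff forall_4 \<pi>)
  moreover have "((\<chi> j i. (\<chi> j i. case i of None \<Rightarrow> \<alpha> | Some k \<Rightarrow> f $ k) $ j $ \<pi> i) :: (3, 'k) mpoly ^ 4 ^ 1)
      = vector [vector [\<alpha>, f $ 1, f $ 2, f $ 3]]"
    by (simp add: vec_eq_iff forall_4 \<pi>)
  ultimately show ?thesis by simp
qed

text \<open>
  The definition of SPOG distinguishes a generator of degree one less than the relation, with nonzero
  coefficient; any generator with these properties can be moved to the distinguished place.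
\<close>

lemma SPOG_of_resolution:
  fixes f :: "(3, 'k::field) mpoly ^ 3"
  assumes res: "minimal_free_resolution ((\<chi> j. int c + 1) :: int ^ 1)
      (\<chi> i. case i of None \<Rightarrow> int e | Some k \<Rightarrow> int (d $ k))
      (\<chi> j i. case i of None \<Rightarrow> \<alpha> | Some k \<Rightarrow> f $ k) (log_derivs A)"
    and i: "d $ i = c" "f $ i \<noteq> 0"
  shows "\<exists>p. SPOG A p c"
proof -
  define \<pi> where "\<pi> = (\<lambda>j. if j = None then Some i else if j = Some i then None else j)"
  have "\<pi> (\<pi> j) = j" for j by (auto simp: \<pi>_def)
  then have "bij \<pi>" by (rule involuntory_imp_bij)
  from minimal_resolution_reindex[OF res this]
  have "minimal_free_resolution ((\<chi> j. int c + 1) :: int ^ 1)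
      (\<chi> j. (\<chi> j. case j of None \<Rightarrow> int e | Some k \<Rightarrow> int (d $ k)) $ \<pi> j)
      (\<chi> l j. (\<chi> l j. case j of None \<Rightarrow> \<alpha> | Some k \<Rightarrow> f $ k) $ l $ \<pi> j) (log_derivs A)" .
  moreover have "(\<chi> j. (\<chi> j. case j of None \<Rightarrow> int e | Some k \<Rightarrow> int (d $ k)) $ \<pi> j)
      = (\<chi> j. case j of None \<Rightarrow> int c | Some k \<Rightarrow> int ((\<chi> k. if k = i then e else d $ k) $ k))"
    by (auto simp: vec_eq_iff \<pi>_def i split: option.split)
  moreover have "((\<chi> l j. (\<chi> l j. case j of None \<Rightarrow> \<alpha> | Some k \<Rightarrow> f $ k) $ l $ \<pi> j) :: (3, 'k) mpoly ^ 3 option ^ 1)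
      = (\<chi> l j. case j of None \<Rightarrow> f $ i | Some k \<Rightarrow> (\<chi> k. if k = i then \<alpha> else f $ k) $ k)"
    by (auto simp: vec_eq_iff \<pi>_def split: option.split)
  ultimately have "minimal_free_resolution ((\<chi> j. int c + 1) :: int ^ 1)
      (\<chi> j. case j of None \<Rightarrow> int c | Some k \<Rightarrow> int ((\<chi> k. if k = i then e else d $ k) $ k))
      (\<chi> l j. case j of None \<Rightarrow> f $ i | Some k \<Rightarrow> (\<chi> k. if k = i then \<alpha> else f $ k) $ k) (log_derivs A)"
    by (simp only:)
  then have "SPOG A (\<chi> k. if k = i then e else d $ k) c"
    unfolding SPOG_def using i(2)
    by (intro exI[of _ "f $ i"] exI[of _ "\<chi> k. if k = i then \<alpha> else f $ k"] conjI)
  then show ?thesis by blast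
qed

section \<open>The resolutions of a double deletion\<close>

context two_deletions begin

text \<open>
  The relations \<open>\<alpha>1 \<phi>1 \<in> D(A)\<close> and \<open>\<alpha>2 \<phi>2 \<in> D(A)\<close> generate all others, because
  \<open>D(A - {H1}) \<inter> D(A - {H2}) = D(A)\<close>: the sum modulo \<open>D(A)\<close> is direct.
\<close>

lemma generic_resolution:
  fixes f h :: "(3, 'k) mpoly ^ 3"
  assumes dec: "\<And>x. x \<in> D12 \<Longrightarrow> decomposable x"
    and f: "\<alpha>1 *s \<phi>1 = f v* T" "\<And>i. const_term (f $ i) = 0"
    and h: "\<alpha>2 *s \<phi>2 = h v* T" "\<And>i. const_term (h $ i) = 0"
  shows "minimal_free_resolution (vector [int c1 + 1, int c2 + 1] :: int ^ 2)
      (vector [int c1, int c2, int (d $ 1), int (d $ 2), int (d $ 3)] :: int ^ 5)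
      (vector [vector [\<alpha>1, 0, (- f) $ 1, (- f) $ 2, (- f) $ 3],
               vector [0, \<alpha>2, (- h) $ 1, (- h) $ 2, (- h) $ 3]]) D12"
proof (rule two_relations_resolution[where d = "\<lambda>i. int (d $ i)"])
  show "z \<in> D12 \<longleftrightarrow> (\<exists>s t c. z = s *s \<phi>1 + t *s \<phi>2 + c v* T)" for z
  proof
    assume "z \<in> D12"
    then show "\<exists>s t c. z = s *s \<phi>1 + t *s \<phi>2 + c v* T" using dec unfolding decomposable_def by blast
  next
    assume "\<exists>s t c. z = s *s \<phi>1 + t *s \<phi>2 + c v* T"
    then show "z \<in> D12"
      using D12_superset(1)[OF D1.generatorD(1)[OF gen1(1)]] D12_superset(2)[OF D2.generatorD(1)[OF gen2(1)]]
        D12_superset(1)[OF D1.T_log_deletion]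
      by (auto intro!: log_derivs_add log_derivs_scale)
  qed
  show "\<exists>r u. s = r * \<alpha>1 + u * 0 \<and> t = u * \<alpha>2" if 0: "s *s \<phi>1 + t *s \<phi>2 + c v* T = 0" for s t c
  proof -
    have "(\<alpha>1 * t) *s \<phi>2 = \<alpha>1 *s (s *s \<phi>1 + t *s \<phi>2 + c v* T) - (s *s f + \<alpha>1 *s c) v* T"
      by (simp add: vector_matrix_mult_simps f(1)[symmetric] vec_eq_iff algebra_simps)
    also have "\<dots> = (- (s *s f + \<alpha>1 *s c)) v* T" unfolding 0 by (simp only: vector_matrix_mult_uminus vector_smult_rzero diff_0)
    finally have "(\<alpha>1 * t) *s \<phi>2 \<in> log_derivs A" using D1.T_log by simp
    then have "\<alpha>2 dvd \<alpha>1 * t" using D2.smult_log_iff D2.generatorD(1,2)[OF gen2(1)] by blast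
    then have "\<alpha>2 dvd t" using D2.form_prime D1.not_dvd(2) prime_elem_dvd_multD by blast
    then obtain u where u: "t = u * \<alpha>2" by (metis dvdE mult.commute)
    have "s *s \<phi>1 + (u *s h + c) v* T = s *s \<phi>1 + t *s \<phi>2 + c v* T"
      by (simp add: u vector_matrix_mult_simps h(1)[symmetric] vector_smult_assoc add.assoc)
    then have "\<alpha>1 dvd s" using D1.generator_syzygy[OF gen1(1)] 0 by metis
    then show ?thesis using u by (metis dvdE mult.commute mult_zero_right add.right_neutral)
  qed
  have hom1: "homogeneous_deriv (1 + int c1) (f v* T)"
    unfolding f(1)[symmetric] by (rule homogeneous_scale[OF D1.\<alpha>(1) gen1(2)])
  show "(- f) $ i \<in> graded_part (int c1 + 1 - int (d $ i))" for i
    using D1.coords_graded[OF hom1, of i] by (simp add: graded_uminus add.commute)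
  have hom2: "homogeneous_deriv (1 + int c2) (h v* T)"
    unfolding h(1)[symmetric] by (rule homogeneous_scale[OF D2.\<alpha>(1) gen2(2)])
  show "(- h) $ i \<in> graded_part (int c2 + 1 - int (d $ i))" for i
    using D1.coords_graded[OF hom2, of i] by (simp add: graded_uminus add.commute)
  show "\<alpha>1 *s \<phi>1 + (- f) v* T = 0" "0 *s \<phi>1 + \<alpha>2 *s \<phi>2 + (- h) v* T = 0"
    by (simp_all add: f(1) h(1) vector_matrix_mult_uminus)
qed (use D1.T_indep D1.T_hom gen1(2) gen2(2) D1.form_nonzero D2.form_nonzero D1.\<alpha>(1) D2.\<alpha>(1)
    D1.const_term_form D2.const_term_form f(2) h(2) in simp_all)

text \<open>
  The coefficient \<open>h\<close> is nonzero: otherwise \<open>\<psi> \<in> D(A - {H2})\<close>, which is impossible because this module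
  is generated over \<open>D(A)\<close> by the proper multiple \<open>\<alpha>1 \<psi>\<close> of \<open>\<psi>\<close>.
\<close>

lemma special_relation:
  assumes \<psi>: "\<psi> \<in> D12" "homogeneous_deriv (int c2 - 1) \<psi>" "D2.generator (\<alpha>1 *s \<psi>)"
  obtains h f where "\<alpha>2 *s \<psi> = h *s \<phi>1 + f v* T" "h \<noteq> 0" "h \<in> graded_part (int c2 - int c1)"
    "\<And>i. f $ i \<in> graded_part (int c2 - int (d $ i))"
proof -
  have hom: "homogeneous_deriv (int c2) (\<alpha>2 *s \<psi>)"
    using homogeneous_scale[OF D2.\<alpha>(1) \<psi>(2)] by simp
  obtain h f where hf: "\<alpha>2 *s \<psi> = h *s \<phi>1 + f v* T" "h \<in> graded_part (int c2 - int c1)"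
    using D1.generator_coords_hom[OF gen1 _ hom] \<psi>(1) D12_iff2 by metis
  have "f v* T = \<alpha>2 *s \<psi> - h *s \<phi>1" by (simp add: hf(1))
  moreover have "homogeneous_deriv (int c2) (h *s \<phi>1)"
    using homogeneous_scale[OF hf(2) gen1(2)] by simp
  ultimately have "homogeneous_deriv (int c2) (f v* T)" using hom homogeneous_diff by metis
  then have f: "f $ i \<in> graded_part (int c2 - int (d $ i))" for i by (rule D1.coords_graded)
  have "h \<noteq> 0"
  proof
    assume "h = 0"
    then have "\<alpha>2 *s \<psi> \<in> log_derivs A" using hf(1) D1.T_log by simp
    then have "\<psi> \<in> log_derivs (A - {H2})" by (simp add: D2.deletion_iff)
    then obtain s c where sc: "\<psi> = s *s (\<alpha>1 *s \<psi>) + c v* T" using D2.generatorD(3)[OF \<psi>(3)] by blast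
    have "(1 - s * \<alpha>1) *s \<psi> = \<psi> - s *s (\<alpha>1 *s \<psi>)" by (simp add: vec_eq_iff algebra_simps)
    also have "\<dots> = c v* T" using sc by (metis add_diff_cancel_left')
    finally have "(1 - s * \<alpha>1) *s \<psi> \<in> log_derivs A" using D1.T_log by simp
    moreover have "\<psi> \<notin> log_derivs A" using D2.generatorD(2)[OF \<psi>(3)] log_derivs_scale by blast
    ultimately have "\<alpha>2 dvd 1 - s * \<alpha>1"
      using D2.smult_log_iff \<open>\<psi> \<in> log_derivs (A - {H2})\<close> by blast
    then obtain r where "1 - s * \<alpha>1 = \<alpha>2 * r" by blast
    from arg_cong[OF this, of const_term]
    show False by (simp add: D1.const_term_form D2.const_term_form)
  qed
  then show ?thesis using that hf f by blast
qed

text \<open>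
  Multiplication by \<open>\<alpha>1\<close> maps \<open>D(A - {H1, H2})\<close> into \<open>D(A - {H2})\<close>, which modulo \<open>D(A)\<close> is generated by
  \<open>\<alpha>1 \<psi>\<close>; what it sends to \<open>D(A)\<close> is \<open>D(A - {H1})\<close>.
\<close>

lemma special_combination:
  assumes \<psi>: "\<psi> \<in> D12" "D2.generator (\<alpha>1 *s \<psi>)" and x: "x \<in> D12"
  shows "\<exists>s t c. x = s *s \<phi>1 + t *s \<psi> + c v* T"
proof -
  obtain t c where tc: "\<alpha>1 *s x = t *s (\<alpha>1 *s \<psi>) + c v* T"
    using D2.generatorD(3)[OF \<psi>(2)] x D12_iff1 by metis
  have "\<alpha>1 *s (x - t *s \<psi>) = c v* T"
    unfolding vector_ssub_ldistrib tc by (simp add: vec_eq_iff algebra_simps)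
  then have "x - t *s \<psi> \<in> log_derivs (A - {H1})" using D1.T_log by (simp add: D1.deletion_iff)
  then obtain s c' where "x - t *s \<psi> = s *s \<phi>1 + c' v* T" using D1.generatorD(3)[OF gen1(1)] by blast
  then have "x = s *s \<phi>1 + t *s \<psi> + c' v* T" by (simp add: algebra_simps)
  then show ?thesis by blast
qed

text \<open>
  Multiplying the syzygy by \<open>\<alpha>1\<close> removes \<open>\<phi>1\<close> modulo \<open>D(A)\<close> and shows that \<open>\<alpha>2\<close> divides \<open>t\<close>.  Then \<open>t \<psi>\<close> can
  be rewritten as a multiple of \<open>\<phi>1\<close>.
\<close>

lemma special_syzygy:
  assumes \<psi>: "D2.generator (\<alpha>1 *s \<psi>)" "\<alpha>2 *s \<psi> = h *s \<phi>1 + f v* T"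
    and 0: "s *s \<phi>1 + t *s \<psi> + c v* T = 0"
  obtains r u where "s = r * \<alpha>1 + u * (- h)" "t = u * \<alpha>2"
proof -
  obtain k where k: "\<alpha>1 *s \<phi>1 = k v* T" using D1.generator_coords[OF gen1(1)] .
  have "t *s (\<alpha>1 *s \<psi>) + (s *s k + \<alpha>1 *s c) v* T = \<alpha>1 *s (s *s \<phi>1 + t *s \<psi> + c v* T)"
    by (simp add: vector_matrix_mult_simps k[symmetric] vec_eq_iff algebra_simps)
  then have "\<alpha>2 dvd t" using D2.generator_syzygy[OF \<psi>(1)] 0 by (metis vector_smult_rzero)
  then obtain u where u: "t = u * \<alpha>2" by (metis dvdE mult.commute)
  have "(s + u * h) *s \<phi>1 + (u *s f + c) v* T = s *s \<phi>1 + u *s (\<alpha>2 *s \<psi>) + c v* T"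
    unfolding \<psi>(2) by (simp add: vector_matrix_mult_simps vec_eq_iff algebra_simps)
  also have "\<dots> = 0" using 0 by (simp add: u vector_smult_assoc)
  finally have "\<alpha>1 dvd s + u * h" using D1.generator_syzygy[OF gen1(1)] by blast
  then obtain r where "s + u * h = \<alpha>1 * r" by blast
  then have "s = r * \<alpha>1 + u * (- h)" by (simp add: algebra_simps)
  then show ?thesis using u that by blast
qed

text \<open>
  The coefficients of the second relation have no constant terms for degree reasons: their degrees are
  \<open>c2 - c1\<close> and \<open>c2 - d $ i \<ge> c2 - c1\<close>.
\<close>

lemma special_resolution_less:
  assumes \<psi>: "\<psi> \<in> D12" "homogeneous_deriv (int c2 - 1) \<psi>" "D2.generator (\<alpha>1 *s \<psi>)"
    and less: "c1 < c2"
    and f: "\<alpha>1 *s \<phi>1 = f v* T" "\<And>i. const_term (f $ i) = 0"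
  shows "\<exists>g (h :: (3, 'k) mpoly ^ 3). g \<noteq> 0 \<and> minimal_free_resolution (vector [int c1 + 1, int c2] :: int ^ 2)
      (vector [int c1, int c2 - 1, int (d $ 1), int (d $ 2), int (d $ 3)] :: int ^ 5)
      (vector [vector [\<alpha>1, 0, (- f) $ 1, (- f) $ 2, (- f) $ 3],
               vector [g, \<alpha>2, h $ 1, h $ 2, h $ 3]]) D12"
proof -
  obtain g h where rel: "\<alpha>2 *s \<psi> = g *s \<phi>1 + h v* T" and g: "g \<noteq> 0" "g \<in> graded_part (int c2 - int c1)"
    and h: "\<And>i. h $ i \<in> graded_part (int c2 - int (d $ i))"
    using special_relation[OF \<psi>] by blast
  have d_le: "d $ i \<le> c1" for i using D1.generator_degree_bounds(1)[OF gen1 f] .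
  have "minimal_free_resolution (vector [int c1 + 1, int c2] :: int ^ 2)
      (vector [int c1, int c2 - 1, int (d $ 1), int (d $ 2), int (d $ 3)] :: int ^ 5)
      (vector [vector [\<alpha>1, 0, (- f) $ 1, (- f) $ 2, (- f) $ 3],
               vector [- g, \<alpha>2, (- h) $ 1, (- h) $ 2, (- h) $ 3]]) D12"
  proof (rule two_relations_resolution[where d = "\<lambda>i. int (d $ i)"])
    show "z \<in> D12 \<longleftrightarrow> (\<exists>s t c. z = s *s \<phi>1 + t *s \<psi> + c v* T)" for z
    proof
      assume "z \<in> D12"
      then show "\<exists>s t c. z = s *s \<phi>1 + t *s \<psi> + c v* T" by (rule special_combination[OF \<psi>(1,3)])
    next
      assume "\<exists>s t c. z = s *s \<phi>1 + t *s \<psi> + c v* T"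
      then show "z \<in> D12"
        using D12_superset(1)[OF D1.generatorD(1)[OF gen1(1)]] \<psi>(1) D12_superset(1)[OF D1.T_log_deletion]
        by (auto intro!: log_derivs_add log_derivs_scale)
    qed
    show "\<exists>r u. s = r * \<alpha>1 + u * (- g) \<and> t = u * \<alpha>2" if "s *s \<phi>1 + t *s \<psi> + c v* T = 0" for s t c
      using special_syzygy[OF \<psi>(3) rel that] by blast
    have hom1: "homogeneous_deriv (1 + int c1) (f v* T)"
      unfolding f(1)[symmetric] by (rule homogeneous_scale[OF D1.\<alpha>(1) gen1(2)])
    show "(- f) $ i \<in> graded_part (int c1 + 1 - int (d $ i))" for i
      using D1.coords_graded[OF hom1, of i] by (simp add: graded_uminus add.commute)
    show "(- h) $ i \<in> graded_part (int c2 - int (d $ i))" for i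
      using h by (simp add: graded_uminus)
    show "- g \<in> graded_part (int c2 - int c1)" using g(2) by (rule graded_uminus)
    show "const_term (- g) = 0" using const_term_graded[OF g(2)] less by simp
    show "const_term ((- h) $ i) = 0" for i
      using const_term_graded[OF h[of i]] less d_le[of i] by simp
    show "\<alpha>1 *s \<phi>1 + (- f) v* T = 0" by (simp add: f(1) vector_matrix_mult_uminus)
    show "(- g) *s \<phi>1 + \<alpha>2 *s \<psi> + (- h) v* T = 0"
      by (simp add: rel vector_matrix_mult_uminus vec_eq_iff)
  qed (use D1.T_indep D1.T_hom gen1(2) \<psi>(2) D1.form_nonzero D2.form_nonzero D1.\<alpha>(1) D2.\<alpha>(1)
      D1.const_term_form D2.const_term_form f(2) in simp_all)
  then show ?thesis using g(1) by (intro exI[of _ "- g"] exI[of _ "- h"] conjI) simp_all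
qed

text \<open>
  For \<open>c1 = c2\<close> the coefficient of \<open>\<phi>1\<close> in \<open>\<alpha>2 \<psi>\<close> has degree \<open>0\<close>, so it is a unit and \<open>\<phi>1\<close> is redundant.
\<close>

lemma special_resolution_equal:
  assumes \<psi>: "\<psi> \<in> D12" "homogeneous_deriv (int c2 - 1) \<psi>" "D2.generator (\<alpha>1 *s \<psi>)"
    and equal: "c1 = c2"
    and f: "\<alpha>2 *s (\<alpha>1 *s \<psi>) = f v* T" "\<And>i. const_term (f $ i) = 0"
  shows "minimal_free_resolution ((\<chi> j. int c1 + 1) :: int ^ 1)
      (\<chi> i. case i of None \<Rightarrow> int c1 - 1 | Some k \<Rightarrow> int (d $ k))
      (\<chi> j i. case i of None \<Rightarrow> \<alpha>1 * \<alpha>2 | Some k \<Rightarrow> (- f) $ k) D12"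
    and "f $ i \<in> graded_part (int c1 + 1 - int (d $ i))"
proof -
  obtain g h where rel: "\<alpha>2 *s \<psi> = g *s \<phi>1 + h v* T" and g: "g \<noteq> 0" "g \<in> graded_part (int c2 - int c1)"
    using special_relation[OF \<psi>] by metis
  have "g = cpoly (const_term g)" using g(2) equal graded_0_const by simp
  then have nz: "const_term g \<noteq> 0" and gc: "g = cpoly (const_term g)" using g(1) by (metis cpoly_eq_0_iff)+
  define k :: "(3, 'k) mpoly" where "k = cpoly (inverse (const_term g))"
  have kg: "k * g = 1" using nz by (subst gc) (simp add: k_def cpoly_inverse mult.commute)
  have \<phi>1: "\<phi>1 = (k * \<alpha>2) *s \<psi> + (- (k *s h)) v* T"
  proof -
    have "(k * \<alpha>2) *s \<psi> = k *s (g *s \<phi>1 + h v* T)" by (simp add: rel[symmetric] vector_smult_assoc)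
    also have "\<dots> = \<phi>1 + (k *s h) v* T"
      by (simp add: vector_add_ldistrib vector_smult_assoc kg vector_matrix_mult_simps)
    finally show ?thesis by (simp add: vector_matrix_mult_uminus)
  qed
  have hom: "homogeneous_deriv (1 + (1 + (int c2 - 1))) (f v* T)"
    unfolding f(1)[symmetric] by (rule homogeneous_scale[OF D2.\<alpha>(1) homogeneous_scale[OF D1.\<alpha>(1) \<psi>(2)]])
  show deg: "f $ i \<in> graded_part (int c1 + 1 - int (d $ i))" for i
    using D1.coords_graded[OF hom, of i] equal by (simp add: add.commute)
  show "minimal_free_resolution ((\<chi> j. int c1 + 1) :: int ^ 1)
      (\<chi> i. case i of None \<Rightarrow> int c1 - 1 | Some k \<Rightarrow> int (d $ k))
      (\<chi> j i. case i of None \<Rightarrow> \<alpha>1 * \<alpha>2 | Some k \<Rightarrow> (- f) $ k) D12"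
  proof (rule one_relation_resolution)
    show "z \<in> D12 \<longleftrightarrow> (\<exists>s c. z = s *s \<psi> + c v* T)" for z
    proof
      assume "z \<in> D12"
      then obtain s t c where "z = s *s \<phi>1 + t *s \<psi> + c v* T" using special_combination[OF \<psi>(1,3)] by blast
      also have "\<dots> = s *s ((k * \<alpha>2) *s \<psi> + (- (k *s h)) v* T) + t *s \<psi> + c v* T"
        using \<phi>1 by metis
      also have "\<dots> = (s * (k * \<alpha>2) + t) *s \<psi> + (c - s *s (k *s h)) v* T"
        by (simp add: vector_matrix_mult_simps vec_eq_iff algebra_simps)
      finally show "\<exists>s c. z = s *s \<psi> + c v* T" by blast
    next
      assume "\<exists>s c. z = s *s \<psi> + c v* T"
      then show "z \<in> D12"
        using \<psi>(1) D12_superset(1)[OF D1.T_log_deletion] by (auto intro!: log_derivs_add log_derivs_scale)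
    qed
    show "\<alpha>1 * \<alpha>2 dvd s" if 0: "s *s \<psi> + c v* T = 0" for s c
    proof -
      have "0 *s \<phi>1 + s *s \<psi> + c v* T = 0" using 0 by simp
      then obtain r u where ru: "0 = r * \<alpha>1 + u * (- g)" "s = u * \<alpha>2" by (rule special_syzygy[OF \<psi>(3) rel])
      have "u = (k * g) * u" by (simp add: kg)
      also have "\<dots> = \<alpha>1 * (k * r)" using ru(1) by (simp add: algebra_simps)
      finally have "s = (\<alpha>1 * \<alpha>2) * (k * r)" unfolding ru(2) by (simp add: mult_ac)
      then show ?thesis by simp
    qed
    show "\<alpha>1 * \<alpha>2 \<in> graded_part (int c1 + 1 - (int c1 - 1))"
      using graded_mult[OF D1.\<alpha>(1) D2.\<alpha>(1)] by simp
    show "(- f) $ i \<in> graded_part (int c1 + 1 - int (d $ i))" for i using deg by (simp add: graded_uminus)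
    show "(\<alpha>1 * \<alpha>2) *s \<psi> + (- f) v* T = 0"
      by (simp add: vector_matrix_mult_uminus f(1)[symmetric] vector_smult_assoc mult.commute)
  qed (use D1.T_indep D1.T_hom \<psi>(2) equal D1.form_nonzero D2.form_nonzero
      D1.const_term_form f(2) in simp_all)
qed

end

theorem theorem1p8:
  fixes A :: "('k::field ^ 3) set set"
    and H1 H2 :: "('k ^ 3) set"
    and \<alpha>1 \<alpha>2 :: "(3, 'k) mpoly"
    and d1 d2 d3 c1 c2 :: nat
  assumes "arrangement A"
    and "free_with_exponents A (vector [d1, d2, d3])"
    and "H1 \<in> A" and "H2 \<in> A" and "H1 \<noteq> H2"
    and "\<alpha>1 \<in> graded_part 1" and "H1 = zero_locus \<alpha>1"
    and "\<alpha>2 \<in> graded_part 1" and "H2 = zero_locus \<alpha>2"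
    and "\<exists>p. SPOG (A - {H1}) p c1"
    and "\<exists>p. SPOG (A - {H2}) p c2"
    and "c1 \<le> c2"
  shows "\<not> free_arrangement (A - {H1, H2}) \<and>
    (card (localization A (H1 \<inter> H2)) = 2 \<longrightarrow>
      (\<exists>f1 f2 f3 g1 g2 g3.
        minimal_free_resolution
          (vector [int c1 + 1, int c2 + 1] :: int ^ 2)
          (vector [int c1, int c2, int d1, int d2, int d3] :: int ^ 5)
          (vector [vector [\<alpha>1, 0, f1, f2, f3],
                   vector [0, \<alpha>2, g1, g2, g3]])
          (log_derivs (A - {H1, H2})))) \<and>
    (card (localization A (H1 \<inter> H2)) > 2 \<longrightarrow>
      (c1 = c2 \<longrightarrow>
        (\<exists>f1 f2 f3.
          minimal_free_resolution
            (vector [int c1 + 1] :: int ^ 1)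
            (vector [int c1 - 1, int d1, int d2, int d3] :: int ^ 4)
            (vector [vector [\<alpha>1 * \<alpha>2, f1, f2, f3]])
            (log_derivs (A - {H1, H2})) \<and>
          ((\<exists>p d. SPOG (A - {H1, H2}) p d) \<longleftrightarrow> c1 = Max {d1, d2, d3}) \<and>
          ((\<exists>p d. SPOG (A - {H1, H2}) p d) \<and> d2 = Max {d1, d2, d3} \<longrightarrow>
            f2 \<in> graded_part 1))) \<and>
      (c1 < c2 \<longrightarrow>
        (\<exists>f1 f2 f3 g1 g2 g3 g.
          g \<noteq> 0 \<and>
          minimal_free_resolution
            (vector [int c1 + 1, int c2] :: int ^ 2)
            (vector [int c1, int c2 - 1, int d1, int d2, int d3] :: int ^ 5)
            (vector [vector [\<alpha>1, 0, f1, f2, f3],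
                     vector [g, \<alpha>2, g1, g2, g3]])
            (log_derivs (A - {H1, H2})))))"
proof -
  let ?d = "vector [d1, d2, d3] :: nat ^ 3"
  let ?B = "A - {H1, H2}" and ?L = "localization A (H1 \<inter> H2)"
  obtain T where T: "range (\<lambda>c. c v* T) = log_derivs A" "\<And>c. c v* T = 0 \<Longrightarrow> c = 0"
    "\<And>i. homogeneous_deriv (int (?d $ i)) (T $ i)"
    by (rule free_basis[OF assms(2)]) blast
  interpret D1: free_deletion A H1 \<alpha>1 H2 \<alpha>2 T ?d
    by (unfold_locales; (fact assms T assms(5)[symmetric])?)
  interpret D2: free_deletion A H2 \<alpha>2 H1 \<alpha>1 T ?d
    by (unfold_locales; (fact assms T)?)
  obtain p1 p2 where spog: "SPOG (A - {H1}) p1 c1" "SPOG (A - {H2}) p2 c2" using assms(10,11) by blast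
  obtain \<phi>1 where \<phi>1: "D1.generator \<phi>1" "homogeneous_deriv (int c1) \<phi>1"
    by (rule D1.SPOG_generator[OF spog(1)])
  obtain \<phi>2 where \<phi>2: "D2.generator \<phi>2" "homogeneous_deriv (int c2) \<phi>2"
    by (rule D2.SPOG_generator[OF spog(2)])
  obtain \<gamma> p q w where fr: "linear_frame \<alpha>1 \<alpha>2 \<gamma> p q w"
    by (rule linear_frame_exists[OF assms(6,8) D1.form_nonzero D1.not_dvd(1)])
  interpret two_deletions A H1 H2 \<alpha>1 \<alpha>2 T ?d \<gamma> p q w \<phi>1 \<phi>2 c1 c2
    using D1.free_deletion_axioms D2.free_deletion_axioms fr \<phi>1 \<phi>2
    by (intro two_deletions.intro two_deletions_axioms.intro)
  obtain f where f: "\<alpha>1 *s \<phi>1 = f v* T" by (rule D1.generator_coords[OF \<phi>1(1)])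
  have f_min: "const_term (f $ i) = 0" for i by (rule D1.SPOG_min[OF spog(1) \<phi>1 f])
  have fin: "finite ?L" using assms(1) by (simp add: localization_def arrangement_def)
  have sub: "{H1, H2} \<subseteq> ?L" using assms(3,4) by (auto simp: localization_def)
  have card2: "card {H1, H2} = 2" using assms(5) by simp
  have card_L: "card ?L \<ge> 2" using card_mono[OF fin sub] card2 by simp
  have generic: "\<exists>f1 f2 f3 g1 g2 g3.
        minimal_free_resolution
          (vector [int c1 + 1, int c2 + 1] :: int ^ 2)
          (vector [int c1, int c2, int d1, int d2, int d3] :: int ^ 5)
          (vector [vector [\<alpha>1, 0, f1, f2, f3], vector [0, \<alpha>2, g1, g2, g3]])
          (log_derivs ?B)"
    if "card ?L = 2"
  proof -
    have "?L = {H1, H2}" using card_seteq[OF fin sub] card2 that by simp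
    then have gen: "\<not> H1 \<inter> H2 \<subseteq> H" if "H \<in> ?B" for H
      using that by (auto simp: localization_def)
    obtain h where h: "\<alpha>2 *s \<phi>2 = h v* T" by (rule D2.generator_coords[OF \<phi>2(1)])
    have "const_term (h $ i) = 0" for i by (rule D2.SPOG_min[OF spog(2) \<phi>2 h])
    from generic_resolution[OF decomposable_if_generic[OF gen] f f_min h this]
    show ?thesis unfolding vector_3 by blast
  qed
  have special: "\<exists>\<psi>. \<psi> \<in> D12 \<and> homogeneous_deriv (int c2 - 1) \<psi> \<and> D2.generator (\<alpha>1 *s \<psi>)"
    if "card ?L > 2"
  proof -
    have "\<not> ?L \<subseteq> {H1, H2}" using card_mono[of "{H1, H2}" ?L] card2 that by auto
    then obtain H3 where "H3 \<in> ?B" "H1 \<inter> H2 \<subseteq> H3" by (auto simp: localization_def)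
    then obtain x n where "x \<in> D12" "homogeneous_deriv (int n) x" "\<not> decomposable x"
      by (rule indecomposable_if_special)
    then show ?thesis using indecomposable_element[OF assms(12)] by metis
  qed
  have less: "\<exists>f1 f2 f3 g1 g2 g3 g. g \<noteq> 0 \<and>
        minimal_free_resolution
          (vector [int c1 + 1, int c2] :: int ^ 2)
          (vector [int c1, int c2 - 1, int d1, int d2, int d3] :: int ^ 5)
          (vector [vector [\<alpha>1, 0, f1, f2, f3], vector [g, \<alpha>2, g1, g2, g3]])
          (log_derivs ?B)"
    if card: "card ?L > 2" and lt: "c1 < c2"
  proof -
    obtain \<psi> where \<psi>: "\<psi> \<in> D12" "homogeneous_deriv (int c2 - 1) \<psi>" "D2.generator (\<alpha>1 *s \<psi>)"
      using special[OF card] by blast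
    show ?thesis using special_resolution_less[OF \<psi> lt f f_min] unfolding vector_3 by blast
  qed
  have equal: "\<exists>f1 f2 f3.
          minimal_free_resolution (vector [int c1 + 1] :: int ^ 1)
            (vector [int c1 - 1, int d1, int d2, int d3] :: int ^ 4)
            (vector [vector [\<alpha>1 * \<alpha>2, f1, f2, f3]]) (log_derivs ?B) \<and>
          ((\<exists>p d. SPOG ?B p d) \<longleftrightarrow> c1 = Max {d1, d2, d3}) \<and>
          ((\<exists>p d. SPOG ?B p d) \<and> d2 = Max {d1, d2, d3} \<longrightarrow> f2 \<in> graded_part 1)"
    if card: "card ?L > 2" and eq: "c1 = c2"
  proof -
    obtain \<psi> where \<psi>: "\<psi> \<in> D12" "homogeneous_deriv (int c2 - 1) \<psi>" "D2.generator (\<alpha>1 *s \<psi>)"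
      using special[OF card] by blast
    have hom: "homogeneous_deriv (int c2) (\<alpha>1 *s \<psi>)"
      using homogeneous_scale[OF assms(6) \<psi>(2)] by simp
    obtain h where h: "\<alpha>2 *s (\<alpha>1 *s \<psi>) = h v* T" by (rule D2.generator_coords[OF \<psi>(3)])
    have h_min: "const_term (h $ i) = 0" for i by (rule D2.SPOG_min[OF spog(2) \<psi>(3) hom h])
    note res = special_resolution_equal(1)[OF \<psi> eq h h_min]
    have h_deg: "h $ i \<in> graded_part (int c1 + 1 - int (?d $ i))" for i
      by (rule special_resolution_equal(2)[OF \<psi> eq h h_min])
    have bound: "?d $ i \<le> c1" for i
      using D2.generator_degree_bounds(1)[OF \<psi>(3) hom h h_min] eq by simp
    have bounds: "d1 \<le> c1" "d2 \<le> c1" "d3 \<le> c1" using bound[of 1] bound[of 2] bound[of 3] by simp_all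
    have max_iff: "c1 = Max {d1, d2, d3} \<longleftrightarrow> (\<exists>i. ?d $ i = c1)"
    proof
      assume "c1 = Max {d1, d2, d3}"
      then have "c1 \<in> {d1, d2, d3}" using Max_in[of "{d1, d2, d3}"] by simp
      then show "\<exists>i. ?d $ i = c1" by (metis empty_iff insertE vector_3)
    next
      assume "\<exists>i. ?d $ i = c1"
      then obtain i where "?d $ i = c1" by blast
      then have "c1 \<in> {d1, d2, d3}" using exhaust_3[of i] by auto
      then show "c1 = Max {d1, d2, d3}" using bounds by (intro Max_eqI[symmetric]) auto
    qed
    have spog_iff: "(\<exists>p d. SPOG ?B p d) \<longleftrightarrow> c1 = Max {d1, d2, d3}"
    proof
      assume "\<exists>p d. SPOG ?B p d"
      then obtain p c and a and r :: "(3, 'k) mpoly ^ 3" where res': "minimal_free_resolution ((\<chi> j. int c + 1) :: int ^ 1)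
        (\<chi> i. case i of None \<Rightarrow> int c | Some k \<Rightarrow> int (p $ k))
        (\<chi> j i. case i of None \<Rightarrow> a | Some k \<Rightarrow> r $ k) (log_derivs ?B)"
        unfolding SPOG_def by blast
      have c: "c = c1" using one_relation_resolution_unique(1)[OF res res'] by simp
      obtain i where "(case i of None \<Rightarrow> int c1 - 1 | Some k \<Rightarrow> int (?d $ k)) = int c"
        using one_relation_resolution_unique(2)[OF res res', of None] by auto
      then show "c1 = Max {d1, d2, d3}" unfolding max_iff using c by (cases i) auto
    next
      assume "c1 = Max {d1, d2, d3}"
      then obtain j where "?d $ j = c2" unfolding max_iff using eq by blast
      then obtain i where i: "?d $ i = c1" "h $ i \<noteq> 0"
        using D2.generator_degree_bounds(2)[OF \<psi>(3) hom h h_min] eq by blast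
      have "c1 \<ge> 1"
      proof -
        obtain k where "?d $ k \<ge> 1" by (rule D2.relation_coefficient_degree_pos[OF \<psi>(3) h])
        then show ?thesis using bound[of k] by simp
      qed
      then have "int c1 - 1 = int (c1 - 1)" by simp
      then show "\<exists>p d. SPOG ?B p d"
        using SPOG_of_resolution[OF res[unfolded \<open>int c1 - 1 = int (c1 - 1)\<close>] i(1)] i(2) by auto
    qed
    have "(- h) $ 2 \<in> graded_part 1" if "(\<exists>p d. SPOG ?B p d) \<and> d2 = Max {d1, d2, d3}"
    proof -
      have "d2 = c1" using that spog_iff by simp
      then have "h $ 2 \<in> graded_part 1" using h_deg[of 2] by simp
      then show ?thesis by (simp add: graded_uminus)
    qed
    with spog_iff one_relation_resolution_vector[OF res] show ?thesis unfolding vector_3 by blast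
  qed
  have "\<not> free_arrangement ?B"
  proof (cases "card ?L = 2")
    case True
    then show ?thesis using generic minimal_resolution_not_free by blast
  next
    case False
    then have "card ?L > 2" using card_L by simp
    show ?thesis
    proof (cases "c1 = c2")
      case True
      show ?thesis using equal[OF \<open>card ?L > 2\<close> True] minimal_resolution_not_free by blast
    next
      case False
      then have "c1 < c2" using assms(12) by simp
      show ?thesis using less[OF \<open>card ?L > 2\<close> \<open>c1 < c2\<close>] minimal_resolution_not_free by blast
    qed
  qed
  then show ?thesis
    by (intro conjI impI) (assumption, rule generic, assumption, rule equal, assumption+, rule less, assumption+)
qed

end
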